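(* $p(3,6)=4$. In particular, every ternary sextic form in $\mathbb{R}[x_1,x_2,x_3]$ that is a sum of squares of forms is a sum of four squares of (cubic) forms.
   Context: For $n\ge1$, $e\ge0$ let $\mathbb{R}[\mathtt{x}]_e$ denote the space of forms of degree $e$ in $\mathbb{R}[x_1,\dots,x_n]$. Let $\Sigma_{n,2d}\subseteq\mathbb{R}[\mathtt{x}]_{2d}$ be the set of forms of degree $2d$ that are finite sums of squares of forms in $\mathbb{R}[\mathtt{x}]_d$. For $f\in\Sigma_{n,2d}$ the sos length $\ell(f)$ is the smallest $r\ge0$ such that $f=p_1^2+\cdots+p_r^2$ for some $p_1,\dots,p_r\in\mathbb{R}[\mathtt{x}]_d$. The Pythagoras number is $p(n,2d)=\sup\{\ell(f)\colon f\in\Sigma_{n,2d}\}$. *)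

theory Defs
  imports "HOL-Library.Poly_Mapping" "HOL-Library.Extended_Nat" Complex_Main
begin

text \<open>A real polynomial is a finitely supported map from monomials to coefficients, and a
  monomial is a finitely supported map from variable indices to exponents. With the convolution
  product this is the polynomial ring in the variables \<open>x\<^sub>0, x\<^sub>1, x\<^sub>2, \<dots>\<close>; the ring
  \<open>\<real>[x\<^sub>1, \<dots>, x\<^sub>n]\<close> is the subring of polynomials involving only the indices \<open>1, \<dots>, n\<close>.\<close>

type_synonym rpoly = "(nat \<Rightarrow>\<^sub>0 nat) \<Rightarrow>\<^sub>0 real"

definition monom_degree :: "(nat \<Rightarrow>\<^sub>0 nat) \<Rightarrow> nat" where
  "monom_degree m = (\<Sum>i\<in>Poly_Mapping.keys m. Poly_Mapping.lookup m i)"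

text \<open>The space \<open>\<real>[x\<^sub>1, \<dots>, x\<^sub>n]\<^sub>e\<close>; it contains the zero polynomial for every \<open>e\<close>.\<close>

definition forms :: "nat \<Rightarrow> nat \<Rightarrow> rpoly set" where
  "forms n e = {f. \<forall>m\<in>Poly_Mapping.keys f. Poly_Mapping.keys m \<subseteq> {1..n} \<and> monom_degree m = e}"

text \<open>The parameter \<open>e\<close> below is the degree \<open>2d\<close> of the form being represented, so only even \<open>e\<close>
  are meaningful.\<close>

definition sum_of_squares :: "nat \<Rightarrow> nat \<Rightarrow> nat \<Rightarrow> rpoly \<Rightarrow> bool" where
  "sum_of_squares n e r f \<longleftrightarrow>
     (\<exists>d p. e = 2 * d \<and> (\<forall>i\<in>{1..r}. p i \<in> forms n d) \<and> f = (\<Sum>i = 1..r. (p i)\<^sup>2))"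

definition sos_forms :: "nat \<Rightarrow> nat \<Rightarrow> rpoly set" where
  "sos_forms n e = {f \<in> forms n e. \<exists>r. sum_of_squares n e r f}"

definition sos_length :: "nat \<Rightarrow> nat \<Rightarrow> rpoly \<Rightarrow> nat" where
  "sos_length n e f = (LEAST r. sum_of_squares n e r f)"

text \<open>The supremum is taken in \<^typ>\<open>enat\<close>, so that an unbounded length would give \<open>\<infinity>\<close>.\<close>

definition pythagoras_number :: "nat \<Rightarrow> nat \<Rightarrow> enat" where
  "pythagoras_number n e = (SUP f\<in>sos_forms n e. enat (sos_length n e f))"

end

theory Submission
  imports Defs "HOL-Analysis.Analysis" "HOL-Computational_Algebra.Computational_Algebra"
    "HOL-Computational_Algebra.Field_as_Ring"
begin

text \<open>Four is tied to the socle degree: a complete intersection of three ternary cubics has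
  its one-dimensional socle in degree 3 + 3 + 3 - 3 = 6, exactly where the squares live. A
  functional on sextics that kills all products \<open>p i * q\<close> with cubics \<open>q\<close>
  therefore puts every \<open>p i\<close> into the span of three cubics. Four of them are then
  dependent, and the dependence leaves a direction of the tuple in which a square can be added
  without any first-order or mixed term. This breaks down when the \<open>p i\<close> share a zero.
  At a real one, evaluation would be a nonzero functional that is nonnegative on squares and
  vanishes at \<open>f\<close>, which an interior point forbids. Non-real ones are not excluded in
  this way; what helps is that they are rare: the lines from the target through such forms are swept
  out by 26 + 1 = 27 parameters in a space of dimension 28, so an open set of starting points
  contains one off these lines. At a dependent tuple the parametrization is not smooth, which calls
  for an open mapping theorem for continuous maps differentiable at a single point.\<close>

text \<open>Upper bound. Let \<open>\<phi>\<close> send four real cubics to the sum of their squares. Its image is closed,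
  and it suffices that it contains the interior of the cone \<open>\<Sigma>\<close> of sums of squares.
  Let \<open>f = \<phi>(p)\<close> be an interior point of \<open>\<Sigma>\<close>. If the \<open>p\<^sub>i\<close> have no common zero in
  \<open>\<bbbP>\<^sup>2(\<complex>)\<close>, then three combinations of them form a complete intersection, so that the ideal they
  generate has codimension one in degree 6, with a perfect pairing on cubics. Hence either \<open>d\<phi>\<close> is
  onto at \<open>p\<close>, or the \<open>p\<^sub>i\<close> are linearly dependent and the normal \<open>l\<close> to the image of
  \<open>d\<phi>\<close> is unique. In the second case \<open>l\<close> takes both signs on squares because \<open>f\<close> is interior,
  and moving along a fourth cubic in either direction shows that \<open>\<phi>\<close> is still open at \<open>p\<close>.
  A common zero cannot be real, and forms that are singular at a non-real point are the
  image of a 26-dimensional parameter space, so for a generic starting point the segment to a given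
  interior point of \<open>\<Sigma>\<close> avoids them, and on that segment the image of \<open>\<phi>\<close> is open and closed.

  Lower bound. The form \<open>x\<^sup>4y\<^sup>2 + y\<^sup>4z\<^sup>2 + z\<^sup>4x\<^sup>2 + x\<^sup>2y\<^sup>2z\<^sup>2\<close> has a unique Gram matrix,
  of rank four.\<close>

section \<open>Bivariate polynomials of bounded degree\<close>

text \<open>Forms of degree \<open>m\<close> in \<open>x, y, z\<close> are dehomogenized at \<open>z = 1\<close>: they become polynomials
  of total degree at most \<open>m\<close>, with \<open>x\<close> the outer and \<open>y\<close> the inner variable of the type
  \<^typ>\<open>'a poly poly\<close>. Degrees are integers, so that there are no nonzero forms of negative degree.\<close>

definition bpoly :: "int \<Rightarrow> 'a::zero poly poly set" where
  "bpoly m = {p. \<forall>i j. coeff (coeff p i) j \<noteq> 0 \<longrightarrow> int i + int j \<le> m}"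

lemma bpoly_coeff_0: "p \<in> bpoly m \<Longrightarrow> int i + int j > m \<Longrightarrow> coeff (coeff p i) j = 0"
  by (fastforce simp: bpoly_def)

lemma bpolyI: "(\<And>i j. int i + int j > m \<Longrightarrow> coeff (coeff p i) j = 0) \<Longrightarrow> p \<in> bpoly m"
  unfolding bpoly_def using leI by blast

lemma bpoly_eqI:
  assumes "p \<in> bpoly m" "q \<in> bpoly m"
    and "\<And>i j. int i + int j \<le> m \<Longrightarrow> coeff (coeff p i) j = coeff (coeff q i) j"
  shows "p = q"
proof (intro poly_eqI)
  fix i j
  show "coeff (coeff p i) j = coeff (coeff q i) j"
    using assms by (cases "int i + int j \<le> m") (auto simp: bpoly_coeff_0)
qed

lemma bpoly_mono: "p \<in> bpoly m \<Longrightarrow> m \<le> n \<Longrightarrow> p \<in> bpoly n"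
  by (fastforce simp: bpoly_def)

lemma bpoly_neg: "p \<in> bpoly m \<Longrightarrow> m < 0 \<Longrightarrow> p = 0"
  by (intro poly_eqI) (auto simp: bpoly_coeff_0)

lemma bpoly_0 [simp]: "0 \<in> bpoly m"
  by (simp add: bpoly_def)

lemma bpoly_add: "p \<in> bpoly m \<Longrightarrow> q \<in> bpoly m \<Longrightarrow> p + q \<in> bpoly m"
  by (rule bpolyI) (simp add: bpoly_coeff_0)

lemma bpoly_diff:
  fixes p :: "'a::ab_group_add poly poly"
  shows "p \<in> bpoly m \<Longrightarrow> q \<in> bpoly m \<Longrightarrow> p - q \<in> bpoly m"
  by (rule bpolyI) (simp add: bpoly_coeff_0)

lemma bpoly_uminus:
  fixes p :: "'a::ab_group_add poly poly"
  shows "p \<in> bpoly m \<Longrightarrow> - p \<in> bpoly m"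
  by (rule bpolyI) (simp add: bpoly_coeff_0)

lemma bpoly_sum:
  "(\<And>i. i \<in> I \<Longrightarrow> f i \<in> bpoly m) \<Longrightarrow> sum f I \<in> bpoly m"
  by (induction I rule: infinite_finite_induct) (auto intro: bpoly_add)

lemma bpoly_mult:
  fixes p q :: "'a::comm_semiring_0 poly poly"
  assumes "p \<in> bpoly m" "q \<in> bpoly n"
  shows "p * q \<in> bpoly (m + n)"
proof (rule bpolyI)
  fix i j :: nat assume ij: "int i + int j > m + n"
  have "coeff (coeff p a) b * coeff (coeff q (i - a)) (j - b) = 0" if "a \<le> i" "b \<le> j" for a b
  proof (cases "int a + int b > m")
    case False
    with ij that have "int (i - a) + int (j - b) > n" by linarith
    with assms show ?thesis by (simp add: bpoly_coeff_0)
  qed (use assms in \<open>simp add: bpoly_coeff_0\<close>)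
  then show "coeff (coeff (p * q) i) j = 0"
    by (simp add: coeff_mult coeff_sum)
qed

lemma bpoly_mult_le:
  fixes p q :: "'a::comm_semiring_0 poly poly"
  shows "p \<in> bpoly m \<Longrightarrow> q \<in> bpoly n \<Longrightarrow> m + n \<le> k \<Longrightarrow> p * q \<in> bpoly k"
  using bpoly_mult bpoly_mono by blast

lemma bpoly_monom: "int i + int j \<le> m \<Longrightarrow> monom (monom c j) i \<in> bpoly m"
  by (rule bpolyI) (auto simp: coeff_monom)

lemma bpoly_const: "m \<ge> 0 \<Longrightarrow> [:[:c:]:] \<in> bpoly m"
  using bpoly_monom[of 0 0 m c] by (simp add: monom_0)

lemma bpoly_1: "m \<ge> 0 \<Longrightarrow> 1 \<in> bpoly m"
  by (metis one_pCons bpoly_const)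

lemma bpoly_smult:
  fixes p :: "'a::comm_semiring_0 poly poly"
  shows "p \<in> bpoly m \<Longrightarrow> smult [:c:] p \<in> bpoly m"
  by (rule bpolyI) (simp add: bpoly_coeff_0)

lemma bpoly_X: "m \<ge> 1 \<Longrightarrow> [:0, 1:] \<in> bpoly m"
  using bpoly_monom[of 1 0 m 1] by (simp add: monom_Suc monom_0 one_pCons)

lemma bpoly_Y: "m \<ge> 1 \<Longrightarrow> [:[:0, 1:]:] \<in> bpoly m"
  using bpoly_monom[of 0 1 m 1] by (simp add: monom_Suc monom_0 flip: one_pCons)

lemma bpoly_0_const:
  assumes "p \<in> bpoly 0"
  shows "\<exists>c. p = [:[:c:]:]"
proof
  show "p = [:[:coeff (coeff p 0) 0:]:]"
  proof (rule bpoly_eqI[OF assms bpoly_const])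
    fix i j assume "int i + int j \<le> 0"
    then have "i = 0" "j = 0" by auto
    then show "coeff (coeff p i) j = coeff (coeff [:[:coeff (coeff p 0) 0:]:] i) j" by simp
  qed simp
qed

lemma bpoly_in_some: "\<exists>m\<ge>n. p \<in> bpoly m"
proof -
  define d where "d = Max ((\<lambda>i. degree (coeff p i)) ` {..degree p})"
  have "p \<in> bpoly (int (degree p) + int d)"
  proof (rule bpolyI)
    fix i j assume "int i + int j > int (degree p) + int d"
    moreover have "degree (coeff p i) \<le> d" if "i \<le> degree p"
      unfolding d_def using that by (intro Max_ge) auto
    ultimately show "coeff (coeff p i) j = 0"
      by (cases "i \<le> degree p") (auto intro!: coeff_eq_0 simp: coeff_eq_0[of p i])
  qed
  then show ?thesis
    using bpoly_mono[of p _ "max n (int (degree p) + int d)"] by (intro exI[of _ "max n (int (degree p) + int d)"]) auto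
qed

text \<open>Lets bilinear identities, such as multiplicativity of \<open>top_form\<close>, be
  checked on monomials within the degree bound.\<close>

lemma bpoly_induct [consumes 1, case_names zero monom add]:
  fixes p :: "'a::comm_monoid_add poly poly"
  assumes "p \<in> bpoly m" and "Q 0"
    and mono: "\<And>i j c. int i + int j \<le> m \<Longrightarrow> Q (monom (monom c j) i)"
    and add: "\<And>p q. p \<in> bpoly m \<Longrightarrow> q \<in> bpoly m \<Longrightarrow> Q p \<Longrightarrow> Q q \<Longrightarrow> Q (p + q)"
  shows "Q p"
proof -
  have sum: "Q (sum f I)" if "\<And>i. i \<in> I \<Longrightarrow> f i \<in> bpoly m" "\<And>i. i \<in> I \<Longrightarrow> Q (f i)"
    for f :: "nat \<Rightarrow> _" and I
    using that by (induction I rule: infinite_finite_induct) (auto intro!: add assms(2) bpoly_sum)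
  have inner: "Q (monom (monom (coeff (coeff p i) j) j) i) \<and> monom (monom (coeff (coeff p i) j) j) i \<in> bpoly m" for i j
    using assms(1,2) mono bpoly_monom by (cases "int i + int j \<le> m") (auto simp: bpoly_coeff_0)
  have outer: "monom (coeff p i) i = (\<Sum>j\<le>degree (coeff p i). monom (monom (coeff (coeff p i) j) j) i)" for i
    by (subst monom_sum[symmetric]) (simp add: poly_as_sum_of_monoms)
  have "Q (\<Sum>i\<le>degree p. monom (coeff p i) i)"
    unfolding outer using inner by (intro sum bpoly_sum) auto
  then show ?thesis by (simp add: poly_as_sum_of_monoms)
qed

text \<open>The restriction of a form of degree \<open>m\<close> to the line \<open>z = 0\<close>, dehomogenized at \<open>y = 1\<close>.\<close>

definition top_form :: "int \<Rightarrow> 'a::zero poly poly \<Rightarrow> 'a poly" where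
  "top_form m p = Poly (map (\<lambda>i. coeff (coeff p i) (nat (m - int i))) [0..<nat (m + 1)])"

lemma coeff_top_form:
  "coeff (top_form m p) i = (if int i \<le> m then coeff (coeff p i) (nat (m - int i)) else 0)"
  by (auto simp: top_form_def nth_default_def)

lemma degree_top_form: "top_form m p = 0 \<or> int (degree (top_form m p)) \<le> m"
  by (metis coeff_top_form leading_coeff_0_iff)

lemma top_form_0 [simp]: "top_form m 0 = 0"
  by (rule poly_eqI) (simp add: coeff_top_form)

lemma top_form_add: "top_form m (p + q) = top_form m p + top_form m q"
  by (rule poly_eqI) (simp add: coeff_top_form)

lemma top_form_diff:
  fixes p q :: "'a::ab_group_add poly poly"
  shows "top_form m (p - q) = top_form m p - top_form m q"
  by (rule poly_eqI) (simp add: coeff_top_form)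

lemma top_form_smult:
  fixes p :: "'a::comm_semiring_0 poly poly"
  shows "top_form m (smult [:c:] p) = smult c (top_form m p)"
  by (rule poly_eqI) (simp add: coeff_top_form)

lemma top_form_sum: "top_form m (sum f I) = (\<Sum>i\<in>I. top_form m (f i))"
  by (induction I rule: infinite_finite_induct) (auto simp: top_form_add)

lemma top_form_monom:
  "int i + int j \<le> m \<Longrightarrow> top_form m (monom (monom c j) i) = (if int i + int j = m then monom c i else 0)"
  by (rule poly_eqI) (auto simp: coeff_top_form coeff_monom)

lemma top_form_mult:
  fixes p q :: "'a::comm_semiring_0 poly poly"
  assumes "p \<in> bpoly m" "q \<in> bpoly n"
  shows "top_form (m + n) (p * q) = top_form m p * top_form n q"
  using assms(1)
proof (induction p rule: bpoly_induct)
  case (monom i j c)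
  show ?case using assms(2)
  proof (induction q rule: bpoly_induct)
    case (monom k l d)
    then show ?case using \<open>int i + int j \<le> m\<close>
      by (subst mult_monom, subst mult_monom, subst top_form_monom) (auto simp: top_form_monom mult_monom)
  qed (auto simp: algebra_simps top_form_add)
qed (auto simp: algebra_simps top_form_add)

lemma top_form_lower: "p \<in> bpoly m \<Longrightarrow> m < n \<Longrightarrow> top_form n p = 0"
  by (rule poly_eqI) (auto simp: coeff_top_form bpoly_coeff_0)

text \<open>A form vanishing on the line z = 0 is divisible by z, and dehomogenized division by z is
  just a smaller degree bound.\<close>

lemma bpoly_drop:
  assumes "p \<in> bpoly m" "top_form m p = 0"
  shows "p \<in> bpoly (m - 1)"
proof (rule bpolyI)
  fix i j assume ij: "int i + int j > m - 1"
  show "coeff (coeff p i) j = 0"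
  proof (cases "int i + int j = m")
    case True
    then have "coeff (coeff p i) j = coeff (top_form m p) i"
      by (auto simp: coeff_top_form)
    with assms show ?thesis by simp
  qed (use ij assms in \<open>simp add: bpoly_coeff_0\<close>)
qed

lemma top_form_lift:
  fixes c :: "'a::comm_monoid_add poly"
  assumes "c = 0 \<or> int (degree c) \<le> m"
  obtains p where "p \<in> bpoly m" "top_form m p = c"
proof (cases "c = 0")
  case False
  define p where "p = (\<Sum>i\<le>degree c. monom (monom (coeff c i) (nat (m - int i))) i)"
  have "p \<in> bpoly m"
    unfolding p_def using assms False by (intro bpoly_sum bpoly_monom) auto
  moreover have "top_form m p = (\<Sum>i\<le>degree c. monom (coeff c i) i)"
    unfolding p_def top_form_sum using assms False by (intro sum.cong) (auto simp: top_form_monom)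
  ultimately show ?thesis using that by (simp add: poly_as_sum_of_monoms)
qed (use that[of 0] in auto)

section \<open>Complete intersections of cubics\<close>

text \<open>The assumptions say that \<open>p1\<close> and \<open>p2\<close> have no common zero on the line \<open>z = 0\<close>.
  As a consequence \<open>z\<close> is not a zero divisor modulo \<open>(p1, p2)\<close>, which in
  dehomogenized form is the degree bound of \<open>coeffs_degree_le\<close>.\<close>

locale cubic_pair =
  fixes p1 p2 :: "'a::field_gcd poly poly"
  assumes p1: "p1 \<in> bpoly 3" and p2: "p2 \<in> bpoly 3"
    and lead: "coeff (coeff p1 3) 0 \<noteq> 0"
    and cop: "coprime (top_form 3 p1) (top_form 3 p2)"
begin

text \<open>\<open>lead\<close> says that \<open>p1\<close> does not vanish at [1:0:0], the point of
  the line z = 0 missed by the chart y = 1. Because the degree is exactly 3, degrees of cofactors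
  can be read off.\<close>

lemma degree_top1: "degree (top_form 3 p1) = 3" and top1_nz: "top_form 3 p1 \<noteq> 0"
proof -
  have *: "coeff (top_form 3 p1) 3 \<noteq> 0"
    using lead by (simp add: coeff_top_form)
  then show "top_form 3 p1 \<noteq> 0" by auto
  then show "degree (top_form 3 p1) = 3"
    using le_degree[OF *] degree_top_form[of 3 p1] by auto
qed

text \<open>By coprimality the first top form divides \<open>b\<close>, which makes the Koszul
  syzygy the only one.\<close>

lemma top_syzygy:
  assumes "a * top_form 3 p1 + b * top_form 3 p2 = 0"
  obtains c where "a = c * top_form 3 p2" "b = - c * top_form 3 p1"
proof -
  have "b * top_form 3 p2 = top_form 3 p1 * (- a)"
    using assms by (simp add: eq_neg_iff_add_eq_0 algebra_simps)
  then have "top_form 3 p1 dvd b * top_form 3 p2" by (metis dvd_triv_left)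
  then have "top_form 3 p1 dvd b"
    using cop coprime_dvd_mult_left_iff by blast
  then obtain e where e: "b = top_form 3 p1 * e" by (elim dvdE)
  have "top_form 3 p1 * (a + e * top_form 3 p2) = 0"
    using assms unfolding e by (simp add: algebra_simps)
  then have "a + e * top_form 3 p2 = 0" using top1_nz by simp
  then show ?thesis using e by (intro that[of "- e"]) (simp_all add: eq_neg_iff_add_eq_0)
qed

text \<open>The top parts of \<open>a\<close> and \<open>b\<close> form a syzygy of the top forms,
  hence a Koszul one; subtracting a lift of it lowers both degrees and leaves
  \<open>a * p1 + b * p2\<close> unchanged.\<close>

lemma syzygy_step:
  assumes a: "a \<in> bpoly m" and b: "b \<in> bpoly m" and ab: "a * p1 + b * p2 \<in> bpoly (m + 2)"
  obtains c where "c \<in> bpoly (m - 3)" "a - c * p2 \<in> bpoly (m - 1)" "b + c * p1 \<in> bpoly (m - 1)"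
proof -
  have "top_form m a * top_form 3 p1 + top_form m b * top_form 3 p2 = top_form (m + 3) (a * p1 + b * p2)"
    by (simp add: top_form_add top_form_mult a b p1 p2)
  also have "\<dots> = 0" using ab by (intro top_form_lower) auto
  finally obtain c' where c': "top_form m a = c' * top_form 3 p2" "top_form m b = - c' * top_form 3 p1"
    using top_syzygy by blast
  \<comment> \<open>The bound is taken from \<open>b\<close>, since only the top form of
    \<open>p1\<close> is known to have degree exactly 3.\<close>
  have "c' = 0 \<or> int (degree c') \<le> m - 3"
  proof (cases "c' = 0")
    case False
    then have "degree (top_form m b) = degree c' + 3" "top_form m b \<noteq> 0"
      using c'(2) top1_nz degree_top1 by (auto simp: degree_mult_eq)
    with degree_top_form[of m b] show ?thesis by auto
  qed auto
  then obtain c where c: "c \<in> bpoly (m - 3)" "top_form (m - 3) c = c'"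
    using top_form_lift by blast
  have t: "top_form m (c * p) = c' * top_form 3 p" if "p \<in> bpoly 3" for p
    using top_form_mult[OF c(1) that] c(2) by simp
  have m: "c * p \<in> bpoly m" if "p \<in> bpoly 3" for p
    using bpoly_mult[OF c(1) that] by simp
  have "a - c * p2 \<in> bpoly (m - 1)"
    by (rule bpoly_drop) (auto intro: bpoly_diff a m p2 simp: top_form_diff c' t p2)
  moreover have "b + c * p1 \<in> bpoly (m - 1)"
    by (rule bpoly_drop) (auto intro: bpoly_add b m p1 simp: top_form_add c' t p1)
  ultimately show ?thesis using that c by blast
qed

lemma coeffs_degree_le:
  assumes "g = a * p1 + b * p2" "g \<in> bpoly k"
  obtains a' b' where "a' \<in> bpoly (k - 3)" "b' \<in> bpoly (k - 3)" "g = a' * p1 + b' * p2"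
proof -
  \<comment> \<open>\<open>n\<close> is the excess of the coefficients over degree
    \<open>k - 3\<close>; each syzygy step removes one unit of it.\<close>
  have "\<exists>a' b'. a' \<in> bpoly (k - 3) \<and> b' \<in> bpoly (k - 3) \<and> a' * p1 + b' * p2 = a * p1 + b * p2"
    if "a \<in> bpoly (k - 3 + int n)" "b \<in> bpoly (k - 3 + int n)" "a * p1 + b * p2 \<in> bpoly k" for a b n
    using that
  proof (induction n arbitrary: a b)
    case (Suc n)
    have "a * p1 + b * p2 \<in> bpoly (k - 3 + int (Suc n) + 2)"
      using Suc.prems(3) by (rule bpoly_mono) auto
    moreover have "k - 3 + int (Suc n) - 1 = k - 3 + int n" by simp
    ultimately obtain c where
      c: "a - c * p2 \<in> bpoly (k - 3 + int n)" "b + c * p1 \<in> bpoly (k - 3 + int n)"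
      using syzygy_step[OF Suc.prems(1,2)] by metis
    have eq: "(a - c * p2) * p1 + (b + c * p1) * p2 = a * p1 + b * p2" by (simp add: algebra_simps)
    show ?case using Suc.IH[OF c] Suc.prems(3) by (simp only: eq)
  qed auto
  note * = this
  have ab: "a * p1 + b * p2 \<in> bpoly k" using assms by simp
  obtain m where m: "m \<ge> k - 3" "a \<in> bpoly m" using bpoly_in_some by blast
  obtain n where n: "n \<ge> m" "b \<in> bpoly n" using bpoly_in_some by blast
  have "n = k - 3 + int (nat (n - (k - 3)))" using m n by simp
  then show ?thesis using *[of a "nat (n - (k - 3))" b] ab bpoly_mono[OF m(2) n(1)] n(2) that assms(1) by metis
qed

text \<open>With right-hand side zero the descent runs down to negative degree, where the
  coefficients vanish; the subtracted multipliers add up to \<open>c\<close>.\<close>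

lemma syzygy_Koszul:
  assumes "a \<in> bpoly m" "b \<in> bpoly m" "a * p1 + b * p2 = 0"
  obtains c where "c \<in> bpoly (m - 3)" "a = c * p2" "b = - c * p1"
proof -
  have "\<exists>c. c \<in> bpoly (m - 3) \<and> a = c * p2 \<and> b = - c * p1"
    if "m = int n - 1" "a \<in> bpoly m" "b \<in> bpoly m" "a * p1 + b * p2 = 0" for a b n m
    using that
  proof (induction n arbitrary: a b m)
    case 0
    then show ?case using bpoly_neg[of a m] bpoly_neg[of b m] by (intro exI[of _ 0]) auto
  next
    case (Suc n)
    obtain c where c: "c \<in> bpoly (m - 3)" "a - c * p2 \<in> bpoly (m - 1)" "b + c * p1 \<in> bpoly (m - 1)"
      using syzygy_step[OF Suc.prems(2,3)] Suc.prems(4) by auto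
    have "(a - c * p2) * p1 + (b + c * p1) * p2 = 0" using Suc.prems(4) by (simp add: algebra_simps)
    with Suc.IH[of "m - 1" "a - c * p2" "b + c * p1"] c Suc.prems(1)
    obtain d where d: "d \<in> bpoly (m - 1 - 3)" "a - c * p2 = d * p2" "b + c * p1 = - d * p1" by auto
    have "c + d \<in> bpoly (m - 3)" using c(1) d(1) by (auto intro!: bpoly_add elim: bpoly_mono)
    moreover have "a = (c + d) * p2" using d(2) by (simp add: algebra_simps)
    moreover have "b = - (c + d) * p1"
    proof -
      have b: "b = - d * p1 - c * p1" using d(3) by (metis add_diff_cancel_right')
      show ?thesis unfolding b by (simp add: algebra_simps)
    qed
    ultimately show ?case by blast
  qed
  note * = this
  show ?thesis
  proof (cases "m < 0")
    case True
    then show ?thesis using that[of 0] bpoly_neg[of a m] bpoly_neg[of b m] assms by auto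
  next
    case False
    then have "m = int (nat m + 1) - 1" by auto
    from *[OF this assms] that show ?thesis by blast
  qed
qed

text \<open>Two coprime binary cubics generate all binary forms of degree at least 3 + 3 - 1 = 5, so
  the top part of \<open>p\<close> can be cancelled.\<close>

lemma reduce_step:
  assumes "p \<in> bpoly m" "m \<ge> 5"
  obtains a b where "p - (a * p1 + b * p2) \<in> bpoly (m - 1)"
proof -
  obtain u v where uv: "u * top_form 3 p1 + v * top_form 3 p2 = 1"
    using cop by (metis bezout_coefficients_fst_snd coprime_imp_gcd_eq_1)
  define t where "t = top_form m p"
  \<comment> \<open>Reducing this Bezout coefficient keeps the degree of
    \<open>b * top_form 3 p2\<close> at most 2 + 3 = 5, hence at most \<open>m\<close>, and this
    bounds the degree of \<open>a\<close> as well.\<close>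
  define b where "b = (t * v) mod top_form 3 p1"
  define k where "k = (t * v) div top_form 3 p1"
  define a where "a = t * u + k * top_form 3 p2"
  have tv: "t * v = k * top_form 3 p1 + b" unfolding b_def k_def by (rule div_mult_mod_eq[symmetric])
  have ab: "a * top_form 3 p1 + b * top_form 3 p2 = t"
  proof -
    have "a * top_form 3 p1 + b * top_form 3 p2 = t * u * top_form 3 p1 + (k * top_form 3 p1 + b) * top_form 3 p2"
      by (simp add: a_def algebra_simps)
    also have "\<dots> = t * (u * top_form 3 p1 + v * top_form 3 p2)"
      unfolding tv[symmetric] by (simp add: algebra_simps)
    finally show ?thesis by (simp add: uv)
  qed
  have db: "b = 0 \<or> degree b < 3"
    using degree_mod_less[of "top_form 3 p1" "t * v"] top1_nz degree_top1 by (auto simp: b_def)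
  have d2: "degree (b * top_form 3 p2) \<le> 5"
    using degree_mult_le[of b "top_form 3 p2"] degree_top_form[of 3 p2] db by (cases "b = 0"; cases "top_form 3 p2 = 0") auto
  have "degree (t - b * top_form 3 p2) \<le> nat m"
  proof (rule degree_diff_le)
    show "degree t \<le> nat m" using degree_top_form[of m p] by (auto simp: t_def)
    show "degree (b * top_form 3 p2) \<le> nat m" using d2 assms by linarith
  qed
  moreover have "t - b * top_form 3 p2 = a * top_form 3 p1" using ab by (simp add: algebra_simps)
  ultimately have "a = 0 \<or> degree a + 3 \<le> nat m"
    using degree_mult_eq[of a "top_form 3 p1"] top1_nz degree_top1 by (cases "a = 0") auto
  then have "a = 0 \<or> int (degree a) \<le> m - 3" by auto
  then obtain A where A: "A \<in> bpoly (m - 3)" "top_form (m - 3) A = a" using top_form_lift by blast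
  have "b = 0 \<or> int (degree b) \<le> m - 3" using db assms by auto
  then obtain B where B: "B \<in> bpoly (m - 3)" "top_form (m - 3) B = b" using top_form_lift by blast
  have "p - (A * p1 + B * p2) \<in> bpoly m"
    using bpoly_mult[OF A(1) p1] bpoly_mult[OF B(1) p2] assms(1) by (simp add: bpoly_diff bpoly_add)
  moreover have "top_form m (p - (A * p1 + B * p2)) = 0"
    using top_form_mult[OF A(1) p1] top_form_mult[OF B(1) p2] A(2) B(2) ab
    by (simp add: top_form_diff top_form_add t_def)
  ultimately show ?thesis using bpoly_drop that by blast
qed

lemma reduce:
  obtains a b where "p - (a * p1 + b * p2) \<in> bpoly 4"
proof -
  have "\<exists>a b. p - (a * p1 + b * p2) \<in> bpoly 4" if "p \<in> bpoly (4 + int n)" for p n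
    using that
  proof (induction n arbitrary: p)
    case 0
    then show ?case by (intro exI[of _ 0]) auto
  next
    case (Suc n)
    obtain a b where ab: "p - (a * p1 + b * p2) \<in> bpoly (4 + int n)"
      using reduce_step[OF Suc.prems] by auto
    from Suc.IH[OF ab] obtain c d where "p - (a * p1 + b * p2) - (c * p1 + d * p2) \<in> bpoly 4" by blast
    then show ?case by (intro exI[of _ "a + c"] exI[of _ "b + d"]) (simp add: algebra_simps)
  qed
  note * = this
  obtain m where m: "m \<ge> 4" "p \<in> bpoly m" using bpoly_in_some by blast
  then have "m = 4 + int (nat (m - 4))" by simp
  then show ?thesis using that *[of p "nat (m - 4)"] m by metis
qed

end

text \<open>\<open>unit\<close> certifies that there is no common affine zero;
  \<open>cubic_pair\<close> already excludes common zeros on z = 0. Together the three cubics form a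
  complete intersection in the projective plane.\<close>

locale cubic_triple = cubic_pair p1 p2 for p1 p2 :: "'a::field_gcd poly poly" +
  fixes p3 :: "'a poly poly"
  assumes p3: "p3 \<in> bpoly 3"
    and unit: "\<exists>a b c. a * p1 + b * p2 + c * p3 = 1"
begin

text \<open>By \<open>unit\<close>, \<open>p3\<close> is invertible modulo
  \<open>(p1, p2)\<close>.\<close>

lemma p3_cancel:
  assumes "q * p3 = a * p1 + b * p2"
  obtains c d where "q = c * p1 + d * p2"
proof -
  obtain r s t where rst: "r * p1 + s * p2 + t * p3 = 1" using unit by blast
  have "q = q * (r * p1 + s * p2 + t * p3)" by (simp add: rst)
  also have "\<dots> = q * r * p1 + q * s * p2 + t * (q * p3)" by (simp add: algebra_simps)
  also have "\<dots> = (q * r + t * a) * p1 + (q * s + t * b) * p2" unfolding assms by (simp add: algebra_simps)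
  finally show ?thesis using that by blast
qed

text \<open>The degree \<open>m\<close> part of the homogeneous ideal. The degree bounds are
  essential: by \<open>unit\<close>, the dehomogenized ideal without them is the whole ring.\<close>

definition J :: "int \<Rightarrow> 'a poly poly set" where
  "J m = {a * p1 + b * p2 + c * p3 | a b c. a \<in> bpoly (m - 3) \<and> b \<in> bpoly (m - 3) \<and> c \<in> bpoly (m - 3)}"

text \<open>In this degree every syzygy is a constant combination of the three Koszul ones:
  cancelling \<open>p3\<close> puts \<open>q3\<close> into \<open>(p1, p2)\<close>, and what remains
  is a syzygy of the pair.\<close>

lemma syzygy_cubics:
  assumes q: "q1 \<in> bpoly 3" "q2 \<in> bpoly 3" "q3 \<in> bpoly 3" and 0: "q1 * p1 + q2 * p2 + q3 * p3 = 0"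
  obtains \<alpha> \<beta> \<gamma> where "q3 = [:[:\<alpha>:]:] * p1 + [:[:\<beta>:]:] * p2"
    "q1 = - [:[:\<alpha>:]:] * p3 + [:[:\<gamma>:]:] * p2" "q2 = - [:[:\<beta>:]:] * p3 - [:[:\<gamma>:]:] * p1"
proof -
  have "q3 * p3 = (- q1) * p1 + (- q2) * p2" using 0 by (simp add: algebra_simps eq_neg_iff_add_eq_0)
  then obtain c d where "q3 = c * p1 + d * p2" using p3_cancel by blast
  from coeffs_degree_le[OF this q(3)] obtain c d
    where cd: "q3 = c * p1 + d * p2" and "c \<in> bpoly (3 - 3)" "d \<in> bpoly (3 - 3)" by blast
  then have cd0: "c \<in> bpoly 0" "d \<in> bpoly 0" by simp_all
  then obtain \<alpha> \<beta> where ab: "c = [:[:\<alpha>:]:]" "d = [:[:\<beta>:]:]" using bpoly_0_const cd0 by metis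
  have "(q1 + c * p3) * p1 + (q2 + d * p3) * p2 = 0" using 0 by (simp add: cd algebra_simps)
  moreover have "q1 + c * p3 \<in> bpoly 3" "q2 + d * p3 \<in> bpoly 3"
    using bpoly_mult[OF cd0(1) p3] bpoly_mult[OF cd0(2) p3] q by (auto intro: bpoly_add)
  ultimately obtain e where "e \<in> bpoly (3 - 3)" and e: "q1 + c * p3 = e * p2" "q2 + d * p3 = - e * p1"
    using syzygy_Koszul[of "q1 + c * p3" 3 "q2 + d * p3"] by blast
  then obtain \<gamma> where \<gamma>: "e = [:[:\<gamma>:]:]" using bpoly_0_const by fastforce
  have "q1 = e * p2 - c * p3" "q2 = - e * p1 - d * p3"
    using e by (metis add_diff_cancel_right')+
  then have "q1 = - c * p3 + e * p2" "q2 = - d * p3 - e * p1" by simp_all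
  then show ?thesis using that cd(1) unfolding ab \<gamma> by blast
qed

text \<open>The socle of the complete intersection lives in degree 6. If \<open>z c = u p3\<close> modulo \<open>(p1, p2)\<close>,
  then the restriction of \<open>u\<close> to \<open>z = 0\<close> lies in the socle of the binary complete intersection of
  the top forms, which is concentrated in degree 4.\<close>

lemma socle:
  assumes m: "m \<le> 5" and c: "c \<in> bpoly m" "c \<in> J (m + 1)"
    and cx: "[:0, 1:] * c \<in> J (m + 1)" and cy: "[:[:0, 1:]:] * c \<in> J (m + 1)"
  shows "c \<in> J m"
proof -
  obtain a b u where abu: "c = a * p1 + b * p2 + u * p3" "a \<in> bpoly (m - 2)" "b \<in> bpoly (m - 2)" "u \<in> bpoly (m - 2)"
    using c(2) by (auto simp: J_def)
  \<comment> \<open>Two expressions for \<open>w * c\<close> are compared, \<open>p3\<close> is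
    cancelled, and the result is restricted to z = 0.\<close>
  have key: "\<exists>s t. s \<in> bpoly (m - 4) \<and> t \<in> bpoly (m - 4) \<and>
      top_form (m - 1) (w * u) = top_form (m - 4) s * top_form 3 p1 + top_form (m - 4) t * top_form 3 p2"
    if w: "w \<in> bpoly 1" and wc: "w * c \<in> J (m + 1)" for w
  proof -
    obtain a' b' u' where 1: "w * c = a' * p1 + b' * p2 + u' * p3" "u' \<in> bpoly (m - 2)"
      using wc by (auto simp: J_def)
    then have "(w * u - u') * p3 = (a' - w * a) * p1 + (b' - w * b) * p2"
      unfolding abu by (simp add: algebra_simps)
    then obtain s t where st: "w * u - u' = s * p1 + t * p2" using p3_cancel by blast
    have "w * u - u' \<in> bpoly (m - 1)"
      using bpoly_mult[OF w abu(4)] bpoly_mono[OF 1(2), of "m - 1"] by (auto intro: bpoly_diff)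
    from coeffs_degree_le[OF st this] obtain s t where
      st1: "w * u - u' = s * p1 + t * p2" and "s \<in> bpoly (m - 1 - 3)" "t \<in> bpoly (m - 1 - 3)" by blast
    then have st: "w * u - u' = s * p1 + t * p2" "s \<in> bpoly (m - 4)" "t \<in> bpoly (m - 4)" by simp_all
    have "top_form (m - 1) (w * u) = top_form (m - 1) (w * u - u')"
      using 1(2) by (simp add: top_form_diff top_form_lower)
    also have "\<dots> = top_form (m - 4) s * top_form 3 p1 + top_form (m - 4) t * top_form 3 p2"
      using top_form_mult[OF st(2) p1] top_form_mult[OF st(3) p2] by (simp add: st(1) top_form_add)
    finally show ?thesis using st by blast
  qed
  define v where "v = top_form (m - 2) u"
  obtain s t where st: "s \<in> bpoly (m - 4)" "t \<in> bpoly (m - 4)"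
    "top_form (m - 1) ([:0, 1:] * u) = top_form (m - 4) s * top_form 3 p1 + top_form (m - 4) t * top_form 3 p2"
    using key[OF bpoly_X cx] by auto
  obtain s' t' where st': "s' \<in> bpoly (m - 4)" "t' \<in> bpoly (m - 4)"
    "top_form (m - 1) ([:[:0, 1:]:] * u) = top_form (m - 4) s' * top_form 3 p1 + top_form (m - 4) t' * top_form 3 p2"
    using key[OF bpoly_Y cy] by auto
  have X: "top_form (m - 1) ([:0, 1:] * u) = [:0, 1:] * v"
    using top_form_mult[OF bpoly_X[of 1] abu(4)] top_form_monom[of 1 0 1 "1::'a"]
    by (simp add: v_def monom_Suc monom_0 one_pCons)
  have Y: "top_form (m - 1) ([:[:0, 1:]:] * u) = v"
    using top_form_mult[OF bpoly_Y[of 1] abu(4)] top_form_monom[of 0 1 1 "1::'a"]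
    by (simp add: v_def monom_Suc monom_0 one_pCons)
  define S T S' T' where "S = top_form (m - 4) s" "T = top_form (m - 4) t"
    "S' = top_form (m - 4) s'" "T' = top_form (m - 4) t'"
  note ST = this
  \<comment> \<open>The relations for x v and for v give two expressions of x v, hence a syzygy of
    the top forms.\<close>
  have "([:0, 1:] * S' - S) * top_form 3 p1 + ([:0, 1:] * T' - T) * top_form 3 p2 = [:0, 1:] * v - [:0, 1:] * v"
    using st(3) st'(3) unfolding X Y ST[symmetric] by (simp add: algebra_simps)
  then obtain k where k: "[:0, 1:] * S' - S = k * top_form 3 p2" "[:0, 1:] * T' - T = - k * top_form 3 p1"
    using top_syzygy by auto
  \<comment> \<open>This is where \<open>m \<le> 5\<close> enters: coefficients of degree at most 1
    leave no room for a nonzero multiple of a cubic, so \<open>k = 0\<close>.\<close>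
  have dT: "degree R \<le> 1" "R = 0 \<or> m \<ge> 4" if "R = top_form (m - 4) r" for r R
    using degree_top_form[of "m - 4" r] m that by auto
  have "degree ([:0, 1:] * T' - T) \<le> 2"
  proof (rule degree_diff_le)
    show "degree ([:0, 1:] * T') \<le> 2" 
      using degree_mult_le[of "[:0, 1:]" T'] dT(1)[OF ST(4)] by simp
  qed (use dT(1)[OF ST(2)] in simp)
  moreover have "degree (- k * top_form 3 p1) = degree k + 3" if "k \<noteq> 0"
    using that top1_nz by (subst degree_mult_eq) (auto simp: degree_top1)
  ultimately have "k = 0" using k(2) by fastforce
  \<comment> \<open>Since \<open>S\<close> and \<open>T\<close> are x times \<open>S'\<close> and
    \<open>T'\<close>, the latter have degree at most \<open>m - 5\<close>; their lifts cancel the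
    restriction of \<open>u\<close> to z = 0.\<close>
  then have S: "S = pCons 0 S'" "T = pCons 0 T'" using k by simp_all
  have low: "R = 0 \<or> int (degree R) \<le> m - 5" if "pCons 0 R = top_form (m - 4) r" for r R
    using degree_top_form[of "m - 4" r] unfolding that[symmetric] by (cases "R = 0") auto
  obtain \<sigma> where \<sigma>: "\<sigma> \<in> bpoly (m - 5)" "top_form (m - 5) \<sigma> = S'"
    using top_form_lift[OF low] S ST by metis
  obtain \<tau> where \<tau>: "\<tau> \<in> bpoly (m - 5)" "top_form (m - 5) \<tau> = T'"
    using top_form_lift[OF low] S ST by metis
  define w where "w = u - (\<sigma> * p1 + \<tau> * p2)"
  have "w \<in> bpoly (m - 2 - 1)"
  proof (rule bpoly_drop)
    show "w \<in> bpoly (m - 2)"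
      unfolding w_def using bpoly_mult[OF \<sigma>(1) p1] bpoly_mult[OF \<tau>(1) p2] abu(4) by (auto intro!: bpoly_diff bpoly_add)
    show "top_form (m - 2) w = 0"
      unfolding w_def using top_form_mult[OF \<sigma>(1) p1] top_form_mult[OF \<tau>(1) p2] st'(3)[unfolded Y]
      by (simp add: top_form_diff top_form_add \<sigma> \<tau> Y ST v_def[symmetric])
  qed
  then have w: "w \<in> bpoly (m - 3)" by simp
  have cw: "c - w * p3 = (a + \<sigma> * p3) * p1 + (b + \<tau> * p3) * p2"
    unfolding abu(1) w_def by (simp add: algebra_simps)
  have "c - w * p3 \<in> bpoly m" using bpoly_mult[OF w p3] c(1) by (auto intro: bpoly_diff)
  from coeffs_degree_le[OF cw this]
  obtain a' b' where "a' \<in> bpoly (m - 3)" "b' \<in> bpoly (m - 3)" "c - w * p3 = a' * p1 + b' * p2" by blast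
  moreover from this(3) have "c = a' * p1 + b' * p2 + w * p3" by (simp add: algebra_simps)
  ultimately show ?thesis using w unfolding J_def by blast
qed

text \<open>Nondegeneracy of the pairing of cubics into degree 6 modulo the ideal:
  \<open>socle\<close> strips off one degree at a time until \<open>q\<close> itself lies in
  \<open>J 3\<close>, where the coefficients are constants.\<close>

lemma socle_cubic:
  assumes q: "q \<in> bpoly 3" and all: "\<And>i j. i + j \<le> 3 \<Longrightarrow> monom (monom 1 j) i * q \<in> J 6"
  obtains \<alpha> \<beta> \<gamma> where "q = [:[:\<alpha>:]:] * p1 + [:[:\<beta>:]:] * p2 + [:[:\<gamma>:]:] * p3"
proof -
  have XY: "[:0, 1:] * (monom (monom 1 j) i * q) = monom (monom 1 j) (Suc i) * q"
    "[:[:0, 1:]:] * (monom (monom 1 j) i * q) = monom (monom 1 (Suc j)) i * q" for i j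
  proof -
    have "[:0, 1:] * monom (monom 1 j) i = monom (monom (1::'a) j) (Suc i)"
      by (simp add: monom_Suc)
    then show "[:0, 1:] * (monom (monom 1 j) i * q) = monom (monom 1 j) (Suc i) * q"
      by (metis mult.assoc)
    have "[:[:0, 1:]:] * monom (monom 1 j) i = monom (monom (1::'a) (Suc j)) i"
      by (simp add: monom_Suc smult_monom)
    then show "[:[:0, 1:]:] * (monom (monom 1 j) i * q) = monom (monom 1 (Suc j)) i * q"
      by (metis mult.assoc)
  qed
  have step: "\<forall>i j. int (i + j) \<le> n \<longrightarrow> monom (monom 1 j) i * q \<in> J (n + 3)"
    if "n \<le> 2" and IH: "\<And>i j. int (i + j) \<le> n + 1 \<Longrightarrow> monom (monom 1 j) i * q \<in> J (n + 3 + 1)" for n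
  proof (intro allI impI)
    fix i j assume ij: "int (i + j) \<le> n"
    show "monom (monom 1 j) i * q \<in> J (n + 3)"
    proof (rule socle)
      show "monom (monom 1 j) i * q \<in> bpoly (n + 3)"
        using ij by (intro bpoly_mult q bpoly_monom) auto
      show "monom (monom 1 j) i * q \<in> J (n + 3 + 1)" by (rule IH) (use ij in simp)
      show "[:0, 1:] * (monom (monom 1 j) i * q) \<in> J (n + 3 + 1)"
        unfolding XY by (rule IH) (use ij in simp)
      show "[:[:0, 1:]:] * (monom (monom 1 j) i * q) \<in> J (n + 3 + 1)"
        unfolding XY by (rule IH) (use ij in simp)
    qed (use that in simp)
  qed
  have "\<forall>i j. int (i + j) \<le> 2 \<longrightarrow> monom (monom 1 j) i * q \<in> J (2 + 3)"
    by (rule step) (use all in auto)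
  then have "\<forall>i j. int (i + j) \<le> 1 \<longrightarrow> monom (monom 1 j) i * q \<in> J (1 + 3)"
    by (intro step) auto
  then have "\<forall>i j. int (i + j) \<le> 0 \<longrightarrow> monom (monom 1 j) i * q \<in> J (0 + 3)"
    by (intro step) auto
  from this[rule_format, of 0 0] have "q \<in> J 3" by (simp add: monom_0 flip: one_pCons)
  then obtain a b c where "q = a * p1 + b * p2 + c * p3" "a \<in> bpoly 0" "b \<in> bpoly 0" "c \<in> bpoly 0"
    unfolding J_def by auto
  then show ?thesis using that bpoly_0_const by metis
qed

end

section \<open>Coefficient vectors\<close>

text \<open>A finite index type makes coefficient vectors a Euclidean space. Degree d corresponds to
  cardinality d + 1, so cubics, quartics and sextics have the index types \<open>4 idx\<close>,
  \<open>5 idx\<close> and \<open>7 idx\<close>.\<close>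

typedef ('n::finite) idx = "{(i, j). i + j < CARD('n)}"
  by (rule exI[of _ "(0, 0)"]) simp

lemma finite_idx_set: "finite {(i, j). i + j < (n :: nat)}"
  by (rule finite_subset[of _ "{..<n} \<times> {..<n}"]) auto

lemma card_idx_set: "card {(i, j). i + j < (n :: nat)} = (\<Sum>i<n. n - i)"
proof -
  have "{(i, j). i + j < n} = (SIGMA i:{..<n}. {..<n - i})" by auto
  then show ?thesis by simp
qed

instance idx :: (finite) finite
proof
  show "finite (UNIV :: 'a idx set)"
    using finite_idx_set[of "CARD('a)"] type_definition.univ[OF type_definition_idx] by (metis finite_imageI)
qed

lemma CARD_idx: "CARD('n::finite idx) = (\<Sum>i<CARD('n). CARD('n) - i)"
proof -
  have "CARD('n idx) = card {(i, j). i + j < CARD('n)}"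
    by (rule type_definition.card[OF type_definition_idx])
  then show ?thesis by (simp add: card_idx_set)
qed

lemma CARD_idx_numeral: "CARD(4 idx) = 10" "CARD(5 idx) = 15" "CARD(7 idx) = 28"
  by (simp_all add: CARD_idx eval_nat_numeral)

definition ix :: "'n::finite idx \<Rightarrow> nat" where "ix k = fst (Rep_idx k)"
definition iy :: "'n::finite idx \<Rightarrow> nat" where "iy k = snd (Rep_idx k)"

lemma ix_iy: "ix (k :: 'n::finite idx) + iy k < CARD('n)"
  using Rep_idx[of k] by (auto simp: ix_def iy_def)

lemma idx_eqI: "ix k = ix l \<Longrightarrow> iy k = iy l \<Longrightarrow> k = l"
  by (simp add: ix_def iy_def Rep_idx_inject[symmetric] prod_eq_iff)

lemma idx_exists: "i + j < CARD('n) \<Longrightarrow> \<exists>k :: 'n::finite idx. ix k = i \<and> iy k = j"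
  by (rule exI[of _ "Abs_idx (i, j)"]) (simp add: ix_def iy_def Abs_idx_inverse)

definition bvec :: "'a::zero poly poly \<Rightarrow> 'a ^ ('n::finite idx)" where
  "bvec p = (\<chi> k. coeff (coeff p (ix k)) (iy k))"

definition vpoly :: "'a::comm_monoid_add ^ ('n::finite idx) \<Rightarrow> 'a poly poly" where
  "vpoly v = (\<Sum>k\<in>UNIV. monom (monom (v $ k) (iy k)) (ix k))"

abbreviation bdeg :: "'n::finite itself \<Rightarrow> int" where
  "bdeg _ \<equiv> int CARD('n) - 1"

lemma vpoly_in: "vpoly (v :: 'a::comm_monoid_add ^ ('n::finite idx)) \<in> bpoly (bdeg TYPE('n))"
  unfolding vpoly_def
proof (intro bpoly_sum bpoly_monom)
  fix k :: "'n idx"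
  show "int (ix k) + int (iy k) \<le> int CARD('n) - 1" using ix_iy[of k] by linarith
qed

lemma coeff_vpoly: "coeff (coeff (vpoly v) (ix k)) (iy k) = v $ k"
proof -
  have "coeff (coeff (vpoly v) (ix k)) (iy k) = (\<Sum>l\<in>UNIV. if l = k then v $ k else 0)"
    unfolding vpoly_def coeff_sum
    by (intro sum.cong) (auto simp: coeff_monom dest: idx_eqI)
  then show ?thesis by simp
qed

lemma bvec_vpoly [simp]: "bvec (vpoly v) = v"
  by (simp add: bvec_def vec_eq_iff coeff_vpoly)

lemma bvec_inject:
  assumes "p \<in> bpoly (bdeg TYPE('n::finite))" "q \<in> bpoly (bdeg TYPE('n))"
    and "(bvec p :: 'a::zero ^ 'n idx) = bvec q"
  shows "p = q"
proof (rule bpoly_eqI[OF assms(1,2)])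
  fix i j assume "int i + int j \<le> bdeg TYPE('n)"
  then have "i + j < CARD('n)" by linarith
  then obtain k :: "'n idx" where "ix k = i" "iy k = j" using idx_exists by blast
  with assms(3) show "coeff (coeff p i) j = coeff (coeff q i) j"
    by (auto simp: bvec_def vec_eq_iff)
qed

lemma vpoly_bvec:
  fixes p :: "'a::comm_monoid_add poly poly"
  assumes "p \<in> bpoly (bdeg TYPE('n::finite))"
  shows "vpoly (bvec p :: 'a ^ 'n idx) = p"
  using assms vpoly_in by (intro bvec_inject[where 'n = 'n]) auto

lemma bvec_add: "bvec (p + q) = bvec p + bvec q"
  by (simp add: bvec_def vec_eq_iff)

lemma bvec_0 [simp]: "bvec 0 = 0"
  by (simp add: bvec_def vec_eq_iff)

lemma bvec_sum: "bvec (sum f I) = (\<Sum>i\<in>I. bvec (f i))"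
  by (induction I rule: infinite_finite_induct) (auto simp: bvec_add)

lemma vpoly_add: "vpoly (v + w) = vpoly v + vpoly w"
  by (simp add: vpoly_def add_monom[symmetric] sum.distrib)

lemma vpoly_diff: "vpoly (v - w) = vpoly v - vpoly (w :: 'a::ab_group_add ^ _)"
  by (metis vpoly_add add_diff_cancel_right' diff_add_cancel)

lemma vpoly_0 [simp]: "vpoly 0 = 0"
  by (simp add: vpoly_def)

lemma vpoly_sum: "vpoly (sum f I) = (\<Sum>i\<in>I. vpoly (f i))"
  by (induction I rule: infinite_finite_induct) (auto simp: vpoly_add)

lemma smult_sum_right: "smult c (sum f I) = (\<Sum>i\<in>I. smult c (f i))"
  by (induction I rule: infinite_finite_induct) (auto simp: smult_add_right)

lemma vpoly_scaleR:
  "vpoly (r *\<^sub>R v) = smult [:of_real r:] (vpoly (v :: 'a::{real_algebra_1, comm_ring_1} ^ 'n::finite idx))"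
  by (simp add: vpoly_def smult_sum_right smult_monom scaleR_conv_of_real[where 'a = 'a])

lemma bvec_scaleR:
  "bvec (smult [:of_real r:] p) = r *\<^sub>R bvec (p :: 'a::{real_algebra_1, comm_ring_1} poly poly)"
  by (simp add: bvec_def vec_eq_iff scaleR_conv_of_real[where 'a = 'a])

text \<open>Real linearity suffices also for complex coefficient spaces, whose real dimensions
  double on both sides.\<close>

lemma linear_kernel_nontrivial:
  fixes f :: "'a::euclidean_space \<Rightarrow> 'b::euclidean_space"
  assumes "linear f" "DIM('a) > DIM('b)"
  obtains x where "x \<noteq> 0" "f x = 0"
proof -
  have "\<not> inj f"
  proof
    assume "inj f"
    then have "dim (range f) = DIM('a)" using dim_image_eq[OF assms(1), of UNIV] by simp
    with dim_subset_UNIV[of "range f"] assms(2) show False by simp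
  qed
  then show ?thesis using that linear_injective_0[OF assms(1)] by blast
qed

section \<open>A Nullstellensatz in two variables\<close>

definition aff :: "'a::comm_semiring_0 poly poly \<Rightarrow> 'a \<Rightarrow> 'a \<Rightarrow> 'a" where
  "aff p x y = poly (poly p [:x:]) y"

lemma aff_simps [simp]:
  "aff 0 x y = 0" "aff (p + q) x y = aff p x y + aff q x y" "aff (p * q) x y = aff p x y * aff q x y"
  "aff (smult [:c:] p) x y = c * aff p x y"
  by (simp_all add: aff_def)

lemma aff_sum [simp]: "aff (sum f I) x y = (\<Sum>i\<in>I. aff (f i) x y)"
  by (induction I rule: infinite_finite_induct) auto

lemma aff_const [simp]: "aff [:[:c:]:] x y = c"
  by (simp add: aff_def)


section \<open>Proper ideals and their zeros over the complex numbers\<close>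

definition is_ideal :: "'r::comm_ring_1 set \<Rightarrow> bool" where
  "is_ideal I \<longleftrightarrow> (\<forall>a\<in>I. \<forall>b\<in>I. a + b \<in> I) \<and> (\<forall>a\<in>I. \<forall>r. r * a \<in> I)"

definition adjoin :: "'r::comm_ring_1 set \<Rightarrow> 'r \<Rightarrow> 'r set" where
  "adjoin I f = {a + r * f | a r. a \<in> I}"

lemma is_ideal_adjoin: "is_ideal I \<Longrightarrow> is_ideal (adjoin I f)"
  unfolding is_ideal_def adjoin_def
proof (intro conjI ballI allI)
  assume I: "(\<forall>a\<in>I. \<forall>b\<in>I. a + b \<in> I) \<and> (\<forall>a\<in>I. \<forall>r. r * a \<in> I)"
  fix x assume "x \<in> {a + r * f |a r. a \<in> I}"
  then obtain a r where x: "x = a + r * f" "a \<in> I" by blast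
  show "s * x \<in> {a + r * f |a r. a \<in> I}" for s
  proof -
    have "s * x = s * a + (s * r) * f" by (simp add: x algebra_simps)
    then show ?thesis using x I by blast
  qed
  fix y assume "y \<in> {a + r * f |a r. a \<in> I}"
  then obtain b s where y: "y = b + s * f" "b \<in> I" by blast
  have "x + y = (a + b) + (r + s) * f" by (simp add: x y algebra_simps)
  then show "x + y \<in> {a + r * f |a r. a \<in> I}" using x y I by blast
qed

lemma adjoin_subset: "I \<subseteq> adjoin I f"
proof
  fix a assume "a \<in> I"
  moreover have "a = a + 0 * f" by simp
  ultimately show "a \<in> adjoin I f" unfolding adjoin_def by blast
qed

lemma adjoin_mem: "is_ideal I \<Longrightarrow> I \<noteq> {} \<Longrightarrow> r * f \<in> adjoin I f"
proof -
  assume "is_ideal I" "I \<noteq> {}"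
  then have "0 \<in> I" unfolding is_ideal_def by (metis all_not_in_conv mult_zero_left)
  moreover have "r * f = 0 + r * f" by simp
  ultimately show ?thesis unfolding adjoin_def by blast
qed

text \<open>A Nullstellensatz step without maximal ideals. If adjoining a linear factor of
  \<open>h\<close> yields 1, that factor is invertible modulo \<open>I\<close> and can be cancelled
  from \<open>h\<close>; cancelling all of them would leave a unit in \<open>I\<close>. The map
  \<open>e\<close> embeds univariate polynomials as polynomials in y or in x.\<close>

lemma adjoin_root_proper:
  fixes e :: "complex poly \<Rightarrow> 'r::comm_ring_1"
  assumes I: "is_ideal I" "1 \<notin> I"
    and lin: "\<And>c g. e ([:- c, 1:] * g) = e [:- c, 1:] * e g"
    and unit: "\<And>c. c \<noteq> 0 \<Longrightarrow> e [:c:] dvd 1"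
    and h: "e h \<in> I" "h \<noteq> 0"
  obtains c where "1 \<notin> adjoin I (e [:- c, 1:])"
proof -
  have "\<exists>c. 1 \<notin> adjoin I (e [:- c, 1:])"
    using h
  proof (induction "degree h" arbitrary: h rule: less_induct)
    case (less h)
    show ?case
    proof (cases "degree h = 0")
      case True
      then obtain c where "h = [:c:]" using degree_eq_zeroE by blast
      with less.prems unit have "e h dvd 1" by auto
      then obtain r where "1 = e h * r" by (elim dvdE)
      then have "1 = r * e h" by (simp add: mult.commute)
      then have "1 \<in> I" using I(1) less.prems(1) unfolding is_ideal_def by metis
      with I show ?thesis by blast
    next
      case False
      then have "\<not> constant (poly h)" by (simp add: constant_degree)
      then obtain c where "poly h c = 0" using fundamental_theorem_of_algebra by blast
      then obtain g where g: "h = [:- c, 1:] * g" by (metis dvdE poly_eq_0_iff_dvd)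
      with less.prems have g0: "g \<noteq> 0" by auto
      then have dg: "degree g < degree h" unfolding g by (subst degree_mult_eq) auto
      show ?thesis
      proof (cases "1 \<in> adjoin I (e [:- c, 1:])")
        case True
        then obtain a r where ar: "1 = a + r * e [:- c, 1:]" "a \<in> I" unfolding adjoin_def by blast
        have "e g = e g * (a + r * e [:- c, 1:])" using ar(1) by simp
        also have "\<dots> = e g * a + r * e h" unfolding g lin by (simp add: algebra_simps)
        finally have "e g \<in> I" using I(1) ar(2) less.prems(1) unfolding is_ideal_def by metis
        from less.hyps[OF dg this g0] show ?thesis .
      qed blast
    qed
  qed
  then show ?thesis using that by blast
qed

lemma poly_poly_eval_decomp:
  fixes p :: "'a::field poly poly"
  obtains w where "p = map_poly (\<lambda>q. [:poly q c:]) p + [:[:- c, 1:]:] * w"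
proof -
  have "\<exists>w. p = map_poly (\<lambda>q. [:poly q c:]) p + [:[:- c, 1:]:] * w"
  proof (induction p)
    case (pCons a p)
    then obtain w where w: "p = map_poly (\<lambda>q. [:poly q c:]) p + [:[:- c, 1:]:] * w" by blast
    have "poly (a - [:poly a c:]) c = 0" by simp
    then obtain b where "a - [:poly a c:] = [:- c, 1:] * b" by (metis dvdE poly_eq_0_iff_dvd)
    then have b: "a = [:poly a c:] + [:- c, 1:] * b" by (metis add.commute diff_add_cancel)
    have "pCons a p = pCons ([:poly a c:] + [:- c, 1:] * b) (map_poly (\<lambda>q. [:poly q c:]) p + [:[:- c, 1:]:] * w)"
      using b w by metis
    also have "\<dots> = map_poly (\<lambda>q. [:poly q c:]) (pCons a p) + [:[:- c, 1:]:] * pCons b w"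
      by (simp add: map_poly_pCons pCons.hyps)
    finally show ?case by blast
  qed simp
  then show ?thesis using that by blast
qed

text \<open>First y is replaced by its value modulo Y - y, then x modulo X - x.\<close>

lemma aff_decomp:
  fixes p :: "'a::field poly poly"
  obtains v w where "p = [:[:aff p x y:]:] + v * [:[:- x:], 1:] + w * [:[:- y, 1:]:]"
proof -
  obtain w where w: "p = map_poly (\<lambda>q. [:poly q y:]) p + [:[:- y, 1:]:] * w"
    using poly_poly_eval_decomp by blast
  define g where "g = map_poly (\<lambda>q. [:poly q y:]) p"
  have "poly (g - [:poly g [:x:]:]) [:x:] = 0" by simp
  then obtain v where v: "g - [:poly g [:x:]:] = [:- [:x:], 1:] * v" by (metis dvdE poly_eq_0_iff_dvd)
  have "poly g [:x:] = [:aff p x y:]"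
    unfolding g_def aff_def by (induction p) (auto simp: map_poly_pCons)
  with v have "g = [:[:aff p x y:]:] + [:- [:x:], 1:] * v" by (metis add.commute diff_add_cancel)
  with w that[of v w] show ?thesis by (simp add: g_def mult.commute)
qed

lemma map_poly_const_mult:
  "map_poly (\<lambda>a. [:a:]) ([:- c, 1:] * g) = map_poly (\<lambda>a. [:a:]) [:- c, 1:] * map_poly (\<lambda>a. [:a:]) (g :: 'a::comm_ring_1 poly)"
  by (rule poly_eqI) (simp add: coeff_map_poly map_poly_pCons coeff_pCons split: nat.split)

text \<open>Adjoin a linear factor of the eliminant \<open>h\<close>, then a linear factor of what
  \<open>p\<close> becomes at that y. The ideal stays proper, so an element not vanishing at the
  resulting point would put a unit into it.\<close>

lemma ideal_common_zero:
  fixes I :: "complex poly poly set"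
  assumes I: "is_ideal I" "1 \<notin> I"
    and h: "[:h:] \<in> I" "h \<noteq> 0" and p: "p \<in> I" "p \<in> bpoly (int n)" "coeff (coeff p n) 0 \<noteq> 0"
  obtains x y where "\<And>q. q \<in> I \<Longrightarrow> aff q x y = 0"
proof -
  obtain y where y: "1 \<notin> adjoin I [:[:- y, 1:]:]"
    by (rule adjoin_root_proper[of I "\<lambda>q. [:q:]" h]) (use I h in \<open>auto simp: is_unit_const_poly_iff is_unit_pCons_iff dvd_field_iff\<close>)
  define I1 where "I1 = adjoin I [:[:- y, 1:]:]"
  have I1: "is_ideal I1" "1 \<notin> I1" "I \<subseteq> I1" "r * [:[:- y, 1:]:] \<in> I1" for r
    using is_ideal_adjoin[OF I(1)] y adjoin_subset[of I] adjoin_mem[OF I(1)] h(1) unfolding I1_def by blast+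
  obtain w where w: "p = map_poly (\<lambda>q. [:poly q y:]) p + [:[:- y, 1:]:] * w"
    using poly_poly_eval_decomp by blast
  define g where "g = map_poly (\<lambda>q. poly q y) p"
  have pg: "map_poly (\<lambda>q. [:poly q y:]) p = map_poly (\<lambda>a. [:a:]) g"
    unfolding g_def by (rule poly_eqI) (simp add: coeff_map_poly)
  have "map_poly (\<lambda>a. [:a:]) g = p + (- w) * [:[:- y, 1:]:]"
    using w unfolding pg by (simp add: algebra_simps)
  then have gI: "map_poly (\<lambda>a. [:a:]) g \<in> I1"
    using I1 p(1) unfolding is_ideal_def by (metis subsetD)
  \<comment> \<open>Total degree \<open>n\<close> makes the coefficient of x^n constant in y, so
    substituting for y cannot kill \<open>p\<close>.\<close>
  have "coeff p n = [:coeff (coeff p n) 0:]"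
    by (rule poly_eqI) (use p(2) in \<open>auto simp: coeff_pCons bpoly_coeff_0 split: nat.split\<close>)
  then have "poly (coeff p n) y \<noteq> 0" using p(3) by (metis mult_zero_right poly_0 poly_pCons add.right_neutral)
  then have "g \<noteq> 0" unfolding g_def by (metis coeff_0 coeff_map_poly poly_0)
  obtain x where x: "1 \<notin> adjoin I1 (map_poly (\<lambda>a. [:a:]) [:- x, 1:])"
    by (rule adjoin_root_proper[OF I1(1,2) map_poly_const_mult _ gI \<open>g \<noteq> 0\<close>])
       (auto simp: map_poly_pCons is_unit_const_poly_iff is_unit_pCons_iff dvd_field_iff)
  define I2 where "I2 = adjoin I1 [:[:- x:], 1:]"
  have I2: "is_ideal I2" "1 \<notin> I2" "I1 \<subseteq> I2" "r * [:[:- x:], 1:] \<in> I2" for r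
  proof -
    have "1 \<notin> adjoin I1 [:[:- x:], 1:]" using x by (simp add: map_poly_pCons one_pCons)
    then show "is_ideal I2" "1 \<notin> I2" "I1 \<subseteq> I2" "r * [:[:- x:], 1:] \<in> I2" for r
      using is_ideal_adjoin[OF I1(1)] adjoin_subset[of I1] adjoin_mem[OF I1(1)] I1(4) unfolding I2_def by blast+
  qed
  have "aff q x y = 0" if "q \<in> I" for q
  proof (rule ccontr)
    assume a: "aff q x y \<noteq> 0"
    obtain v w where vw: "q = [:[:aff q x y:]:] + v * [:[:- x:], 1:] + w * [:[:- y, 1:]:]"
      by (rule aff_decomp)
    moreover have "q = C + v * A + w * B \<Longrightarrow> C = q + (- v) * A + (- w) * B" for A B C :: "complex poly poly"
      by (simp add: algebra_simps)
    ultimately have "[:[:aff q x y:]:] = q + (- v) * [:[:- x:], 1:] + (- w) * [:[:- y, 1:]:]" by blast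
    moreover have "q \<in> I2" "(- w) * [:[:- y, 1:]:] \<in> I2" using that I1(3,4) I2(3) by blast+
    ultimately have "[:[:aff q x y:]:] \<in> I2" using I2(1,4) unfolding is_ideal_def by metis
    then have "[:[:inverse (aff q x y):]:] * [:[:aff q x y:]:] \<in> I2" using I2(1) unfolding is_ideal_def by metis
    then show False using a I2(2) by (simp flip: one_pCons)
  qed
  then show ?thesis using that by blast
qed

section \<open>Families of cubics without common zeros\<close>

text \<open>Modulo \<open>p1, p2\<close> every power of \<open>y\<close> reduces to degree at most 4, that is, into a space of
  dimension 15, so 28 distinct powers of \<open>y\<close> are linearly dependent.\<close>

lemma eliminant:
  fixes p1 p2 :: "complex poly poly"
  assumes "cubic_pair p1 p2"
  obtains h a b where "h \<noteq> 0" "[:h:] = a * p1 + b * p2"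
proof -
  interpret cubic_pair p1 p2 by fact
  \<comment> \<open>Since \<open>iy k < 7\<close>, this labels the 28 indices by distinct
    exponents.\<close>
  define e :: "7 idx \<Rightarrow> nat" where "e k = 7 * ix k + iy k" for k
  have inj: "e k = e l \<Longrightarrow> k = l" for k l
  proof (rule idx_eqI)
    assume "e k = e l"
    moreover have "iy k < 7" "iy l < 7" using ix_iy[of k] ix_iy[of l] by simp_all
    ultimately show "ix k = ix l" "iy k = iy l" unfolding e_def by presburger+
  qed
  have "\<forall>k. \<exists>a b. [:monom 1 (e k):] - (a * p1 + b * p2) \<in> bpoly 4" using reduce by metis
  then obtain A B where AB: "\<And>k. [:monom 1 (e k):] - (A k * p1 + B k * p2) \<in> bpoly 4" by metis
  define R where "R k = [:monom 1 (e k):] - (A k * p1 + B k * p2)" for k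
  define F :: "complex ^ 7 idx \<Rightarrow> complex ^ 5 idx" where
    "F c = bvec (\<Sum>k\<in>UNIV. smult [:c $ k:] (R k))" for c
  have "linear F"
  proof (rule linearI)
    show "F (c + d) = F c + F d" for c d
    proof -
      have "smult [:(c + d) $ k:] (R k) = smult [:c $ k:] (R k) + smult [:d $ k:] (R k)" for k
        by (simp flip: smult_add_left)
      then show ?thesis by (simp add: F_def sum.distrib bvec_add del: vector_add_component)
    qed
    show "F (r *\<^sub>R c) = r *\<^sub>R F c" for r c
    proof -
      have "smult [:(r *\<^sub>R c) $ k:] (R k) = smult [:of_real r:] (smult [:c $ k:] (R k))" for k
        by (simp add: scaleR_conv_of_real[where 'a = complex] mult.commute)
      then have "F (r *\<^sub>R c) = bvec (smult [:of_real r:] (\<Sum>k\<in>UNIV. smult [:c $ k:] (R k)))"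
        unfolding F_def smult_sum_right by (simp only:)
      then show ?thesis unfolding bvec_scaleR F_def .
    qed
  qed
  then obtain c where c: "c \<noteq> 0" "F c = 0"
    by (rule linear_kernel_nontrivial) (simp_all add: CARD_idx_numeral)
  have "(\<Sum>k\<in>UNIV. smult [:c $ k:] (R k)) = 0"
    by (rule bvec_inject[where 'n = 5])
       (use c AB in \<open>auto simp: F_def R_def intro!: bpoly_sum bpoly_smult\<close>)
  moreover define h where "h = (\<Sum>k\<in>UNIV. monom (c $ k) (e k))"
  have "[:h:] = (\<Sum>k\<in>UNIV. smult [:c $ k:] [:monom 1 (e k):])"
    unfolding h_def by (intro poly_eqI) (simp add: coeff_sum coeff_pCons smult_monom split: nat.split)
  ultimately have "[:h:] = (\<Sum>k\<in>UNIV. smult [:c $ k:] [:monom 1 (e k):]) - (\<Sum>k\<in>UNIV. smult [:c $ k:] (R k))"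
    by simp
  also have "\<dots> = (\<Sum>k\<in>UNIV. smult [:c $ k:] (A k)) * p1 + (\<Sum>k\<in>UNIV. smult [:c $ k:] (B k)) * p2"
    unfolding sum_subtractf[symmetric] sum_distrib_right sum.distrib[symmetric]
    by (intro sum.cong refl) (simp add: R_def smult_diff_right smult_add_right del: smult_pCons)
  finally have "[:h:] = (\<Sum>k\<in>UNIV. smult [:c $ k:] (A k)) * p1 + (\<Sum>k\<in>UNIV. smult [:c $ k:] (B k)) * p2" .
  moreover have "h \<noteq> 0"
  proof -
    obtain k where k: "c $ k \<noteq> 0" using c(1) by (metis vec_eq_iff zero_index)
    have "coeff h (e k) = (\<Sum>l\<in>UNIV. if l = k then c $ k else 0)"
      unfolding h_def coeff_sum by (intro sum.cong) (auto simp: coeff_monom dest: inj)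
    with k show ?thesis by auto
  qed
  ultimately show ?thesis using that by blast
qed

text \<open>The eliminant leaves finitely many y; for each y, \<open>p1\<close> is a nonzero
  polynomial in x because its x^3 coefficient is a nonzero constant.\<close>

lemma finite_common_zeros:
  fixes p1 p2 :: "complex poly poly"
  assumes "cubic_pair p1 p2"
  shows "finite {(x, y). aff p1 x y = 0 \<and> aff p2 x y = 0}"
proof -
  interpret cubic_pair p1 p2 by fact
  obtain h a b where h: "h \<noteq> 0" "[:h:] = a * p1 + b * p2" using eliminant[OF assms] by blast
  define g where "g y = map_poly (\<lambda>q. poly q y) p1" for y
  have c3: "coeff p1 3 = [:coeff (coeff p1 3) 0:]"
    by (rule poly_eqI) (use p1 in \<open>auto simp: coeff_pCons bpoly_coeff_0 split: nat.split\<close>)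
  have "g y \<noteq> 0" for y
  proof -
    have "poly (coeff p1 3) y = coeff (coeff p1 3) 0" by (subst c3) simp
    then have "coeff (g y) 3 \<noteq> 0" using lead by (simp add: g_def coeff_map_poly)
    then show ?thesis by auto
  qed
  moreover have "aff p1 x y = poly (g y) x" for x y
    unfolding g_def aff_def by (induction p1) (auto simp: map_poly_pCons)
  ultimately have fin: "finite {x. aff p1 x y = 0}" for y using poly_roots_finite[of "g y"] by simp
  have "poly h y = 0" if "aff p1 x y = 0" "aff p2 x y = 0" for x y
    using arg_cong[OF h(2), of "\<lambda>q. aff q x y"] that by (simp add: aff_def)
  then have "{(x, y). aff p1 x y = 0 \<and> aff p2 x y = 0} \<subseteq> (\<lambda>(y, x). (x, y)) ` (SIGMA y:{y. poly h y = 0}. {x. aff p1 x y = 0})"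
    by force
  moreover have "finite (SIGMA y:{y. poly h y = 0}. {x. aff p1 x y = 0})"
    using fin poly_roots_finite[OF h(1)] by blast
  ultimately show ?thesis by (meson finite_imageI finite_subset)
qed

lemma cubic_tripleI:
  fixes p1 p2 :: "complex poly poly"
  assumes "cubic_pair p1 p2" "p3 \<in> bpoly 3"
    and nz: "\<And>x y. aff p1 x y = 0 \<Longrightarrow> aff p2 x y = 0 \<Longrightarrow> aff p3 x y \<noteq> 0"
  shows "cubic_triple p1 p2 p3"
proof -
  interpret cubic_pair p1 p2 by fact
  define I where "I = {a * p1 + b * p2 + c * p3 | a b c. True}"
  have mem: "a * p1 + b * p2 + c * p3 \<in> I" for a b c unfolding I_def by blast
  have "is_ideal I"
    unfolding is_ideal_def
  proof (intro conjI ballI allI)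
    fix u assume "u \<in> I"
    then obtain a b c where u: "u = a * p1 + b * p2 + c * p3" unfolding I_def by blast
    show "r * u \<in> I" for r using mem[of "r * a" "r * b" "r * c"] by (simp add: u algebra_simps)
    fix v assume "v \<in> I"
    then obtain a' b' c' where v: "v = a' * p1 + b' * p2 + c' * p3" unfolding I_def by blast
    show "u + v \<in> I" using mem[of "a + a'" "b + b'" "c + c'"] by (simp add: u v algebra_simps)
  qed
  note ideal = this
  obtain h a b where h: "h \<noteq> 0" "[:h:] = a * p1 + b * p2" using eliminant[OF assms(1)] by blast
  have I: "[:h:] \<in> I" "p1 \<in> I" "p2 \<in> I" "p3 \<in> I"
    using mem[of a b 0] mem[of 1 0 0] mem[of 0 1 0] mem[of 0 0 1] unfolding h(2) by simp_all
  have "1 \<in> I"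
  proof (rule ccontr)
    assume "1 \<notin> I"
    have "p1 \<in> bpoly (int 3)" using p1 by simp
    from ideal_common_zero[OF ideal \<open>1 \<notin> I\<close> I(1) h(1) I(2) this lead]
    obtain x y where "\<And>q. q \<in> I \<Longrightarrow> aff q x y = 0" by blast
    with I(2-4) have "aff p1 x y = 0" "aff p2 x y = 0" "aff p3 x y = 0" by simp_all
    with nz show False by simp
  qed
  then obtain a b c where "a * p1 + b * p2 + c * p3 = 1" unfolding I_def by auto
  then have "\<exists>a b c. a * p1 + b * p2 + c * p3 = 1" by (intro exI)
  with assms(1,2) show ?thesis by (intro cubic_triple.intro cubic_triple_axioms.intro)
qed

text \<open>Coefficients are sought on the moment curve (1, t, t^2, ...): each point of
  \<open>Z\<close> gives a nonzero polynomial in t and so excludes finitely many t.\<close>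

lemma avoid_finite:
  fixes v :: "nat \<Rightarrow> 'z \<Rightarrow> complex"
  assumes "finite Z" "\<And>z. z \<in> Z \<Longrightarrow> \<exists>i<n. v i z \<noteq> 0"
  obtains t where "\<And>z. z \<in> Z \<Longrightarrow> (\<Sum>i<n. t ^ i * v i z) \<noteq> 0"
proof -
  define P where "P z = (\<Sum>i<n. monom (v i z) i)" for z
  have P: "poly (P z) t = (\<Sum>i<n. t ^ i * v i z)" for z t
    by (simp add: P_def poly_sum poly_monom mult.commute)
  have "P z \<noteq> 0" if z: "z \<in> Z" for z
  proof -
    obtain i where i: "i < n" "v i z \<noteq> 0" using assms(2)[OF z] by blast
    have "coeff (P z) i = v i z" using i(1) by (simp add: P_def coeff_sum coeff_monom)
    with i show ?thesis by auto
  qed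
  then have "finite (\<Union>z\<in>Z. {t. poly (P z) t = 0})"
    by (intro finite_UN_I assms(1) poly_roots_finite)
  from ex_new_if_finite[OF infinite_UNIV_char_0 this]
  obtain t where t: "t \<notin> (\<Union>z\<in>Z. {t. poly (P z) t = 0})" ..
  show ?thesis
  proof (rule that)
    show "(\<Sum>i<n. t ^ i * v i z) \<noteq> 0" if "z \<in> Z" for z
      using t that unfolding P[symmetric] by blast
  qed
qed

lemma complex_coprimeI:
  fixes p q :: "complex poly"
  assumes "p \<noteq> 0" "\<And>x. poly p x = 0 \<Longrightarrow> poly q x \<noteq> 0"
  shows "coprime p q"
proof (rule coprimeI)
  fix d assume d: "d dvd p" "d dvd q"
  show "is_unit d"
  proof (rule ccontr)
    assume "\<not> is_unit d"
    moreover have "d \<noteq> 0" using d assms by auto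
    ultimately have "degree d \<noteq> 0" by (auto simp: is_unit_iff_degree)
    then have "\<not> constant (poly d)" by (simp add: constant_degree)
    then obtain x where "poly d x = 0" using fundamental_theorem_of_algebra by blast
    with d assms(2) show False by (metis dvdE mult_zero_left poly_mult)
  qed
qed

text \<open>The first cubic avoids [1:0:0], the second avoids the zeros of the first at infinity,
  and the third avoids the finitely many affine zeros common to both. A multiple of the first is
  subtracted from the second to remove its x^3 term, which keeps their common zeros.\<close>

lemma base_point_free_triple:
  fixes p :: "nat \<Rightarrow> complex poly poly"
  assumes p: "\<And>i. i < n \<Longrightarrow> p i \<in> bpoly 3"
    and B0: "\<exists>i<n. coeff (coeff (p i) 3) 0 \<noteq> 0"
    and B1: "\<And>x. \<exists>i<n. poly (top_form 3 (p i)) x \<noteq> 0"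
    and B2: "\<And>x y. \<exists>i<n. aff (p i) x y \<noteq> 0"
  obtains c1 c2 c3 where
    "cubic_triple (\<Sum>i<n. smult [:c1 i:] (p i)) (\<Sum>i<n. smult [:c2 i:] (p i)) (\<Sum>i<n. smult [:c3 i:] (p i))"
    "coeff (coeff (\<Sum>i<n. smult [:c2 i:] (p i)) 3) 0 = 0"
proof -
  define S where "S c = (\<Sum>i<n. smult [:c i:] (p i))" for c
  have S: "S c \<in> bpoly 3" for c unfolding S_def using p by (intro bpoly_sum bpoly_smult) auto
  have top_S: "poly (top_form 3 (S c)) x = (\<Sum>i<n. c i * poly (top_form 3 (p i)) x)" for c x
    by (simp add: S_def top_form_sum top_form_smult poly_sum)
  have aff_S: "aff (S c) x y = (\<Sum>i<n. c i * aff (p i) x y)" for c x y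
    by (simp add: S_def)
  obtain i0 where i0: "i0 < n" "coeff (coeff (p i0) 3) 0 \<noteq> 0" using B0 by blast
  define c1 where "c1 i = (if i = i0 then 1 else 0 :: complex)" for i
  have "S c1 = (\<Sum>i<n. if i = i0 then p i0 else 0)"
    unfolding S_def c1_def by (intro sum.cong) (auto simp flip: one_pCons)
  then have S1: "S c1 = p i0" using i0 by simp
  define T1 where "T1 = top_form 3 (S c1)"
  have "coeff T1 3 \<noteq> 0" using i0 by (simp add: T1_def S1 coeff_top_form)
  then have T1: "T1 \<noteq> 0" by auto
  obtain t where t: "\<And>x. x \<in> {x. poly T1 x = 0} \<Longrightarrow> (\<Sum>i<n. t ^ i * poly (top_form 3 (p i)) x) \<noteq> 0"
    using avoid_finite[of "{x. poly T1 x = 0}" n "\<lambda>i x. poly (top_form 3 (p i)) x"] poly_roots_finite[OF T1] B1 by blast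
  define l where "l = coeff (coeff (S (\<lambda>i. t ^ i)) 3) 0 / coeff (coeff (p i0) 3) 0"
  define c2 where "c2 i = t ^ i - l * c1 i" for i
  have S2: "S c2 = S (\<lambda>i. t ^ i) - smult [:l:] (S c1)"
    unfolding S_def c2_def smult_sum_right sum_subtractf[symmetric]
    by (intro sum.cong refl) (simp add: mult.commute flip: smult_diff_left)
  have S23: "coeff (coeff (S c2) 3) 0 = 0" using i0 by (simp add: S2 S1 l_def)
  have "cubic_pair (S c1) (S c2)"
  proof
    show "coprime (top_form 3 (S c1)) (top_form 3 (S c2))"
    proof (rule complex_coprimeI)
      fix x assume x: "poly (top_form 3 (S c1)) x = 0"
      then have "poly (top_form 3 (S c2)) x = poly (top_form 3 (S (\<lambda>i. t ^ i))) x"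
        by (simp add: S2 top_form_diff top_form_smult)
      also have "\<dots> \<noteq> 0" using t x unfolding top_S T1_def by auto
      finally show "poly (top_form 3 (S c2)) x \<noteq> 0" .
    qed (use T1 T1_def in auto)
    show "coeff (coeff (S c1) 3) 0 \<noteq> 0" using i0 by (simp add: S1)
  qed (rule S)+
  note pair = this
  obtain s where s: "\<And>z. z \<in> {(x, y). aff (S c1) x y = 0 \<and> aff (S c2) x y = 0} \<Longrightarrow>
      (\<Sum>i<n. s ^ i * (case z of (x, y) \<Rightarrow> aff (p i) x y)) \<noteq> 0"
    by (rule avoid_finite[OF finite_common_zeros[OF pair], of n "\<lambda>i z. case z of (x, y) \<Rightarrow> aff (p i) x y"])
       (use B2 in auto)
  have "cubic_triple (S c1) (S c2) (S (\<lambda>i. s ^ i))"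
  proof (rule cubic_tripleI[OF pair S])
    show "aff (S (\<lambda>i. s ^ i)) x y \<noteq> 0" if "aff (S c1) x y = 0" "aff (S c2) x y = 0" for x y
      using s[of "(x, y)"] that by (auto simp: aff_S)
  qed
  with S23 that[of c1 c2 "\<lambda>i. s ^ i"] show ?thesis unfolding S_def by blast
qed

text \<open>If no nontrivial combination of \<open>h1, h2\<close> were in the ideal, then the map sending \<open>(a, b, c, \<alpha>, \<beta>)\<close> to
  \<open>a p1 + b p2 + c p3 + \<alpha> h1 + \<beta> h2\<close>, extended by three functionals that vanish together
  on no Koszul syzygy, would embed \<open>\<complex>\<^bsup>32\<^esup>\<close> into \<open>\<complex>\<^bsup>31\<^esup>\<close>.\<close>

lemma sextic_codim_le_1:
  fixes p1 p2 p3 :: "complex poly poly"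
  assumes "cubic_triple p1 p2 p3" and p23: "coeff (coeff p2 3) 0 = 0"
    and h: "h1 \<in> bpoly 6" "h2 \<in> bpoly 6"
  obtains \<alpha> \<beta> where "\<alpha> \<noteq> 0 \<or> \<beta> \<noteq> 0" "smult [:\<alpha>:] h1 + smult [:\<beta>:] h2 \<in> cubic_triple.J p1 p2 p3 6"
proof -
  interpret cubic_triple p1 p2 p3 by fact
  have "p2 \<noteq> 0"
  proof
    assume "p2 = 0"
    then have "is_unit (top_form 3 p1)" using cop by simp
    then show False using degree_top1 top1_nz by (simp add: is_unit_iff_degree)
  qed
  then obtain i j where ij: "coeff (coeff p2 i) j \<noteq> 0" by (metis leading_coeff_0_iff)
  define q :: "complex ^ 4 idx \<Rightarrow> complex poly poly" where "q = vpoly"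
  define H :: "(complex ^ 4 idx) \<times> (complex ^ 4 idx) \<times> (complex ^ 4 idx) \<times> complex \<times> complex \<Rightarrow> complex poly poly" where
    "H = (\<lambda>(a, b, c, \<alpha>, \<beta>). q a * p1 + q b * p2 + q c * p3 + smult [:\<alpha>:] h1 + smult [:\<beta>:] h2)"
  define F :: "(complex ^ 4 idx) \<times> (complex ^ 4 idx) \<times> (complex ^ 4 idx) \<times> complex \<times> complex \<Rightarrow>
      (complex ^ 7 idx) \<times> complex \<times> complex \<times> complex" where
    "F = (\<lambda>z. (bvec (H z), case z of (a, b, c, \<alpha>, \<beta>) \<Rightarrow>
      (coeff (coeff (q c) 3) 0, coeff (coeff (q c) i) j, coeff (coeff (q a) i) j)))"
  have q4: "q a \<in> bpoly 3" for a
    using vpoly_in[of a] by (simp add: q_def)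
  have "linear F"
  proof (rule linearI)
    show "F (z + w) = F z + F w" for z w
    proof -
      obtain a b c \<alpha> \<beta> where zz: "z = (a, b, c, \<alpha>, \<beta>)" by (cases z) auto
      obtain a' b' c' \<alpha>' \<beta>' where ww: "w = (a', b', c', \<alpha>', \<beta>')" by (cases w) auto
      have *: "smult [:u + v:] r = smult [:u:] r + smult [:v:] r" for u v and r :: "complex poly poly"
        by (simp flip: smult_add_left)
      have "H (z + w) = H z + H w"
        unfolding zz ww H_def add_Pair prod.case * q_def vpoly_add distrib_right by (simp only: ac_simps)
      then show ?thesis unfolding F_def bvec_add by (simp add: zz ww q_def vpoly_add bvec_add)
    qed
    show "F (r *\<^sub>R z) = r *\<^sub>R F z" for r z
    proof -
      obtain a b c \<alpha> \<beta> where zz: "z = (a, b, c, \<alpha>, \<beta>)" by (cases z) auto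
      have *: "smult [:r *\<^sub>R b:] p = smult [:of_real r:] (smult [:b:] p)" for b and p :: "complex poly poly"
        by (simp add: scaleR_conv_of_real mult.commute)
      have H: "H (r *\<^sub>R z) = smult [:of_real r:] (H z)"
        unfolding zz H_def scaleR_Pair prod.case * q_def vpoly_scaleR smult_add_right mult_smult_left ..
      have "coeff (coeff (q (r *\<^sub>R v)) k) l = r *\<^sub>R coeff (coeff (q v) k) l" for v k l
        unfolding q_def vpoly_scaleR by (simp add: scaleR_conv_of_real)
      with H show ?thesis unfolding F_def bvec_scaleR by (simp add: zz bvec_scaleR)
    qed
  qed
  then obtain z where z: "z \<noteq> 0" "F z = 0"
    by (rule linear_kernel_nontrivial) (simp add: CARD_idx_numeral)
  obtain a b c \<alpha> \<beta> where zz: "z = (a, b, c, \<alpha>, \<beta>)" by (cases z) auto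
  have eqs: "coeff (coeff (q c) 3) 0 = 0" "coeff (coeff (q c) i) j = 0" "coeff (coeff (q a) i) j = 0"
    using z(2) by (simp_all add: F_def zz zero_prod_def)
  have in6: "q a * p1 \<in> bpoly 6" "q b * p2 \<in> bpoly 6" "q c * p3 \<in> bpoly 6"
    by (rule bpoly_mult_le[OF q4 p1], simp, rule bpoly_mult_le[OF q4 p2], simp, rule bpoly_mult_le[OF q4 p3], simp)
  have "H z = 0"
  proof (rule bvec_inject[where 'n = 7])
    show "H z \<in> bpoly (int CARD(7) - 1)"
      using in6 h by (auto simp: H_def zz intro!: bpoly_add bpoly_smult)
  qed (use z(2) in \<open>auto simp: F_def zero_prod_def\<close>)
  then have H0: "q a * p1 + q b * p2 + q c * p3 + smult [:\<alpha>:] h1 + smult [:\<beta>:] h2 = 0"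
    by (simp add: H_def zz)
  show ?thesis
  proof (rule that)
    have "smult [:\<alpha>:] h1 + smult [:\<beta>:] h2 = (- q a) * p1 + (- q b) * p2 + (- q c) * p3"
      using H0 by (simp add: algebra_simps eq_neg_iff_add_eq_0)
    moreover have "- q v \<in> bpoly (6 - 3)" for v using bpoly_uminus[OF q4] by simp
    ultimately show "smult [:\<alpha>:] h1 + smult [:\<beta>:] h2 \<in> J 6"
      unfolding J_def by blast
    show "\<alpha> \<noteq> 0 \<or> \<beta> \<noteq> 0"
    proof (rule ccontr)
      assume "\<not> (\<alpha> \<noteq> 0 \<or> \<beta> \<noteq> 0)"
      then have ab0: "\<alpha> = 0" "\<beta> = 0" by auto
      with H0 have "q a * p1 + q b * p2 + q c * p3 = 0" by simp
      from syzygy_cubics[OF q4 q4 q4 this] obtain u v w where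
        u: "q c = [:[:u:]:] * p1 + [:[:v:]:] * p2" "q a = - [:[:u:]:] * p3 + [:[:w:]:] * p2"
           "q b = - [:[:v:]:] * p3 - [:[:w:]:] * p1" by blast
      \<comment> \<open>Triangular elimination: the x^3 coefficient of \<open>q c\<close> is
        \<open>u\<close> times that of \<open>p1\<close> because that of \<open>p2\<close> is zero;
        then the (i, j) coefficients of \<open>q c\<close> and \<open>q a\<close> isolate
        \<open>v\<close> and \<open>w\<close>.\<close>
      have "u = 0" using eqs(1) lead p23 unfolding u(1) by simp
      moreover from this have "v = 0" using eqs(2) ij unfolding u(1) by simp
      moreover from calculation have "w = 0" using eqs(3) ij unfolding u(2) by simp
      ultimately have "q a = 0" "q b = 0" "q c = 0" using u by simp_all
      then have "a = 0" "b = 0" "c = 0" unfolding q_def by (metis bvec_vpoly bvec_0)+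
      with z(1) ab0 show False by (simp add: zz zero_prod_def)
    qed
  qed
qed

section \<open>Real functionals on complexified sextics\<close>

definition cpoly :: "real poly poly \<Rightarrow> complex poly poly" where
  "cpoly = map_poly (map_poly complex_of_real)"

lemma coeff_cpoly [simp]: "coeff (coeff (cpoly p) i) j = of_real (coeff (coeff p i) j)"
  by (simp add: cpoly_def coeff_map_poly)

lemma poly_poly_eqI: "(\<And>i j. coeff (coeff p i) j = coeff (coeff q i) j) \<Longrightarrow> p = q"
  by (intro poly_eqI)

lemma cpoly_mult: "cpoly (p * q) = cpoly p * cpoly q"
  by (rule poly_poly_eqI) (simp add: coeff_mult coeff_sum)

lemma cpoly_in: "p \<in> bpoly m \<Longrightarrow> cpoly p \<in> bpoly m"
  by (auto simp: bpoly_def)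

lemma cpoly_add: "cpoly (p + q) = cpoly p + cpoly q"
  by (rule poly_poly_eqI) simp

lemma cpoly_0 [simp]: "cpoly 0 = 0"
  by (rule poly_poly_eqI) simp

lemma cpoly_split:
  assumes "q \<in> bpoly m"
  obtains u v where "u \<in> bpoly m" "v \<in> bpoly m" "q = cpoly u + smult [:\<i>:] (cpoly v)"
proof
  show "map_poly (map_poly Re) q \<in> bpoly m" "map_poly (map_poly Im) q \<in> bpoly m"
    using assms by (auto intro!: bpolyI simp: coeff_map_poly bpoly_coeff_0)
  show "q = cpoly (map_poly (map_poly Re) q) + smult [:\<i>:] (cpoly (map_poly (map_poly Im) q))"
    by (rule poly_poly_eqI) (simp add: coeff_map_poly complex_eq)
qed

text \<open>The complex-linear extension of the real functional represented by
  \<open>l\<close>.\<close>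

definition cfun :: "real ^ 7 idx \<Rightarrow> complex poly poly \<Rightarrow> complex" where
  "cfun l h = (\<Sum>k\<in>UNIV. of_real (l $ k) * coeff (coeff h (ix k)) (iy k))"

lemma cfun_add: "cfun l (g + h) = cfun l g + cfun l h"
  by (simp add: cfun_def algebra_simps sum.distrib)

lemma cfun_smult: "cfun l (smult [:c:] h) = c * cfun l h"
  by (simp add: cfun_def sum_distrib_left algebra_simps)

lemma cfun_0 [simp]: "cfun l 0 = 0"
  by (simp add: cfun_def)

lemma cfun_sum: "cfun l (sum f I) = (\<Sum>i\<in>I. cfun l (f i))"
  by (induction I rule: infinite_finite_induct) (auto simp: cfun_add)

lemma cfun_cpoly: "cfun l (cpoly h) = of_real (l \<bullet> bvec h)"
proof -
  have "l \<bullet> bvec h = (\<Sum>k\<in>UNIV. l $ k * coeff (coeff h (ix k)) (iy k))"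
    unfolding inner_vec_def bvec_def by (simp only: vec_lambda_beta inner_real_def)
  then show ?thesis unfolding cfun_def by simp
qed

lemma cfun_monom: "cfun l (monom (monom 1 (iy k)) (ix k)) = of_real (l $ k)"
proof -
  have "cfun l (monom (monom 1 (iy k)) (ix k)) = (\<Sum>m\<in>UNIV. if m = k then of_real (l $ k) else 0)"
    unfolding cfun_def by (intro sum.cong) (auto simp: coeff_monom dest: idx_eqI)
  then show ?thesis by simp
qed

lemma monom_idx_in: "monom (monom c (iy k)) (ix k) \<in> bpoly (bdeg TYPE('n))" for k :: "'n::finite idx"
  using ix_iy[of k] by (intro bpoly_monom) linarith

text \<open>For the cubics of a tuple these are the normals to the image of the derivative of the
  sum-of-squares map; see \<open>annihilator_bil\<close>.\<close>

definition annihilator :: "(nat \<Rightarrow> real poly poly) \<Rightarrow> (real ^ 7 idx) set" where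
  "annihilator p = {l. \<forall>i<4. \<forall>q\<in>bpoly 3. l \<bullet> bvec (p i * q) = 0}"

text \<open>\<open>B0\<close>, \<open>B1\<close> and \<open>B2\<close> concern the points [1:0:0],
  [x:1:0] and [x:y:1], which make up the complex projective plane.\<close>

locale base_point_free =
  fixes p :: "nat \<Rightarrow> real poly poly"
  assumes p: "\<And>i. i < 4 \<Longrightarrow> p i \<in> bpoly 3"
    and B0: "\<exists>i<4. coeff (coeff (p i) 3) 0 \<noteq> 0"
    and B1: "\<And>x. \<exists>i<4. poly (top_form 3 (cpoly (p i))) x \<noteq> 0"
    and B2: "\<And>x y. \<exists>i<4. aff (cpoly (p i)) x y \<noteq> 0"
begin

lemma cfun_ideal:
  assumes "l \<in> annihilator p" "q \<in> bpoly 3" "i < 4"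
  shows "cfun l (q * cpoly (p i)) = 0"
proof -
  obtain u v where uv: "u \<in> bpoly 3" "v \<in> bpoly 3" "q = cpoly u + smult [:\<i>:] (cpoly v)"
    using assms(2) by (rule cpoly_split)
  have "q * cpoly (p i) = cpoly (p i * u) + smult [:\<i>:] (cpoly (p i * v))"
    unfolding uv(3) cpoly_mult distrib_right mult_smult_left by (simp only: mult.commute)
  with assms uv show ?thesis by (simp add: cfun_add cfun_smult cfun_cpoly annihilator_def del: smult_pCons)
qed

text \<open>Combinations of the \<open>p i\<close> generate a smaller ideal, so annihilators of the
  family kill its degree 6 part.\<close>

lemma triple:
  obtains q1 q2 q3 where "cubic_triple q1 q2 q3" "coeff (coeff q2 3) 0 = 0"
    "\<And>l h. l \<in> annihilator p \<Longrightarrow> h \<in> cubic_triple.J q1 q2 q3 6 \<Longrightarrow> cfun l h = 0"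
proof -
  obtain c1 c2 c3 where c:
    "cubic_triple (\<Sum>i<4. smult [:c1 i:] (cpoly (p i))) (\<Sum>i<4. smult [:c2 i:] (cpoly (p i))) (\<Sum>i<4. smult [:c3 i:] (cpoly (p i)))"
    "coeff (coeff (\<Sum>i<4. smult [:c2 i:] (cpoly (p i))) 3) 0 = 0"
    by (rule base_point_free_triple[of 4 "\<lambda>i. cpoly (p i)"])
       (use cpoly_in[OF p] B0 B1 B2 in auto)
  show ?thesis
  proof (rule that[OF c])
    fix l h assume l: "l \<in> annihilator p"
    have 0: "cfun l (a * (\<Sum>i<4. smult [:c i:] (cpoly (p i)))) = 0" if "a \<in> bpoly (6 - 3)" for a c
      using that l by (simp add: sum_distrib_left cfun_sum mult_smult_right cfun_smult cfun_ideal)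
    assume "h \<in> cubic_triple.J (\<Sum>i<4. smult [:c1 i:] (cpoly (p i))) (\<Sum>i<4. smult [:c2 i:] (cpoly (p i)))
      (\<Sum>i<4. smult [:c3 i:] (cpoly (p i))) 6"
    then show "cfun l h = 0"
      unfolding cubic_triple.J_def[OF c(1)] using 0 by (auto simp: cfun_add)
  qed
qed

text \<open>Codimension at most one of \<open>J 6\<close> relates any two monomials; applying both
  functionals to the relation makes their coordinates proportional.\<close>

lemma annihilator_dim_le_1:
  assumes l: "l1 \<in> annihilator p" "l2 \<in> annihilator p" and nz: "l1 \<noteq> 0"
  obtains r where "l2 = r *\<^sub>R l1"
proof -
  obtain q1 q2 q3 where q: "cubic_triple q1 q2 q3" "coeff (coeff q2 3) 0 = 0"
    and J: "\<And>l h. l \<in> annihilator p \<Longrightarrow> h \<in> cubic_triple.J q1 q2 q3 6 \<Longrightarrow> cfun l h = 0"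
    using triple by blast
  obtain k where k: "l1 $ k \<noteq> 0" using nz by (metis vec_eq_iff zero_index)
  have eq: "l2 $ m = l2 $ k / l1 $ k * l1 $ m" for m
  proof -
    have mem: "monom (monom 1 (iy n)) (ix n) \<in> bpoly 6" for n :: "7 idx"
      using monom_idx_in[of 1 n] by simp
    from sextic_codim_le_1[OF q mem[of k] mem[of m]] obtain \<alpha> \<beta> where ab: "\<alpha> \<noteq> 0 \<or> \<beta> \<noteq> 0"
      "smult [:\<alpha>:] (monom (monom 1 (iy k)) (ix k)) + smult [:\<beta>:] (monom (monom 1 (iy m)) (ix m)) \<in> cubic_triple.J q1 q2 q3 6"
      by blast
    have e: "\<alpha> * of_real (l1 $ k) + \<beta> * of_real (l1 $ m) = 0" "\<alpha> * of_real (l2 $ k) + \<beta> * of_real (l2 $ m) = 0"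
      using J[OF l(1) ab(2)] J[OF l(2) ab(2)] by (simp_all only: cfun_add cfun_smult cfun_monom)
    have "\<alpha> = 0" if "\<beta> = 0" using e(1) k unfolding that by simp
    with ab(1) have "\<beta> \<noteq> 0" by blast
    moreover have "\<beta> * (of_real (l2 $ m) * of_real (l1 $ k)) = \<beta> * (of_real (l2 $ k) * of_real (l1 $ m))"
    proof -
      have 1: "\<beta> * of_real (l1 $ m) = - (\<alpha> * of_real (l1 $ k))" "\<beta> * of_real (l2 $ m) = - (\<alpha> * of_real (l2 $ k))"
        unfolding eq_neg_iff_add_eq_0 using e by (simp_all only: add.commute)
      have "\<beta> * (of_real (l2 $ m) * of_real (l1 $ k)) = (\<beta> * of_real (l2 $ m)) * of_real (l1 $ k)"
        by (simp only: mult.assoc)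
      also have "\<dots> = of_real (l2 $ k) * (\<beta> * of_real (l1 $ m))"
        unfolding 1 by (simp only: mult_minus_left mult_minus_right mult_ac)
      finally show ?thesis by (simp only: mult_ac)
    qed
    ultimately have "complex_of_real (l2 $ m) * of_real (l1 $ k) = of_real (l2 $ k) * of_real (l1 $ m)" by simp
    then have "l2 $ m * l1 $ k = l2 $ k * l1 $ m" unfolding of_real_mult[symmetric] of_real_eq_iff .
    with k show ?thesis by (simp add: field_simps)
  qed
  show ?thesis
  proof (rule that)
    show "l2 = (l2 $ k / l1 $ k) *\<^sub>R l1"
      unfolding vec_eq_iff vector_scaleR_component real_scaleR_def using eq by (rule allI)
  qed
qed

text \<open>All products of \<open>p i\<close> with cubic monomials are killed by \<open>l\<close>
  and therefore lie in \<open>J 6\<close>. Then \<open>socle_cubic\<close> puts the four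
  \<open>p i\<close> into a space spanned by three cubics.\<close>

lemma annihilator_dependent:
  assumes l: "l \<in> annihilator p" and nz: "l \<noteq> 0"
  obtains c :: "nat \<Rightarrow> real" where "(\<Sum>i<4. smult [:c i:] (p i)) = 0" "\<exists>i<4. c i \<noteq> 0"
proof -
  obtain q1 q2 q3 where q: "cubic_triple q1 q2 q3" "coeff (coeff q2 3) 0 = 0"
    and J: "\<And>l h. l \<in> annihilator p \<Longrightarrow> h \<in> cubic_triple.J q1 q2 q3 6 \<Longrightarrow> cfun l h = 0"
    using triple by blast
  interpret cubic_triple q1 q2 q3 by fact
  obtain k where k: "l $ k \<noteq> 0" using nz by (metis vec_eq_iff zero_index)
  have "\<exists>\<alpha> \<beta> \<gamma>. cpoly (p i) = [:[:\<alpha>:]:] * q1 + [:[:\<beta>:]:] * q2 + [:[:\<gamma>:]:] * q3" if i: "i < 4" for i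
  proof -
    have "monom (monom 1 n) m * cpoly (p i) \<in> J 6" if "m + n \<le> 3" for m n
    proof -
      let ?h = "monom (monom 1 n) m * cpoly (p i)"
      have w: "monom (monom 1 n) m \<in> bpoly 3" using that by (intro bpoly_monom) auto
      have h: "?h \<in> bpoly 6" by (rule bpoly_mult_le[OF w cpoly_in[OF p[OF i]]]) simp
      have "monom (monom 1 (iy k)) (ix k) \<in> bpoly 6" using monom_idx_in[of 1 k] by simp
      from sextic_codim_le_1[OF q this h] obtain \<alpha> \<beta> where ab: "\<alpha> \<noteq> 0 \<or> \<beta> \<noteq> 0"
        "smult [:\<alpha>:] (monom (monom 1 (iy k)) (ix k)) + smult [:\<beta>:] ?h \<in> J 6" by blast
      have "\<alpha> * of_real (l $ k) + \<beta> * cfun l ?h = 0"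
        using J[OF l ab(2)] by (simp only: cfun_add cfun_smult cfun_monom)
      \<comment> \<open>\<open>l\<close> kills \<open>?h\<close> but not the monomial with index
        \<open>k\<close>, so the relation involves \<open>?h\<close> alone.\<close>
      then have "\<alpha> = 0" using k cfun_ideal[OF l w i] by simp
      with ab have \<beta>: "\<beta> \<noteq> 0" "smult [:\<beta>:] ?h \<in> J 6" by auto
      then obtain a b c where abc: "smult [:\<beta>:] ?h = a * q1 + b * q2 + c * q3"
        "a \<in> bpoly (6 - 3)" "b \<in> bpoly (6 - 3)" "c \<in> bpoly (6 - 3)" unfolding J_def by blast
      have "?h = smult [:inverse \<beta>:] (smult [:\<beta>:] ?h)" using \<beta>(1) by (simp flip: one_pCons)
      also have "\<dots> = smult [:inverse \<beta>:] a * q1 + smult [:inverse \<beta>:] b * q2 + smult [:inverse \<beta>:] c * q3"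
        unfolding abc(1) by (simp add: smult_add_right)
      finally show ?thesis unfolding J_def using abc(2-4) bpoly_smult by blast
    qed
    from socle_cubic[OF cpoly_in[OF p[OF i]] this] show ?thesis by blast
  qed
  then obtain A B C where ABC: "\<And>i. i < 4 \<Longrightarrow> cpoly (p i) = [:[:A i:]:] * q1 + [:[:B i:]:] * q2 + [:[:C i:]:] * q3"
    by metis
  define F :: "(complex \<times> complex \<times> complex \<times> complex) \<Rightarrow> complex \<times> complex \<times> complex" where
    "F = (\<lambda>(x, y, z, w). (x * A 0 + y * A 1 + z * A 2 + w * A 3, x * B 0 + y * B 1 + z * B 2 + w * B 3,
       x * C 0 + y * C 1 + z * C 2 + w * C 3))"
  have "linear F"
    by (rule linearI) (auto simp: F_def distrib_right distrib_left scaleR_conv_of_real[where 'a = complex] mult.assoc)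
  then obtain t where t: "t \<noteq> 0" "F t = 0"
    by (rule linear_kernel_nontrivial) simp
  obtain x y z w where xyz: "t = (x, y, z, w)" by (cases t) auto
  define d where "d i = (if i = 0 then x else if i = 1 then y else if i = 2 then z else w)" for i :: nat
  have d: "\<exists>i<4. d i \<noteq> 0"
  proof (rule ccontr)
    assume "\<not> (\<exists>i<4. d i \<noteq> 0)"
    then have "d 0 = 0" "d 1 = 0" "d 2 = 0" "d 3 = 0" by auto
    then show False using t(1) by (simp add: d_def xyz zero_prod_def)
  qed
  have s4: "(\<Sum>i<4. f i) = f 0 + f 1 + f 2 + f 3" for f :: "nat \<Rightarrow> 'b::comm_monoid_add"
    by (simp add: eval_nat_numeral)
  have "(\<Sum>i<4. smult [:d i:] (cpoly (p i))) = (\<Sum>i<4. [:[:d i * A i:]:] * q1 + [:[:d i * B i:]:] * q2 + [:[:d i * C i:]:] * q3)"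
    by (intro sum.cong refl) (simp add: ABC smult_add_right mult.commute)
  also have "\<dots> = [:[:\<Sum>i<4. d i * A i:]:] * q1 + [:[:\<Sum>i<4. d i * B i:]:] * q2 + [:[:\<Sum>i<4. d i * C i:]:] * q3"
  proof -
    have "[:[:\<Sum>i<4. f i:]:] = (\<Sum>i<4. [:[:f i:]:])" for f :: "nat \<Rightarrow> complex"
      by (simp add: s4)
    then show ?thesis by (simp only: sum.distrib sum_distrib_right)
  qed
  also have "\<dots> = 0"
    using t(2) by (simp add: s4 d_def F_def xyz zero_prod_def)
  finally have dep: "(\<Sum>i<4. smult [:d i:] (cpoly (p i))) = 0" .
  have cc: "(\<Sum>i<4. d i * of_real (coeff (coeff (p i) m) n)) = 0" for m n
    using arg_cong[OF dep, of "\<lambda>q. coeff (coeff q m) n"] by (simp add: coeff_sum)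
  have R: "(\<Sum>i<4. smult [:Re (d i):] (p i)) = 0"
  proof (rule poly_poly_eqI)
    show "coeff (coeff (\<Sum>i<4. smult [:Re (d i):] (p i)) m) n = coeff (coeff 0 m) n" for m n
      using arg_cong[OF cc[of m n], of Re] by (simp add: coeff_sum)
  qed
  have I: "(\<Sum>i<4. smult [:Im (d i):] (p i)) = 0"
  proof (rule poly_poly_eqI)
    show "coeff (coeff (\<Sum>i<4. smult [:Im (d i):] (p i)) m) n = coeff (coeff 0 m) n" for m n
      using arg_cong[OF cc[of m n], of Im] by (simp add: coeff_sum)
  qed
  \<comment> \<open>The cubics are real, so both parts of the complex relation are real relations,
    one of them nontrivial.\<close>
  obtain i where "i < 4" "d i \<noteq> 0" using d by blast
  then have "Re (d i) \<noteq> 0 \<or> Im (d i) \<noteq> 0" by (simp add: complex_eq_iff)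
  with \<open>i < 4\<close> R I that[of "\<lambda>i. Re (d i)"] that[of "\<lambda>i. Im (d i)"] show ?thesis by blast
qed

end

section \<open>Openness of the sum of four squares\<close>

inductive_set sos_cone :: "(real ^ 7 idx) set" where
  zero: "0 \<in> sos_cone"
| step: "v \<in> sos_cone \<Longrightarrow> q \<in> bpoly 3 \<Longrightarrow> v + bvec (q\<^sup>2) \<in> sos_cone"

lemma sos_cone_add:
  assumes "v \<in> sos_cone" "w \<in> sos_cone"
  shows "v + w \<in> sos_cone"
  using assms(2,1) by (induction w rule: sos_cone.induct) (auto simp: add.assoc[symmetric] intro: sos_cone.step)

lemma sos_cone_scaleR: "v \<in> sos_cone \<Longrightarrow> r \<ge> 0 \<Longrightarrow> r *\<^sub>R v \<in> sos_cone"
proof (induction v rule: sos_cone.induct)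
  case (step v q)
  have "r *\<^sub>R bvec (q\<^sup>2) = (bvec ((smult [:sqrt r:] q)\<^sup>2) :: real ^ 7 idx)"
  proof -
    have "(smult [:sqrt r:] q)\<^sup>2 = smult [:of_real r:] (q\<^sup>2)" using step.prems by (simp add: power2_eq_square)
    then show ?thesis by (simp only: bvec_scaleR)
  qed
  then show ?case
    using sos_cone.step[OF step.IH[OF step.prems], of "smult [:sqrt r:] q"] step.hyps(2)
    by (simp add: scaleR_add_right bpoly_smult)
qed (auto intro: sos_cone.zero)

lemma convex_sos_cone: "convex sos_cone"
  by (rule convexI) (auto intro: sos_cone_add sos_cone_scaleR)

lemma sos_cone_sum:
  "(\<And>i. i \<in> I \<Longrightarrow> q i \<in> bpoly 3) \<Longrightarrow> bvec (\<Sum>i\<in>I. (q i)\<^sup>2) \<in> sos_cone"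
proof (induction I rule: infinite_finite_induct)
  case (insert i I)
  then show ?case using sos_cone.step[of "bvec (\<Sum>i\<in>I. (q i)\<^sup>2)" "q i"] by (simp add: bvec_add add.commute)
qed (auto intro: sos_cone.zero)

text \<open>From an interior point a small step along \<open>- l\<close> stays in the cone, where
  \<open>l\<close> is nonnegative.\<close>

lemma interior_sos_cone_pos:
  assumes f: "f \<in> interior sos_cone" and l: "l \<noteq> 0" "\<And>q. q \<in> bpoly 3 \<Longrightarrow> l \<bullet> bvec (q\<^sup>2) \<ge> 0"
  shows "l \<bullet> f > 0"
proof -
  have pos: "l \<bullet> v \<ge> 0" if "v \<in> sos_cone" for v
    using that by (induction v rule: sos_cone.induct) (auto simp: inner_add_right l(2))
  obtain e where e: "e > 0" "cball f e \<subseteq> sos_cone"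
    using f by (auto simp: mem_interior_cball)
  have "f - (e / norm l) *\<^sub>R l \<in> cball f e" using e l by (simp add: dist_norm)
  then have "l \<bullet> (f - (e / norm l) *\<^sub>R l) \<ge> 0" using e pos by blast
  moreover have "l \<bullet> ((e / norm l) *\<^sub>R l) > 0" using e l by simp
  ultimately show ?thesis by (simp add: inner_diff_right)
qed

section \<open>The sum-of-squares map on four-tuples of cubics\<close>

type_synonym cubic = "real ^ 4 idx"
type_synonym cubics = "cubic \<times> cubic \<times> cubic \<times> cubic"

definition pr :: "nat \<Rightarrow> cubics \<Rightarrow> cubic" where
  "pr i z = (if i = 0 then fst z else if i = 1 then fst (snd z)
     else if i = 2 then fst (snd (snd z)) else snd (snd (snd z)))"

definition tup :: "(nat \<Rightarrow> cubic) \<Rightarrow> cubics" where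
  "tup f = (f 0, f 1, f 2, f 3)"

lemma sum_lessThan_4: "(\<Sum>i<4. f i) = f 0 + f 1 + f 2 + f (3::nat)"
  by (simp add: eval_nat_numeral)

lemma all_less_4: "(\<forall>i<4. P i) \<longleftrightarrow> P 0 \<and> P 1 \<and> P 2 \<and> P (3::nat)"
proof -
  have "i < 4 \<longleftrightarrow> i = 0 \<or> i = 1 \<or> i = 2 \<or> i = 3" for i :: nat by auto
  then show ?thesis by auto
qed

lemma pr_tup: "i < 4 \<Longrightarrow> pr i (tup f) = f i"
  by (auto simp: pr_def tup_def eval_nat_numeral less_Suc_eq)

lemma pr_simps [simp]: "pr i (a + b) = pr i a + pr i b" "pr i (r *\<^sub>R a) = r *\<^sub>R pr i a" "pr i 0 = 0"
  by (simp_all add: pr_def)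

lemma cubics_eqI: "(\<And>i. i < 4 \<Longrightarrow> pr i a = pr i b) \<Longrightarrow> a = b"
  using all_less_4[of "\<lambda>i. pr i a = pr i b"] by (auto simp: pr_def prod_eq_iff)

definition cub :: "cubics \<Rightarrow> nat \<Rightarrow> real poly poly" where
  "cub z i = vpoly (pr i z)"

lemma cub_in: "cub z i \<in> bpoly 3"
  using vpoly_in[of "pr i z"] by (simp add: cub_def)

lemma cub_add: "cub (a + b) i = cub a i + cub b i"
  by (simp add: cub_def vpoly_add)

lemma cub_scaleR: "cub (r *\<^sub>R a) i = smult [:r:] (cub a i)"
  using vpoly_scaleR[of r "pr i a"] by (simp add: cub_def)

lemma cub_tup: "i < 4 \<Longrightarrow> cub (tup f) i = vpoly (f i)"
  by (simp add: cub_def pr_tup)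

text \<open>The polar form of \<open>sos4\<close>: the derivative of \<open>sos4\<close> at
  \<open>a\<close> is \<open>2 *\<^sub>R bil a b\<close> in direction \<open>b\<close>.\<close>

definition bil :: "cubics \<Rightarrow> cubics \<Rightarrow> real ^ 7 idx" where
  "bil a b = bvec (\<Sum>i<4. cub a i * cub b i)"

definition sos4 :: "cubics \<Rightarrow> real ^ 7 idx" where
  "sos4 z = bvec (\<Sum>i<4. (cub z i)\<^sup>2)"

lemma sos4_bil: "sos4 z = bil z z"
  by (simp add: sos4_def bil_def power2_eq_square)

lemma bil_commute: "bil a b = bil b a"
  by (simp add: bil_def mult.commute)

lemma linear_bil: "linear (bil a)"
proof (rule linearI)
  show "bil a (b + c) = bil a b + bil a c" for b c
    by (simp add: bil_def cub_add distrib_left sum.distrib bvec_add)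
  show "bil a (r *\<^sub>R b) = r *\<^sub>R bil a b" for r b
  proof -
    have "bil a (r *\<^sub>R b) = bvec (smult [:of_real r:] (\<Sum>i<4. cub a i * cub b i))"
      unfolding bil_def cub_scaleR mult_smult_right smult_sum_right by simp
    then show ?thesis unfolding bvec_scaleR bil_def .
  qed
qed

lemma bounded_bilinear_bil: "bounded_bilinear bil"
proof -
  have "linear (\<lambda>x. bil x y)" for y
    using linear_bil[of y] by (simp add: bil_commute[of _ y])
  then show ?thesis
    using linear_bil by (simp add: bilinear_def flip: bilinear_conv_bounded_bilinear)
qed

interpretation bil: bounded_bilinear bil
  by (rule bounded_bilinear_bil)

lemma sos4_add: "sos4 (z + a) = sos4 z + 2 *\<^sub>R bil z a + sos4 a"
  by (simp add: sos4_bil bil.add_left bil.add_right bil_commute[of a z] scaleR_2)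

lemma sos4_scaleR: "sos4 (r *\<^sub>R a) = r\<^sup>2 *\<^sub>R sos4 a"
  by (simp add: sos4_bil bil.scaleR_left bil.scaleR_right power2_eq_square)

lemma continuous_sos4: "continuous_on S sos4"
  unfolding sos4_bil by (intro bil.continuous_on continuous_on_id)

lemma range_sos4_subset: "range sos4 \<subseteq> sos_cone"
  unfolding sos4_def by (auto intro!: sos_cone_sum cub_in)

lemma annihilator_bil: "l \<in> annihilator (cub z) \<longleftrightarrow> (\<forall>a. l \<bullet> bil z a = 0)"
proof
  assume l: "l \<in> annihilator (cub z)"
  show "\<forall>a. l \<bullet> bil z a = 0"
    using l cub_in unfolding annihilator_def bil_def bvec_sum inner_sum_right by simp
next
  assume r: "\<forall>a. l \<bullet> bil z a = 0"
  show "l \<in> annihilator (cub z)"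
    unfolding annihilator_def
  proof (intro CollectI allI impI ballI)
    fix i and q :: "real poly poly" assume i: "i < (4::nat)" and q: "q \<in> bpoly 3"
    have "(\<Sum>j<4. cub z j * cub (tup (\<lambda>j. if j = i then bvec q else 0)) j) = (\<Sum>j<4. if j = i then cub z i * q else 0)"
      using q by (intro sum.cong) (auto simp: cub_tup vpoly_bvec)
    also have "\<dots> = cub z i * q" using i by simp
    finally have "bil z (tup (\<lambda>j. if j = i then bvec q else 0)) = bvec (cub z i * q)" by (simp add: bil_def)
    with r show "l \<bullet> bvec (cub z i * q) = 0" by metis
  qed
qed

lemma linear_surj_if_no_normal:
  fixes D :: "'a::euclidean_space \<Rightarrow> 'b::euclidean_space"
  assumes D: "linear D" and n: "\<And>l. (\<And>a. l \<bullet> D a = 0) \<Longrightarrow> l = 0"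
  shows "surj D"
proof (rule ccontr)
  assume "\<not> surj D"
  moreover have "span (range D) = range D"
    using D by (metis linear_subspace_image span_eq_iff subspace_UNIV)
  ultimately have "span (range D) \<subset> UNIV" by (metis subset_UNIV psubsetI)
  then obtain l where "l \<noteq> 0" "\<And>y. y \<in> span (range D) \<Longrightarrow> orthogonal l y"
    using orthogonal_to_subspace_exists_gen[of "range D" UNIV] by (metis span_UNIV)
  then show False using n[of l] by (simp add: orthogonal_def span_base)
qed

lemma has_derivative_zero_if_quadratic:
  fixes E :: "'a::real_normed_vector \<Rightarrow> 'b::real_normed_vector"
  assumes "\<And>y. norm (E y) \<le> M * (norm y)\<^sup>2"
  shows "(E has_derivative (\<lambda>_. 0)) (at 0)"
proof -
  have E0: "E 0 = 0" using assms[of 0] by simp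
  have "((\<lambda>h. norm (E h) / norm h) \<longlongrightarrow> 0) (at 0)"
  proof (rule Lim_null_comparison)
    show "\<forall>\<^sub>F h in at 0. norm (norm (E h) / norm h) \<le> \<bar>M\<bar> * norm h"
    proof (intro always_eventually allI)
      fix h
      have "norm (E h) \<le> (\<bar>M\<bar> * norm h) * norm h"
        using assms[of h] mult_right_mono[OF abs_ge_self[of M] zero_le_power2[of "norm h"]]
        by (simp add: power2_eq_square mult.assoc)
      then show "norm (norm (E h) / norm h) \<le> \<bar>M\<bar> * norm h"
        by (cases "h = 0") (auto simp: divide_le_eq)
    qed
    show "((\<lambda>h. \<bar>M\<bar> * norm h) \<longlongrightarrow> 0) (at 0)"
      by (auto intro!: tendsto_eq_intros)
  qed
  then show ?thesis by (simp add: has_derivative_at E0)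
qed

text \<open>Sussmann's theorem needs continuity and a derivative at the single point 0 with a right
  inverse. Smoothness of \<open>E\<close> away from 0 is not assumed, which admits the
  \<open>min\<close> in \<open>open_at_corank_one\<close>.\<close>

lemma open_at_if_quadratic_remainder:
  fixes D :: "'a::euclidean_space \<Rightarrow> 'b::euclidean_space"
  assumes D: "linear D" "surj D" and E: "continuous_on UNIV E" "\<And>y. norm (E y) \<le> M * (norm y)\<^sup>2"
    and \<Phi>: "\<And>y. u + D y + E y \<in> R"
  shows "u \<in> interior R"
proof -
  define F where "F y = u + D y + E y" for y
  have "(F has_derivative (\<lambda>y. 0 + D y + 0)) (at 0)"
    unfolding F_def
    by (intro has_derivative_add has_derivative_const has_derivative_zero_if_quadratic[OF E(2)])
       (simp add: D(1) linear_imp_has_derivative)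
  then have dF: "(F has_derivative D) (at 0)" by simp
  obtain g where g: "linear g" "D \<circ> g = id"
    using linear_surjective_right_inverse[OF D] by blast
  have "continuous_on UNIV F"
    unfolding F_def by (intro continuous_on_add continuous_on_const E(1) linear_continuous_on linear_conv_bounded_linear[THEN iffD1] D(1))
  from sussmann_open_mapping[OF open_UNIV this UNIV_I dF linear_conv_bounded_linear[THEN iffD1, OF g(1)] g(2) subset_UNIV]
  have "F 0 \<in> interior (F ` UNIV)" by simp
  moreover have "F 0 = u" using E(2)[of 0] linear_0[OF D(1)] by (simp add: F_def)
  moreover have "F ` UNIV \<subseteq> R" using \<Phi> by (auto simp: F_def)
  ultimately show ?thesis using interior_mono by blast
qed

lemma open_at_regular:
  assumes "annihilator (cub z) \<subseteq> {0}"
  shows "sos4 z \<in> interior (range sos4)"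
proof -
  obtain M where M: "\<And>a b. norm (bil a b) \<le> norm a * norm b * M"
    using bil.bounded by blast
  show ?thesis
  proof (rule open_at_if_quadratic_remainder)
    show "linear (\<lambda>a. 2 *\<^sub>R bil z a)" using linear_bil by (rule linear_compose_scale_right)
    show "surj (\<lambda>a. 2 *\<^sub>R bil z a)"
    proof (rule linear_surj_if_no_normal[OF \<open>linear (\<lambda>a. 2 *\<^sub>R bil z a)\<close>])
      fix l assume l: "\<And>a. l \<bullet> 2 *\<^sub>R bil z a = 0"
      have "l \<bullet> bil z a = 0" for a using l[of a] by simp
      then have "l \<in> annihilator (cub z)" unfolding annihilator_bil by blast
      with assms show "l = 0" by blast
    qed
    show "norm (sos4 y) \<le> M * (norm y)\<^sup>2" for y
      using M[of y y] by (simp add: sos4_bil power2_eq_square mult_ac)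
    show "sos4 z + 2 *\<^sub>R bil z y + sos4 y \<in> range sos4" for y
      by (simp flip: sos4_add)
  qed (rule continuous_sos4)
qed

text \<open>The unused direction \<open>c\<close> lets one add \<open>s q\<^sup>2\<close> or \<open>s q'\<^sup>2\<close> for small \<open>s > 0\<close>.
  The correction \<open>b\<close> makes the two one-sided derivatives agree.\<close>

lemma open_at_corank_one:
  assumes dep: "(\<Sum>i<4. smult [:c i:] (cub z i)) = 0" "\<exists>i<4. c i \<noteq> (0::real)"
    and l: "l \<in> annihilator (cub z)" "\<And>l'. l' \<in> annihilator (cub z) \<Longrightarrow> \<exists>r. l' = r *\<^sub>R l"
    and q: "q \<in> bpoly 3" "l \<bullet> bvec (q\<^sup>2) = 1" and q': "q' \<in> bpoly 3" "l \<bullet> bvec (q'\<^sup>2) = - 1"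
  shows "sos4 z \<in> interior (range sos4)"
proof -
  define N where "N = (\<Sum>i<4. (c i)\<^sup>2)"
  have "N > 0" unfolding N_def using dep(2) by (auto intro!: sum_pos2)
  \<comment> \<open>A unit vector along the relation. Below, \<open>T v\<close> places a cubic in
    direction \<open>d\<close> and \<open>pj\<close> removes that component. Then \<open>T v\<close>
    is orthogonal under \<open>bil\<close> to \<open>z\<close> and to every \<open>pj a\<close>, so
    adding it contributes exactly the square of \<open>v\<close>.\<close>
  define d where "d i = c i / sqrt N" for i
  have d1: "(\<Sum>i<4. d i * d i) = 1"
  proof -
    have "(\<Sum>i<4. d i * d i) = (\<Sum>i<4. (c i)\<^sup>2) / N"
      using \<open>N > 0\<close> by (simp add: d_def sum_divide_distrib power2_eq_square)
    with \<open>N > 0\<close> show ?thesis by (simp add: N_def)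
  qed
  have dz: "(\<Sum>i<4. smult [:d i:] (cub z i)) = 0"
  proof -
    have "(\<Sum>i<4. smult [:d i:] (cub z i)) = smult [:1 / sqrt N:] (\<Sum>i<4. smult [:c i:] (cub z i))"
      unfolding smult_sum_right by (intro sum.cong refl) (simp add: d_def)
    with dep(1) show ?thesis by simp
  qed
  define w where "w a = (\<Sum>i<4. d i *\<^sub>R pr i a)" for a
  define pj where "pj a = tup (\<lambda>i. pr i a - d i *\<^sub>R w a)" for a
  define T where "T v = tup (\<lambda>i. d i *\<^sub>R v)" for v
  have vd: "vpoly (r *\<^sub>R v) = smult [:r:] (vpoly v)" for r and v :: cubic
    using vpoly_scaleR[of r v] by simp
  have w_vpoly: "vpoly (w a) = (\<Sum>i<4. smult [:d i:] (cub a i))" for a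
    by (simp add: w_def vpoly_sum vd cub_def)
  have cub_T: "cub (T v) i = smult [:d i:] (vpoly v)" if "i < 4" for i v
    using that by (simp add: T_def cub_tup vd)
  have cub_pj: "cub (pj a) i = cub a i - smult [:d i:] (vpoly (w a))" if "i < 4" for i a
    unfolding pj_def cub_tup[OF that] vpoly_diff vd by (simp add: cub_def)
  have TT: "sos4 (T v) = bvec ((vpoly v)\<^sup>2)" for v
  proof -
    have "(\<Sum>i<4. (cub (T v) i)\<^sup>2) = (\<Sum>i<4. smult [:d i * d i:] ((vpoly v)\<^sup>2))"
      by (intro sum.cong refl) (simp add: cub_T power2_eq_square)
    also have "\<dots> = smult [:\<Sum>i<4. d i * d i:] ((vpoly v)\<^sup>2)"
      by (simp add: sum_lessThan_4 flip: smult_add_left)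
    finally show ?thesis unfolding sos4_def d1 by (simp flip: one_pCons)
  qed
  have orth: "(\<Sum>i<4. cub a i * smult [:d i:] x) = (\<Sum>i<4. smult [:d i:] (cub a i)) * x" for a x
    by (simp add: sum_distrib_right)
  have zT: "bil z (T v) = 0" for v
  proof -
    have "(\<Sum>i<4. cub z i * cub (T v) i) = (\<Sum>i<4. cub z i * smult [:d i:] (vpoly v))"
      by (intro sum.cong refl) (simp add: cub_T)
    then show ?thesis by (simp only: bil_def orth dz mult_zero_left bvec_0)
  qed
  have zpj: "bil z (pj a) = bil z a" for a
  proof -
    have "(\<Sum>i<4. cub z i * cub (pj a) i) = (\<Sum>i<4. cub z i * cub a i) - (\<Sum>i<4. cub z i * smult [:d i:] (vpoly (w a)))"
      unfolding sum_subtractf[symmetric] by (intro sum.cong refl) (simp add: cub_pj right_diff_distrib)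
    then show ?thesis by (simp only: bil_def orth dz mult_zero_left diff_zero)
  qed
  have pjT: "bil (pj a) (T v) = 0" for a v
  proof -
    have "(\<Sum>i<4. cub (pj a) i * cub (T v) i) = (\<Sum>i<4. smult [:d i:] (cub (pj a) i)) * vpoly v"
      unfolding orth[symmetric] by (intro sum.cong refl) (simp add: cub_T)
    also have "(\<Sum>i<4. smult [:d i:] (cub (pj a) i)) = (\<Sum>i<4. smult [:d i:] (cub a i)) - (\<Sum>i<4. smult [:d i * d i:] (vpoly (w a)))"
      unfolding sum_subtractf[symmetric] by (intro sum.cong refl) (simp add: cub_pj smult_diff_right)
    also have "(\<Sum>i<4. smult [:d i * d i:] (vpoly (w a))) = smult [:\<Sum>i<4. d i * d i:] (vpoly (w a))"
      by (simp add: sum_lessThan_4 flip: smult_add_left)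
    also have "(\<Sum>i<4. smult [:d i:] (cub a i)) - smult [:\<Sum>i<4. d i * d i:] (vpoly (w a)) = 0"
      unfolding d1 w_vpoly by (simp flip: one_pCons)
    finally show ?thesis by (simp add: bil_def)
  qed
  have lin_pj: "linear pj"
    unfolding pj_def tup_def w_def
    by (rule linearI) (simp_all add: sum.distrib scaleR_add_right scaleR_sum_right algebra_simps)
  define sq where "sq = (bvec (q\<^sup>2) :: real ^ 7 idx)"
  define sq' where "sq' = (bvec (q'\<^sup>2) :: real ^ 7 idx)"
  define v where "v = (bvec q :: cubic)"
  define v' where "v' = (bvec q' :: cubic)"
  have v: "sos4 (T v) = sq" "sos4 (T v') = sq'"
    using q(1) q'(1) by (simp_all add: TT sq_def sq'_def v_def v'_def vpoly_bvec)
  define D where "D = (\<lambda>(a, s). 2 *\<^sub>R bil z a + s *\<^sub>R sq)"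
  have D: "linear D"
    unfolding D_def case_prod_beta
    by (rule linearI) (simp_all add: bil.add_right bil.scaleR_right scaleR_add_right scaleR_add_left mult.commute)
  have surj: "surj D"
  proof (rule linear_surj_if_no_normal[OF D])
    fix l' assume l': "\<And>y. l' \<bullet> D y = 0"
    have "l' \<bullet> bil z a = 0" for a using l'[of "(a, 0)"] by (simp add: D_def)
    then have "l' \<in> annihilator (cub z)" unfolding annihilator_bil by blast
    then obtain r where r: "l' = r *\<^sub>R l" using l(2) by blast
    have "l' \<bullet> sq = 0" using l'[of "(0, 1)"] by (simp add: D_def bil.zero_right)
    with r q(2) show "l' = 0" by (simp add: sq_def)
  qed
  \<comment> \<open>\<open>b\<close> realizes \<open>sq + sq'\<close> to first order: pairing with
    \<open>l\<close> gives 1 - 1 = 0 on the left and \<open>s0\<close> on the right.\<close>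
  obtain b s0 where bs: "sq + sq' = 2 *\<^sub>R bil z b + s0 *\<^sub>R sq"
    using surj unfolding D_def by (metis (no_types, lifting) surjD case_prod_conv surj_pair)
  have "l \<bullet> (sq + sq') = l \<bullet> (2 *\<^sub>R bil z b + s0 *\<^sub>R sq)" by (simp only: bs)
  then have "s0 = 0"
    using q(2) q'(2) l(1)[unfolded annihilator_bil, rule_format, of b]
    by (simp add: inner_add_right sq_def sq'_def)
  with bs have b: "2 *\<^sub>R bil z b = sq + sq'" by simp
  \<comment> \<open>For \<open>s < 0\<close> the step adds \<open>- s *\<^sub>R sq'\<close> and
    shifts \<open>a\<close> by \<open>s *\<^sub>R b\<close>. By the choice of \<open>b\<close> the
    linear terms sum to \<open>s *\<^sub>R sq\<close>, as for \<open>s \<ge> 0\<close>, so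
    \<open>D\<close> serves both sides.\<close>
  define E where "E = (\<lambda>(a, s). sos4 (pj (a + min s 0 *\<^sub>R b)))"
  have val: "sos4 z + D y + E y \<in> range sos4" for y
  proof (cases y)
    case (Pair a s)
    show ?thesis
    proof (cases "s \<ge> 0")
      case True
      have "sos4 (z + (pj a + sqrt s *\<^sub>R T v)) = sos4 z + 2 *\<^sub>R bil z a + (sos4 (pj a) + s *\<^sub>R sq)"
        unfolding sos4_add bil.add_right zpj bil.scaleR_right zT pjT sos4_scaleR v using True by simp
      then have "sos4 z + D y + E y = sos4 (z + (pj a + sqrt s *\<^sub>R T v))"
        using True Pair by (simp add: D_def E_def algebra_simps)
      then show ?thesis by blast
    next
      case False
      have "sos4 (z + (pj (a + s *\<^sub>R b) + sqrt (- s) *\<^sub>R T v'))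
          = sos4 z + 2 *\<^sub>R bil z (a + s *\<^sub>R b) + (sos4 (pj (a + s *\<^sub>R b)) + (- s) *\<^sub>R sq')"
        unfolding sos4_add bil.add_right[of z _ "_ *\<^sub>R T _"] zpj bil.scaleR_right zT pjT sos4_scaleR v
        using False by simp
      also have "2 *\<^sub>R bil z (a + s *\<^sub>R b) = 2 *\<^sub>R bil z a + s *\<^sub>R (2 *\<^sub>R bil z b)"
        by (simp add: bil.add_right bil.scaleR_right scaleR_add_right)
      finally have "sos4 z + D y + E y = sos4 (z + (pj (a + s *\<^sub>R b) + sqrt (- s) *\<^sub>R T v'))"
        unfolding b using False Pair by (simp add: D_def E_def algebra_simps min_def)
      then show ?thesis by blast
    qed
  qed
  have bpj: "bounded_linear pj" using lin_pj linear_conv_bounded_linear by blast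
  have contE: "continuous_on UNIV E"
    unfolding E_def case_prod_beta
    by (intro continuous_on_compose2[OF continuous_sos4[of UNIV]] bounded_linear.continuous_on[OF bpj] continuous_intros) auto
  obtain M where M0: "M \<ge> 0" and M: "\<And>a b. norm (bil a b) \<le> norm a * norm b * M"
    using bil.nonneg_bounded by blast
  obtain K where K: "K \<ge> 0" "\<And>a. norm (pj a) \<le> norm a * K"
    using bounded_linear.nonneg_bounded[OF bpj] by blast
  have bound: "norm (E y) \<le> (M * ((1 + norm b) * K)\<^sup>2) * (norm y)\<^sup>2" for y
  proof (cases y)
    case (Pair a s)
    have "norm (a + min s 0 *\<^sub>R b) \<le> norm a + \<bar>s\<bar> * norm b"
      by (rule order_trans[OF norm_triangle_ineq]) (auto simp: min_def intro: mult_right_mono)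
    also have "\<dots> \<le> norm y + norm y * norm b"
      unfolding Pair using norm_fst_le[of a s] norm_snd_le[of s a] by (intro add_mono mult_right_mono) auto
    finally have "norm (pj (a + min s 0 *\<^sub>R b)) \<le> ((1 + norm b) * norm y) * K"
      by (intro order_trans[OF K(2)] mult_right_mono K(1)) (simp add: algebra_simps)
    then have 1: "norm (pj (a + min s 0 *\<^sub>R b)) \<le> ((1 + norm b) * K) * norm y" by (simp add: mult_ac)
    have "norm (E y) \<le> (norm (pj (a + min s 0 *\<^sub>R b)))\<^sup>2 * M"
      using M[of "pj (a + min s 0 *\<^sub>R b)" "pj (a + min s 0 *\<^sub>R b)"]
      by (simp add: E_def Pair sos4_bil power2_eq_square)
    also have "\<dots> \<le> (((1 + norm b) * K) * norm y)\<^sup>2 * M"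
      using 1 M0 by (intro mult_mono power_mono) auto
    finally show ?thesis by (simp add: power_mult_distrib mult_ac)
  qed
  show ?thesis
    by (rule open_at_if_quadratic_remainder[OF D surj contE bound val])
qed

text \<open>A normal \<open>l\<close> of the derivative vanishes at the interior point
  \<open>sos4 z\<close>, so neither \<open>l\<close> nor \<open>- l\<close> is nonnegative on
  squares; rescaling gives the \<open>q\<close> and \<open>q'\<close> of the corank-one
  case.\<close>

lemma open_at_base_point_free:
  assumes bpf: "base_point_free (cub z)" and int: "sos4 z \<in> interior sos_cone"
  shows "sos4 z \<in> interior (range sos4)"
proof (cases "annihilator (cub z) \<subseteq> {0}")
  case False
  then obtain l where l: "l \<in> annihilator (cub z)" "l \<noteq> 0" by blast
  have lz: "l \<bullet> sos4 z = 0" using l(1) unfolding annihilator_bil sos4_bil by blast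
  have pick: "\<exists>q\<in>bpoly 3. m \<bullet> bvec (q\<^sup>2) = - 1" if m: "m \<noteq> 0" "m \<bullet> sos4 z = 0" for m
  proof -
    obtain q where q: "q \<in> bpoly 3" "m \<bullet> bvec (q\<^sup>2) < 0"
      using interior_sos_cone_pos[OF int m(1)] m(2) by force
    define r where "r = 1 / sqrt (- (m \<bullet> bvec (q\<^sup>2)))"
    have "bvec ((smult [:r:] q)\<^sup>2) = (r * r) *\<^sub>R (bvec (q\<^sup>2) :: real ^ 7 idx)"
    proof -
      have "(smult [:r:] q)\<^sup>2 = smult [:of_real (r * r):] (q\<^sup>2)" by (simp add: power2_eq_square)
      then show ?thesis by (simp only: bvec_scaleR)
    qed
    moreover have "r * r = 1 / (- (m \<bullet> bvec (q\<^sup>2)))" using q(2) by (simp add: r_def)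
    ultimately have "m \<bullet> bvec ((smult [:r:] q)\<^sup>2) = - 1" using q(2) by simp
    with q(1) bpoly_smult show ?thesis by blast
  qed
  obtain q' where q': "q' \<in> bpoly 3" "l \<bullet> bvec (q'\<^sup>2) = - 1" using pick[OF l(2) lz] by blast
  obtain q where q: "q \<in> bpoly 3" "(- l) \<bullet> bvec (q\<^sup>2) = - 1" using pick[of "- l"] l(2) lz by auto
  obtain c where c: "(\<Sum>i<4. smult [:c i:] (cub z i)) = 0" "\<exists>i<4. c i \<noteq> (0::real)"
    using base_point_free.annihilator_dependent[OF bpf l] by blast
  show ?thesis
  proof (rule open_at_corank_one[OF c l(1) _ q(1) _ q'])
    show "\<exists>r. l' = r *\<^sub>R l" if "l' \<in> annihilator (cub z)" for l'
      using base_point_free.annihilator_dim_le_1[OF bpf l(1) that l(2)] by blast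
  qed (use q(2) in simp)
qed (rule open_at_regular)

section \<open>Forms with a non-real singular point\<close>

definition bpolyfun :: "('a::euclidean_space \<Rightarrow> real poly poly) \<Rightarrow> bool" where
  "bpolyfun F \<longleftrightarrow> (\<forall>i j. real_polynomial_function (\<lambda>t. coeff (coeff (F t) i) j))"

lemma bpolyfun_const: "bpolyfun (\<lambda>t. p)"
  by (simp add: bpolyfun_def real_polynomial_function.intros(2))

lemma bpolyfun_add: "bpolyfun F \<Longrightarrow> bpolyfun G \<Longrightarrow> bpolyfun (\<lambda>t. F t + G t)"
  by (simp add: bpolyfun_def real_polynomial_function.intros(3))

lemma bpolyfun_mult: "bpolyfun F \<Longrightarrow> bpolyfun G \<Longrightarrow> bpolyfun (\<lambda>t. F t * G t)"
  by (simp add: bpolyfun_def coeff_mult coeff_sum real_polynomial_function_sum real_polynomial_function.intros(4))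

lemma bpolyfun_scalar: "real_polynomial_function f \<Longrightarrow> bpolyfun (\<lambda>t. [:[:f t:]:])"
  unfolding bpolyfun_def
proof (intro allI)
  fix i j assume "real_polynomial_function f"
  then show "real_polynomial_function (\<lambda>t. coeff (coeff [:[:f t:]:] i) j)"
    by (cases i; cases j) (simp_all add: real_polynomial_function.intros(2))
qed

lemma bpolyfun_diff: "bpolyfun F \<Longrightarrow> bpolyfun G \<Longrightarrow> bpolyfun (\<lambda>t. F t - G t)"
  by (simp add: bpolyfun_def real_polynomial_function_diff)

lemma bpolyfun_power: "bpolyfun F \<Longrightarrow> bpolyfun (\<lambda>t. F t ^ n)"
  by (induction n) (auto intro: bpolyfun_mult bpolyfun_const)

lemma bpolyfun_vpoly:
  assumes "bounded_linear (g :: 'a::euclidean_space \<Rightarrow> real ^ 'n::finite idx)"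
  shows "bpolyfun (\<lambda>t. vpoly (g t))"
  unfolding bpolyfun_def
proof (intro allI)
  fix i j
  have lin: "real_polynomial_function (\<lambda>t. g t $ k)" for k
    using bounded_linear_compose[OF bounded_linear_vec_nth assms] by (rule real_polynomial_function.intros(1))
  have "coeff (coeff (vpoly (g t)) i) j = (\<Sum>k\<in>UNIV. (if ix k = i \<and> iy k = j then 1 else 0) * g t $ k)" for t
    unfolding vpoly_def coeff_sum by (intro sum.cong) (auto simp: coeff_monom)
  then show "real_polynomial_function (\<lambda>t. coeff (coeff (vpoly (g t)) i) j)"
    by (simp only:) (intro real_polynomial_function_sum real_polynomial_function.intros(4) real_polynomial_function.intros(2) lin finite)
qed

lemma polynomial_function_bvec:
  assumes "bpolyfun F"
  shows "polynomial_function (\<lambda>t. bvec (F t) :: real ^ 'n::finite idx)"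
  unfolding polynomial_function_iff_Basis_inner
proof
  fix b :: "real ^ 'n idx" assume "b \<in> Basis"
  then obtain k where "b = axis k 1" by (auto simp: Basis_vec_def)
  then show "real_polynomial_function (\<lambda>t. bvec (F t) \<bullet> b)"
    using assms by (simp add: inner_axis bpolyfun_def bvec_def)
qed

type_synonym chart_param =
  "(real \<times> real \<times> real \<times> real \<times> real \<times> real \<times> real \<times> real \<times> real \<times> real \<times> real) \<times> (real ^ 5 idx)"

text \<open>With \<open>m\<close> quadratic in \<open>K, L\<close> and \<open>t\<close> linear, \<open>m = t = 0\<close> is a pair of conjugate points, and
  the cubics vanishing there are the \<open>m l + t q\<close>. A sum of their squares has the form
  \<open>m\<^sup>2 Q + m t C + t\<^sup>2 E\<close>, where \<open>Q\<close> and \<open>C\<close> can be taken binary in \<open>K, L\<close>.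
  The number of parameters is \<open>2 + 2 + 3 + 4 + 15 = 26\<close>.\<close>

definition singular_form :: "real poly poly \<Rightarrow> real poly poly \<Rightarrow> real poly poly \<Rightarrow> chart_param \<Rightarrow> real poly poly" where
  "singular_form K L M = (\<lambda>((m1, m0, c, d, q2, q1, q0, c3, c2, c1, c0), e).
     let m = L\<^sup>2 + [:[:m1:]:] * L * K + [:[:m0:]:] * K\<^sup>2; t = M - [:[:c:]:] * K - [:[:d:]:] * L in
       m\<^sup>2 * ([:[:q2:]:] * L\<^sup>2 + [:[:q1:]:] * K * L + [:[:q0:]:] * K\<^sup>2) +
       m * t * ([:[:c3:]:] * L ^ 3 + [:[:c2:]:] * K * L\<^sup>2 + [:[:c1:]:] * K\<^sup>2 * L + [:[:c0:]:] * K ^ 3) +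
       t\<^sup>2 * vpoly e)"

text \<open>The position on the line through \<open>f\<close> is one more parameter: 26 + 1 = 27 <
  28.\<close>

lemma negligible_singular_cone:
  "negligible ((\<lambda>(t, r). f + r *\<^sub>R (bvec (singular_form K L M t) - f)) ` UNIV :: (real ^ 7 idx) set)"
proof (rule negligible_differentiable_image_lowdim)
  show "DIM(chart_param \<times> real) < DIM(real ^ 7 idx)"
    by (simp add: CARD_idx_numeral)
  have bp: "bpolyfun (\<lambda>z :: chart_param \<times> real. singular_form K L M (fst z))"
    unfolding singular_form_def case_prod_beta Let_def
    by (intro bpolyfun_add bpolyfun_mult bpolyfun_diff bpolyfun_power bpolyfun_const bpolyfun_scalar bpolyfun_vpoly
          real_polynomial_function.intros(1) bounded_linear_fst_comp bounded_linear_snd_comp bounded_linear_ident)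
  have "real_polynomial_function (\<lambda>z :: chart_param \<times> real. snd z)"
    by (intro real_polynomial_function.intros(1) bounded_linear_snd)
  then have "polynomial_function (\<lambda>z :: chart_param \<times> real. f + snd z *\<^sub>R (bvec (singular_form K L M (fst z)) - f))"
    using polynomial_function_bvec[OF bp]
    by (intro polynomial_function_add polynomial_function_const polynomial_function_mult polynomial_function_diff)
       (simp_all flip: real_polynomial_function_eq)
  then show "(\<lambda>(t, r). f + r *\<^sub>R (bvec (singular_form K L M t) - f)) differentiable_on UNIV"
    unfolding case_prod_beta by (rule differentiable_on_polynomial_function)
qed

text \<open>\<open>K, L, M\<close> is a permutation of the coordinates \<open>x, y, z\<close>, and \<open>ev n\<close> evaluates forms of degree \<open>n\<close>
  at a point normalized by \<open>K = 1\<close> whose coordinate \<open>L\<close> is not real.\<close>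

locale chart =
  fixes K L M :: "real poly poly" and ev :: "int \<Rightarrow> real poly poly \<Rightarrow> complex"
  assumes K: "K \<in> bpoly 1" and L: "L \<in> bpoly 1" and M: "M \<in> bpoly 1"
    and gen: "\<And>p n. p \<in> bpoly (int n + 1) \<Longrightarrow>
      \<exists>a b c. a \<in> bpoly (int n) \<and> b \<in> bpoly (int n) \<and> c \<in> bpoly (int n) \<and> p = a * K + b * L + c * M"
    and ev_add: "\<And>n p q. ev n (p + q) = ev n p + ev n q"
    and ev_mult: "\<And>m n p q. p \<in> bpoly m \<Longrightarrow> q \<in> bpoly n \<Longrightarrow> ev (m + n) (p * q) = ev m p * ev n q"
    and ev_const: "\<And>r. ev 0 [:[:r:]:] = of_real r"
    and evK: "ev 1 K = 1" and evL: "Im (ev 1 L) \<noteq> 0"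
begin

text \<open>At the point, 1 and the non-real value of \<open>L\<close> form a real basis of the
  complex numbers; \<open>cc\<close> and \<open>cd\<close> are the coordinates of the value of
  \<open>M\<close>. \<open>cm1\<close> and \<open>cm0\<close> are the coefficients of the monic real
  quadratic with the value of \<open>L\<close> as a root.\<close>

definition "cd = Im (ev 1 M) / Im (ev 1 L)"
definition "cc = Re (ev 1 M) - cd * Re (ev 1 L)"
definition "cm1 = - 2 * Re (ev 1 L)"
definition "cm0 = (Re (ev 1 L))\<^sup>2 + (Im (ev 1 L))\<^sup>2"
definition "t = M - [:[:cc:]:] * K - [:[:cd:]:] * L"
definition "m = L\<^sup>2 + [:[:cm1:]:] * L * K + [:[:cm0:]:] * K\<^sup>2"

lemma ev_smult: "p \<in> bpoly n \<Longrightarrow> ev n ([:[:r:]:] * p) = of_real r * ev n p"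
  using ev_mult[OF bpoly_const[of 0 r], of p n] by (simp add: ev_const)

lemma t_in: "t \<in> bpoly 1"
  unfolding t_def by (intro bpoly_diff M bpoly_mult_le[OF bpoly_const[of 0] K] bpoly_mult_le[OF bpoly_const[of 0] L]) auto

lemma KL_in: "K\<^sup>2 \<in> bpoly 2" "L\<^sup>2 \<in> bpoly 2" "L * K \<in> bpoly 2"
  using bpoly_mult[OF K K] bpoly_mult[OF L L] bpoly_mult[OF L K] by (simp_all add: power2_eq_square)

lemma m_in: "m \<in> bpoly 2"
  unfolding m_def mult.assoc by (intro bpoly_add KL_in(2) bpoly_mult_le[OF bpoly_const[of 0] KL_in(3)] bpoly_mult_le[OF bpoly_const[of 0] KL_in(1)]) auto

lemma ev_t: "ev 1 t = 0"
proof -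
  have "M = t + ([:[:cc:]:] * K + [:[:cd:]:] * L)" by (simp add: t_def)
  then have "ev 1 M = ev 1 t + (of_real cc + of_real cd * ev 1 L)"
    by (metis ev_add ev_smult[OF K] ev_smult[OF L] evK mult.right_neutral)
  moreover have "ev 1 M = of_real cc + of_real cd * ev 1 L"
    using evL by (simp add: complex_eq_iff cc_def cd_def)
  ultimately show ?thesis by simp
qed

lemma ev_m: "ev 2 m = 0"
proof -
  have "ev 2 m = (ev 1 L)\<^sup>2 + of_real cm1 * ev 1 L + of_real cm0"
    unfolding m_def mult.assoc ev_add ev_smult[OF KL_in(3)] ev_smult[OF KL_in(1)]
    using ev_mult[OF K K] ev_mult[OF L L] ev_mult[OF L K] by (simp add: power2_eq_square evK)
  also have "\<dots> = 0"
    by (simp add: complex_eq_iff cm1_def cm0_def power2_eq_square algebra_simps)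
  finally show ?thesis .
qed

text \<open>Modulo \<open>t\<close>, the coordinate \<open>M\<close> is a combination of
  \<open>K\<close> and \<open>L\<close>; iterating leaves binary forms in \<open>K\<close> and
  \<open>L\<close>.\<close>

lemma reduce_t:
  assumes "p \<in> bpoly (int n + 1)"
  obtains a b q where "a \<in> bpoly (int n)" "b \<in> bpoly (int n)" "q \<in> bpoly (int n)" "p = t * q + a * K + b * L"
proof -
  obtain a b q where abq: "a \<in> bpoly (int n)" "b \<in> bpoly (int n)" "q \<in> bpoly (int n)" "p = a * K + b * L + q * M"
    using gen[OF assms] by blast
  have sm: "[:[:r:]:] * q \<in> bpoly (int n)" for r by (rule bpoly_mult_le[OF bpoly_const[of 0] abq(3)]) auto
  show ?thesis
  proof (rule that)
    show "p = t * q + (a + [:[:cc:]:] * q) * K + (b + [:[:cd:]:] * q) * L"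
      unfolding abq(4) t_def by (simp only: algebra_simps)
  qed (use abq sm bpoly_add in auto)
qed

lemma reduce_t1:
  assumes "p \<in> bpoly 1"
  obtains q r s where "q \<in> bpoly 0" "p = t * q + [:[:r:]:] * K + [:[:s:]:] * L"
proof -
  obtain a b q where "a \<in> bpoly 0" "b \<in> bpoly 0" "q \<in> bpoly 0" "p = t * q + a * K + b * L"
    using reduce_t[of p 0] assms by auto
  then show ?thesis using bpoly_0_const that by metis
qed

lemma reduce_t2:
  assumes "p \<in> bpoly 2"
  obtains q r s u where "q \<in> bpoly 1" "p = t * q + [:[:r:]:] * L\<^sup>2 + [:[:s:]:] * K * L + [:[:u:]:] * K\<^sup>2"
proof -
  obtain a b q where 1: "a \<in> bpoly 1" "b \<in> bpoly 1" "q \<in> bpoly 1" "p = t * q + a * K + b * L"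
    using reduce_t[of p 1] assms by auto
  obtain qa ra sa where a: "qa \<in> bpoly 0" "a = t * qa + [:[:ra:]:] * K + [:[:sa:]:] * L"
    using reduce_t1[OF 1(1)] by blast
  obtain qb rb sb where b: "qb \<in> bpoly 0" "b = t * qb + [:[:rb:]:] * K + [:[:sb:]:] * L"
    using reduce_t1[OF 1(2)] by blast
  show ?thesis
  proof (rule that)
    show "q + qa * K + qb * L \<in> bpoly 1"
      using bpoly_mult[OF a(1) K] bpoly_mult[OF b(1) L] 1(3) by (simp add: bpoly_add)
    have "[:[:sa + rb:]:] = [:[:sa:]:] + [:[:rb:]:]" by simp
    then show "p = t * (q + qa * K + qb * L) + [:[:sb:]:] * L\<^sup>2 + [:[:sa + rb:]:] * K * L + [:[:ra:]:] * K\<^sup>2"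
      unfolding 1(4) a(2) b(2) by (simp only: algebra_simps power2_eq_square)
  qed
qed

lemma reduce_t3:
  assumes "p \<in> bpoly 3"
  obtains q r s u v where "q \<in> bpoly 2"
    "p = t * q + ([:[:v:]:] * L ^ 3 + [:[:u:]:] * K * L\<^sup>2 + [:[:s:]:] * K\<^sup>2 * L + [:[:r:]:] * K ^ 3)"
proof -
  obtain a b q where 1: "a \<in> bpoly 2" "b \<in> bpoly 2" "q \<in> bpoly 2" "p = t * q + a * K + b * L"
    using reduce_t[of p 2] assms by auto
  obtain qa ra sa ua where a: "qa \<in> bpoly 1" "a = t * qa + [:[:ra:]:] * L\<^sup>2 + [:[:sa:]:] * K * L + [:[:ua:]:] * K\<^sup>2"
    using reduce_t2[OF 1(1)] by blast
  obtain qb rb sb ub where b: "qb \<in> bpoly 1" "b = t * qb + [:[:rb:]:] * L\<^sup>2 + [:[:sb:]:] * K * L + [:[:ub:]:] * K\<^sup>2"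
    using reduce_t2[OF 1(2)] by blast
  show ?thesis
  proof (rule that)
    show "q + qa * K + qb * L \<in> bpoly 2"
      using bpoly_mult[OF a(1) K] bpoly_mult[OF b(1) L] 1(3) by (simp add: bpoly_add)
    have "[:[:ra + sb:]:] = [:[:ra:]:] + [:[:sb:]:]" "[:[:sa + ub:]:] = [:[:sa:]:] + [:[:ub:]:]" by simp_all
    then show "p = t * (q + qa * K + qb * L) + ([:[:rb:]:] * L ^ 3 + [:[:ra + sb:]:] * K * L\<^sup>2 +
        [:[:sa + ub:]:] * K\<^sup>2 * L + [:[:ua:]:] * K ^ 3)"
      unfolding 1(4) a(2) b(2) by (simp only: algebra_simps power2_eq_square power3_eq_cube)
  qed
qed

text \<open>Modulo \<open>t\<close> the cubic is binary. Dividing it by \<open>m\<close> leaves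
  \<open>K\<^sup>2\<close> times a real linear form in \<open>K\<close> and \<open>L\<close>, which
  cannot vanish at a non-real value of \<open>L\<close> unless it is zero.\<close>

lemma vanishing_cubic:
  assumes p: "p \<in> bpoly 3" and 0: "ev 3 p = 0"
  obtains q r s where "q \<in> bpoly 2" "p = m * ([:[:r:]:] * L + [:[:s:]:] * K) + t * q"
proof -
  obtain q r s u v where q: "q \<in> bpoly 2" and
    pq: "p = t * q + ([:[:v:]:] * L ^ 3 + [:[:u:]:] * K * L\<^sup>2 + [:[:s:]:] * K\<^sup>2 * L + [:[:r:]:] * K ^ 3)"
    by (rule reduce_t3[OF p])
  define a where "a = s - cm0 * v - cm1 * (u - v * cm1)"
  define b where "b = r - cm0 * (u - v * cm1)"
  have id: "V * L ^ 3 + U * K * L\<^sup>2 + S * K\<^sup>2 * L + R * K ^ 3 = (L\<^sup>2 + M1 * L * K + M0 * K\<^sup>2) * (V * L + (U - V * M1) * K) +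
      K\<^sup>2 * ((S - M0 * V - M1 * (U - V * M1)) * L + (R - M0 * (U - V * M1)) * K)" for V U S R M1 M0
    by (simp only: algebra_simps power2_eq_square power3_eq_cube)
  have C: "[:[:u - v * cm1:]:] = [:[:u:]:] - [:[:v:]:] * [:[:cm1:]:]"
    "[:[:a:]:] = [:[:s:]:] - [:[:cm0:]:] * [:[:v:]:] - [:[:cm1:]:] * ([:[:u:]:] - [:[:v:]:] * [:[:cm1:]:])"
    "[:[:b:]:] = [:[:r:]:] - [:[:cm0:]:] * ([:[:u:]:] - [:[:v:]:] * [:[:cm1:]:])"
    by (simp_all add: a_def b_def)
  have p2: "p = t * q + (m * ([:[:v:]:] * L + [:[:u - v * cm1:]:] * K) + K\<^sup>2 * ([:[:a:]:] * L + [:[:b:]:] * K))"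
    unfolding pq id[of _ _ _ _ "[:[:cm1:]:]" "[:[:cm0:]:]"] m_def C ..
  have lin: "[:[:x:]:] * L + [:[:y:]:] * K \<in> bpoly 1" for x y
    by (intro bpoly_add bpoly_mult_le[OF bpoly_const[of 0] L] bpoly_mult_le[OF bpoly_const[of 0] K]) auto
  have "ev 3 p = ev 1 t * ev 2 q + (ev 2 m * ev 1 ([:[:v:]:] * L + [:[:u - v * cm1:]:] * K) +
      ev 1 K * ev 1 K * ev 1 ([:[:a:]:] * L + [:[:b:]:] * K))"
    unfolding p2 ev_add using ev_mult[OF t_in q] ev_mult[OF m_in lin] ev_mult[OF KL_in(1) lin] ev_mult[OF K K]
    by (simp add: power2_eq_square ev_add)
  then have "of_real a * ev 1 L + of_real b = 0"
    using 0 by (simp only: ev_t ev_m evK ev_add ev_smult[OF K] ev_smult[OF L]) simp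
  then have "a = 0" "b = 0" using evL by (auto simp: complex_eq_iff)
  with p2 q show ?thesis by (intro that[of q v "u - v * cm1"]) simp_all
qed

text \<open>In the expanded squares of \<open>m * l i + t * q i\<close> the cross terms are reduced
  modulo \<open>t\<close>; the leftover \<open>m * t * (t * q')\<close> joins the
  \<open>t\<^sup>2\<close> part.\<close>

lemma sum_of_squares_singular:
  fixes n :: nat
  assumes p: "\<And>i. i < n \<Longrightarrow> p i \<in> bpoly 3" "\<And>i. i < n \<Longrightarrow> ev 3 (p i) = 0"
  shows "(\<Sum>i<n. (p i)\<^sup>2) \<in> range (singular_form K L M)"
proof -
  have "\<exists>q r s. q \<in> bpoly 2 \<and> p i = m * ([:[:r:]:] * L + [:[:s:]:] * K) + t * q" if i: "i < n" for i
  proof -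
    obtain q r s where "q \<in> bpoly 2" "p i = m * ([:[:r:]:] * L + [:[:s:]:] * K) + t * q"
      by (rule vanishing_cubic[OF p(1)[OF i] p(2)[OF i]])
    then show ?thesis by blast
  qed
  then have "\<forall>i. \<exists>q r s. i < n \<longrightarrow> q \<in> bpoly 2 \<and> p i = m * ([:[:r:]:] * L + [:[:s:]:] * K) + t * q" by blast
  then obtain q r s where qrs: "\<forall>i. i < n \<longrightarrow> q i \<in> bpoly 2 \<and> p i = m * ([:[:r i:]:] * L + [:[:s i:]:] * K) + t * q i"
    unfolding choice_iff by blast
  then have q: "\<And>i. i < n \<Longrightarrow> q i \<in> bpoly 2"
    and pi: "\<And>i. i < n \<Longrightarrow> p i = m * ([:[:r i:]:] * L + [:[:s i:]:] * K) + t * q i" by blast+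
  define l where "l i = [:[:r i:]:] * L + [:[:s i:]:] * K" for i
  have l: "l i \<in> bpoly 1" for i
    unfolding l_def
    by (intro bpoly_add bpoly_mult_le[OF bpoly_const[of 0] L] bpoly_mult_le[OF bpoly_const[of 0] K]) auto
  have "(\<Sum>i<n. [:[:2:]:] * (l i * q i)) \<in> bpoly 3"
    by (intro bpoly_sum bpoly_mult_le[OF bpoly_const[of 0]] bpoly_mult_le[OF l q]) auto
  then obtain q' c0 c1 c2 c3 where q': "q' \<in> bpoly 2" and
    lq: "(\<Sum>i<n. [:[:2:]:] * (l i * q i)) = t * q' + ([:[:c3:]:] * L ^ 3 + [:[:c2:]:] * K * L\<^sup>2 + [:[:c1:]:] * K\<^sup>2 * L + [:[:c0:]:] * K ^ 3)"
    by (rule reduce_t3)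
  define E where "E = (\<Sum>i<n. q i * q i) + m * q'"
  have "E \<in> bpoly 4"
    unfolding E_def using bpoly_mult[OF m_in q'] by (intro bpoly_add bpoly_sum bpoly_mult_le[OF q q]) auto
  then have vE: "vpoly (bvec E :: real ^ 5 idx) = E" by (intro vpoly_bvec) simp
  have C: "[:[:\<Sum>i<n. f i:]:] = (\<Sum>i<n. [:[:f i:]:])" for f :: "nat \<Rightarrow> real"
  proof (induction n)
    case (Suc n)
    show ?case unfolding sum.lessThan_Suc Suc.IH[symmetric] by simp
  qed simp
  have ll: "(\<Sum>i<n. l i * l i) = [:[:\<Sum>i<n. r i * r i:]:] * L\<^sup>2 + [:[:\<Sum>i<n. 2 * (r i * s i):]:] * K * L + [:[:\<Sum>i<n. s i * s i:]:] * K\<^sup>2"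
    unfolding C sum_distrib_right sum.distrib[symmetric]
  proof (intro sum.cong refl)
    fix i
    have "[:[:r i * r i:]:] = [:[:r i:]:] * [:[:r i:]:]" "[:[:s i * s i:]:] = [:[:s i:]:] * [:[:s i:]:]"
      "[:[:2 * (r i * s i):]:] = [:[:r i:]:] * [:[:s i:]:] + [:[:r i:]:] * [:[:s i:]:]" by simp_all
    then show "l i * l i = [:[:r i * r i:]:] * L\<^sup>2 + [:[:2 * (r i * s i):]:] * K * L + [:[:s i * s i:]:] * K\<^sup>2"
      unfolding l_def by (simp only: algebra_simps power2_eq_square)
  qed
  have two: "[:[:2:]:] * x = x + x" for x :: "real poly poly"
  proof -
    have "[:[:2:]:] = (1 + 1 :: real poly poly)" by (simp add: one_pCons)
    then show ?thesis by (simp only: distrib_right mult_1_left)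
  qed
  have "(\<Sum>i<n. (p i)\<^sup>2) = (\<Sum>i<n. m\<^sup>2 * (l i * l i) + m * t * ([:[:2:]:] * (l i * q i)) + t\<^sup>2 * (q i * q i))"
  proof (intro sum.cong refl)
    fix i assume "i \<in> {..<n}"
    then have "p i = m * l i + t * q i" using pi unfolding l_def by simp
    then show "(p i)\<^sup>2 = m\<^sup>2 * (l i * l i) + m * t * ([:[:2:]:] * (l i * q i)) + t\<^sup>2 * (q i * q i)"
      unfolding two by (simp only: algebra_simps power2_eq_square)
  qed
  also have "\<dots> = m\<^sup>2 * (\<Sum>i<n. l i * l i) + m * t * (\<Sum>i<n. [:[:2:]:] * (l i * q i)) + t\<^sup>2 * (\<Sum>i<n. q i * q i)"
    by (simp only: sum.distrib sum_distrib_left)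
  also have "\<dots> = m\<^sup>2 * (\<Sum>i<n. l i * l i) +
      m * t * ([:[:c3:]:] * L ^ 3 + [:[:c2:]:] * K * L\<^sup>2 + [:[:c1:]:] * K\<^sup>2 * L + [:[:c0:]:] * K ^ 3) + t\<^sup>2 * E"
    unfolding lq E_def by (simp only: algebra_simps power2_eq_square)
  also have "\<dots> = singular_form K L M ((cm1, cm0, cc, cd, \<Sum>i<n. r i * r i, \<Sum>i<n. 2 * (r i * s i), \<Sum>i<n. s i * s i, c3, c2, c1, c0), bvec E)"
    unfolding singular_form_def Let_def prod.case vE ll m_def t_def ..
  finally show ?thesis by blast
qed

end

section \<open>Charts for the non-real points of the plane\<close>

lemma bpoly_split:
  assumes "p \<in> bpoly (int n + 1)"
  obtains a b c where "a \<in> bpoly (int n)" "b \<in> bpoly (int n)" "c \<in> bpoly (int n)"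
    "p = a + b * [:0, 1:] + c * [:[:0, 1:]:]"
proof -
  obtain u b where p: "p = pCons u b" by (cases p)
  obtain a0 c0 where u: "u = pCons a0 c0" by (cases u)
  have b: "b \<in> bpoly (int n)"
  proof (rule bpolyI)
    fix i j assume "int i + int j > int n"
    then show "coeff (coeff b i) j = 0" using bpoly_coeff_0[OF assms, of "Suc i" j] by (simp add: p)
  qed
  have c: "[:c0:] \<in> bpoly (int n)"
  proof (rule bpolyI)
    fix i j assume "int i + int j > int n"
    then show "coeff (coeff [:c0:] i) j = 0"
      using bpoly_coeff_0[OF assms, of 0 "Suc j"] by (cases i) (simp_all add: p u)
  qed
  show ?thesis
  proof (rule that[OF bpoly_const b c])
    have "[:0, 1:] * b = pCons 0 b" "[:[:0, 1:]:] * [:c0:] = [:pCons 0 c0:]" by simp_all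
    then show "p = [:[:a0:]:] + b * [:0, 1:] + [:c0:] * [:[:0, 1:]:]"
      by (simp add: p u mult.commute)
  qed simp
qed

lemma aff_X [simp]: "aff [:0, 1:] x y = x" and aff_Y [simp]: "aff [:[:0, 1:]:] x y = y"
  and aff_1 [simp]: "aff 1 x y = 1"
  for x y :: "'a::comm_semiring_1"
  by (simp_all add: aff_def)

lemma cpoly_gen [simp]: "cpoly [:0, 1:] = [:0, 1:]" "cpoly [:[:0, 1:]:] = [:[:0, 1:]:]" "cpoly 1 = 1"
  "cpoly [:[:r:]:] = [:[:of_real r:]:]"
  by (simp_all add: cpoly_def map_poly_pCons one_pCons)

lemma chart_affine_x: "Im x \<noteq> 0 \<Longrightarrow> chart 1 [:0, 1:] [:[:0, 1:]:] (\<lambda>n p. aff (cpoly p) x y)"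
proof
  show "\<exists>a b c. a \<in> bpoly (int n) \<and> b \<in> bpoly (int n) \<and> c \<in> bpoly (int n) \<and> p = a * 1 + b * [:0, 1:] + c * [:[:0, 1:]:]"
    if "p \<in> bpoly (int n + 1)" for p :: "real poly poly" and n
    using bpoly_split[OF that] by (metis mult.right_neutral)
qed (simp_all add: bpoly_1 bpoly_X bpoly_Y cpoly_add cpoly_mult del: mult_pCons_left mult_pCons_right)

lemma chart_affine_y: "Im y \<noteq> 0 \<Longrightarrow> chart 1 [:[:0, 1:]:] [:0, 1:] (\<lambda>n p. aff (cpoly p) x y)"
proof
  show "\<exists>a b c. a \<in> bpoly (int n) \<and> b \<in> bpoly (int n) \<and> c \<in> bpoly (int n) \<and> p = a * 1 + b * [:[:0, 1:]:] + c * [:0, 1:]"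
    if p: "p \<in> bpoly (int n + 1)" for p :: "real poly poly" and n
  proof -
    obtain a b c where "a \<in> bpoly (int n)" "b \<in> bpoly (int n)" "c \<in> bpoly (int n)" "p = a + b * [:0, 1:] + c * [:[:0, 1:]:]"
      by (rule bpoly_split[OF p])
    moreover from this(4) have "p = a * 1 + c * [:[:0, 1:]:] + b * [:0, 1:]" by (simp only: ac_simps mult_1_right)
    ultimately show ?thesis by blast
  qed
qed (simp_all add: bpoly_1 bpoly_X bpoly_Y cpoly_add cpoly_mult del: mult_pCons_left mult_pCons_right)

lemma top_form_gen: "top_form 1 [:0, 1:] = [:0, 1:]" "top_form 1 [:[:0, 1:]:] = 1" "top_form 0 [:[:c:]:] = [:c:]"
  for c :: "'a::comm_semiring_1"
  by (auto intro!: poly_eqI simp: coeff_top_form coeff_pCons one_pCons split: nat.split)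

lemma chart_infinity: "Im x \<noteq> 0 \<Longrightarrow> chart [:[:0, 1:]:] [:0, 1:] 1 (\<lambda>n p. poly (top_form n (cpoly p)) x)"
proof
  show "\<exists>a b c. a \<in> bpoly (int n) \<and> b \<in> bpoly (int n) \<and> c \<in> bpoly (int n) \<and> p = a * [:[:0, 1:]:] + b * [:0, 1:] + c * 1"
    if p: "p \<in> bpoly (int n + 1)" for p :: "real poly poly" and n
  proof -
    obtain a b c where "a \<in> bpoly (int n)" "b \<in> bpoly (int n)" "c \<in> bpoly (int n)" "p = a + b * [:0, 1:] + c * [:[:0, 1:]:]"
      by (rule bpoly_split[OF p])
    moreover from this(4) have "p = c * [:[:0, 1:]:] + b * [:0, 1:] + a * 1" by (simp only: ac_simps mult_1_right)
    ultimately show ?thesis by blast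
  qed
  show "poly (top_form (m + n) (cpoly (p * q))) x = poly (top_form m (cpoly p)) x * poly (top_form n (cpoly q)) x"
    if "p \<in> bpoly m" "q \<in> bpoly n" for m n p q
    by (simp add: cpoly_mult top_form_mult cpoly_in that)
qed (simp_all add: bpoly_1 bpoly_X bpoly_Y cpoly_add top_form_add top_form_gen)

section \<open>Excluding real common zeros\<close>

lemma linear_functional_bvec:
  fixes E :: "real poly poly \<Rightarrow> real"
  assumes add: "\<And>p q. E (p + q) = E p + E q" and scale: "\<And>r p. E (smult [:r:] p) = r * E p"
  shows "\<exists>l :: real ^ 7 idx. \<forall>h\<in>bpoly 6. E h = l \<bullet> bvec h"
proof -
  have E0: "E 0 = 0" using scale[of 0 0] by simp
  have sum: "E (sum f I) = (\<Sum>i\<in>I. E (f i))" for f :: "7 idx \<Rightarrow> _" and I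
    by (induction I rule: infinite_finite_induct) (auto simp: add E0)
  have "E h = (\<chi> k. E (monom (monom 1 (iy k)) (ix k))) \<bullet> (bvec h :: real ^ 7 idx)" if "h \<in> bpoly 6" for h
  proof -
    have "E h = E (vpoly (bvec h :: real ^ 7 idx))" using that by (subst vpoly_bvec) auto
    also have "\<dots> = (\<Sum>k\<in>UNIV. E (smult [:(bvec h :: real ^ 7 idx) $ k:] (monom (monom 1 (iy k)) (ix k))))"
      by (simp add: vpoly_def sum smult_monom)
    finally show ?thesis by (simp add: scale inner_vec_def mult.commute)
  qed
  then show ?thesis by blast
qed

text \<open>\<open>e\<close> and \<open>E\<close> stand for evaluation of cubics and sextics at one
  real point, abstractly enough to cover [1:0:0], [x:1:0] and affine points; \<open>h\<close> shows
  that \<open>E\<close> is not zero. \<open>E\<close> is positive at an interior point, but it is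
  also the sum of the squares of the values of \<open>e\<close>.\<close>

lemma no_real_zero:
  assumes int: "sos4 z \<in> interior sos_cone"
    and add: "\<And>p q. E (p + q) = E p + E q" and scale: "\<And>r p. E (smult [:r:] p) = r * E p"
    and sq: "\<And>q. q \<in> bpoly 3 \<Longrightarrow> E (q\<^sup>2) = (e q)\<^sup>2" and nz: "h \<in> bpoly 6" "E h \<noteq> 0"
  shows "\<exists>i<4. e (cub z i) \<noteq> (0::real)"
proof (rule ccontr)
  assume "\<not> (\<exists>i<4. e (cub z i) \<noteq> 0)"
  then have 0: "e (cub z i) = 0" if "i < 4" for i using that by blast
  obtain l :: "real ^ 7 idx" where l: "\<And>h. h \<in> bpoly 6 \<Longrightarrow> E h = l \<bullet> bvec h"
    using linear_functional_bvec[of E, OF add scale] by blast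
  have q6: "q\<^sup>2 \<in> bpoly 6" if "q \<in> bpoly 3" for q :: "real poly poly"
    using bpoly_mult[OF that that] by (simp add: power2_eq_square)
  have "l \<noteq> 0" using nz l by auto
  moreover have "l \<bullet> bvec (q\<^sup>2) \<ge> 0" if "q \<in> bpoly 3" for q
    using l[OF q6[OF that]] sq[OF that] by (metis zero_le_power2)
  ultimately have "l \<bullet> sos4 z > 0" by (rule interior_sos_cone_pos[OF int])
  moreover have "l \<bullet> sos4 z = (\<Sum>i<4. l \<bullet> bvec ((cub z i)\<^sup>2))"
    by (simp add: sos4_def bvec_sum inner_sum_right)
  moreover have "l \<bullet> bvec ((cub z i)\<^sup>2) = 0" if "i < 4" for i
    using l[OF q6[OF cub_in]] sq[OF cub_in] 0[OF that] by (metis power_zero_numeral)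
  ultimately show False by simp
qed

lemma cpoly_monom: "cpoly (monom (monom c j) i) = monom (monom (of_real c) j) i"
  by (rule poly_poly_eqI) (simp add: coeff_monom)

lemma aff_cpoly_real: "p \<in> bpoly m \<Longrightarrow> aff (cpoly p) (of_real x) (of_real y) = of_real (aff p x y)"
proof (induction p rule: bpoly_induct)
  case (monom i j c)
  then show ?case by (simp add: cpoly_monom aff_def poly_monom poly_power)
qed (simp_all add: cpoly_add)

lemma top_cpoly_real: "p \<in> bpoly m \<Longrightarrow> poly (top_form m (cpoly p)) (of_real x) = of_real (poly (top_form m p) x)"
proof (induction p rule: bpoly_induct)
  case (monom i j c)
  then show ?case by (simp add: cpoly_monom top_form_monom poly_monom)
qed (simp_all add: cpoly_add top_form_add)

text \<open>Evaluation at [1:0:0] takes the x^3 coefficient of a cubic and the x^6 coefficient of a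
  sextic.\<close>

lemma coeff_square_corner:
  fixes q :: "real poly poly"
  assumes "q \<in> bpoly 3"
  shows "coeff (coeff (q\<^sup>2) 6) 0 = (coeff (coeff q 3) 0)\<^sup>2"
proof -
  have z: "coeff (coeff q i) 0 = 0" if "i > 3" for i using bpoly_coeff_0[OF assms, of i 0] that by simp
  have "coeff (coeff (q\<^sup>2) 6) 0 = (\<Sum>i\<le>6. coeff (coeff q i) 0 * coeff (coeff q (6 - i)) 0)"
    by (simp add: power2_eq_square coeff_mult coeff_sum)
  also have "\<dots> = (\<Sum>i\<le>6::nat. if i = 3 then (coeff (coeff q 3) 0)\<^sup>2 else 0)"
  proof (intro sum.cong refl)
    fix i :: nat
    show "coeff (coeff q i) 0 * coeff (coeff q (6 - i)) 0 = (if i = 3 then (coeff (coeff q 3) 0)\<^sup>2 else 0)"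
      using z[of i] z[of "6 - i"] by (cases "i = 3"; cases "i > 3") (auto simp: power2_eq_square)
  qed
  finally show ?thesis by simp
qed

text \<open>In order: affine points with x not real, affine points with y not real, points [x:1:0]
  with x not real. The remaining point [1:0:0] is real, so all non-real points are covered.\<close>

definition singular_locus :: "(real ^ 7 idx) set" where
  "singular_locus = bvec ` (range (singular_form 1 [:0, 1:] [:[:0, 1:]:]) \<union>
     range (singular_form 1 [:[:0, 1:]:] [:0, 1:]) \<union> range (singular_form [:[:0, 1:]:] [:0, 1:] 1))"

lemma base_point_free_or_singular:
  assumes int: "sos4 z \<in> interior sos_cone"
  shows "base_point_free (cub z) \<or> sos4 z \<in> singular_locus"
proof (rule ccontr)
  assume neg: "\<not> (base_point_free (cub z) \<or> sos4 z \<in> singular_locus)"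
  have sing: "sos4 z \<in> bvec ` range (singular_form K L M)"
    if "chart K L M ev" "\<And>i. i < 4 \<Longrightarrow> ev 3 (cub z i) = 0" for K L M ev
    using chart.sum_of_squares_singular[OF that(1), of 4 "cub z"] that(2) cub_in unfolding sos4_def by blast
  have "base_point_free (cub z)"
  proof
    show "cub z i \<in> bpoly 3" for i by (rule cub_in)
    show "\<exists>i<4. coeff (coeff (cub z i) 3) 0 \<noteq> 0"
      by (rule no_real_zero[OF int, where E = "\<lambda>h. coeff (coeff h 6) 0" and h = "monom (monom 1 0) 6"])
         (use bpoly_monom[of 6 0 6 "1::real"] in \<open>simp_all add: coeff_square_corner\<close>)
    show "\<exists>i<4. poly (top_form 3 (cpoly (cub z i))) x \<noteq> 0" for x
    proof (rule ccontr)
      assume "\<not> (\<exists>i<4. poly (top_form 3 (cpoly (cub z i))) x \<noteq> 0)"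
      then have 0: "poly (top_form 3 (cpoly (cub z i))) x = 0" if "i < 4" for i using that by blast
      have "Im x = 0"
        using sing[OF chart_infinity[of x]] 0 neg unfolding singular_locus_def by blast
      then have x: "x = of_real (Re x)" by (simp add: complex_eq_iff)
      have sq: "poly (top_form 6 (q\<^sup>2)) (Re x) = (poly (top_form 3 q) (Re x))\<^sup>2" if "q \<in> bpoly 3" for q
        using top_form_mult[OF that that] by (simp add: power2_eq_square)
      have "\<exists>i<4. poly (top_form 3 (cub z i)) (Re x) \<noteq> 0"
        by (rule no_real_zero[OF int, where E = "\<lambda>h. poly (top_form 6 h) (Re x)" and h = "monom (monom 1 6) 0"])
           (simp_all add: sq bpoly_monom top_form_monom top_form_add top_form_smult poly_monom)
      then obtain i where "i < 4" "poly (top_form 3 (cub z i)) (Re x) \<noteq> 0" by blast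
      with 0[of i] top_cpoly_real[OF cub_in, of z i "Re x"] x show False by simp
    qed
    show "\<exists>i<4. aff (cpoly (cub z i)) x y \<noteq> 0" for x y
    proof (rule ccontr)
      assume "\<not> (\<exists>i<4. aff (cpoly (cub z i)) x y \<noteq> 0)"
      then have 0: "aff (cpoly (cub z i)) x y = 0" if "i < 4" for i using that by blast
      have "Im x = 0" "Im y = 0"
        using sing[OF chart_affine_x[of x y]] sing[OF chart_affine_y[of y x]] 0 neg
        unfolding singular_locus_def by blast+
      then have xy: "x = of_real (Re x)" "y = of_real (Re y)" by (simp_all add: complex_eq_iff)
      have "\<exists>i<4. aff (cub z i) (Re x) (Re y) \<noteq> 0"
        by (rule no_real_zero[OF int, where E = "\<lambda>h. aff h (Re x) (Re y)" and h = 1])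
           (simp_all add: power2_eq_square bpoly_1)
      then obtain i where "i < 4" "aff (cub z i) (Re x) (Re y) \<noteq> 0" by blast
      with 0[of i] aff_cpoly_real[OF cub_in, of z i "Re x" "Re y"] xy show False by simp
    qed
  qed
  with neg show False by blast
qed

lemma negligible_singular_cone_locus:
  "negligible ((\<lambda>(d, r). f + r *\<^sub>R (d - f)) ` (singular_locus \<times> UNIV))"
proof -
  have "(\<lambda>(d, r). f + r *\<^sub>R (d - f)) ` (singular_locus \<times> UNIV) \<subseteq>
    (\<lambda>(t, r). f + r *\<^sub>R (bvec (singular_form 1 [:0, 1:] [:[:0, 1:]:] t) - f)) ` UNIV \<union>
    (\<lambda>(t, r). f + r *\<^sub>R (bvec (singular_form 1 [:[:0, 1:]:] [:0, 1:] t) - f)) ` UNIV \<union>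
    (\<lambda>(t, r). f + r *\<^sub>R (bvec (singular_form [:[:0, 1:]:] [:0, 1:] 1 t) - f)) ` UNIV"
    unfolding singular_locus_def by (auto simp: image_iff)
  then show ?thesis by (rule negligible_subset[rotated]) (intro negligible_Un negligible_singular_cone)
qed

section \<open>Every sum of squares of ternary cubics is a sum of four\<close>

lemma sos4_eq_0: "sos4 z = 0 \<Longrightarrow> z = 0"
proof (rule cubics_eqI)
  fix i assume z: "sos4 z = 0" and i: "i < (4::nat)"
  have s: "(\<Sum>i<4. (cub z i)\<^sup>2) = 0"
  proof (rule bvec_inject[where 'n = 7])
    show "(\<Sum>i<4. (cub z i)\<^sup>2) \<in> bpoly (int CARD(7) - 1)"
      using bpoly_mult[OF cub_in cub_in] by (intro bpoly_sum) (simp add: power2_eq_square)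
  qed (use z in \<open>simp_all add: sos4_def\<close>)
  have a0: "aff (cub z i) x y = 0" for x y
  proof -
    have "(\<Sum>i<4. (aff (cub z i) x y)\<^sup>2) = aff (\<Sum>i<4. (cub z i)\<^sup>2) x y"
      by (simp add: power2_eq_square)
    also have "\<dots> = 0" by (simp only: s aff_simps)
    finally show ?thesis using i by (simp add: sum_nonneg_eq_0_iff)
  qed
  have "poly (cub z i) [:x:] = 0" for x
    using a0 unfolding aff_def by (metis poly_all_0_iff_0)
  then have "range (\<lambda>x::real. [:x:]) \<subseteq> {u. poly (cub z i) u = 0}" by auto
  moreover have "inj (\<lambda>x::real. [:x:])" by (simp add: inj_def)
  then have "infinite (range (\<lambda>x::real. [:x:]))" using finite_imageD infinite_UNIV_char_0 by blast
  ultimately have "cub z i = 0" using poly_roots_finite finite_subset by blast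
  then have "pr i z = bvec 0" unfolding cub_def by (metis bvec_vpoly)
  then show "pr i z = pr i 0" by simp
qed

text \<open>\<open>sos4\<close> is homogeneous of degree 2 and nonzero on the unit sphere, so
  bounded values come from bounded tuples, and a limit lies in the image of a compact ball.\<close>

lemma closed_range_sos4: "closed (range sos4)"
proof -
  have "compact (sphere (0::cubics) 1)" by simp
  moreover have "continuous_on (sphere 0 1) (\<lambda>z. norm (sos4 z))"
    by (intro continuous_on_norm continuous_sos4)
  moreover have "sphere (0::cubics) 1 \<noteq> {}" by simp
  ultimately obtain w where w: "norm w = 1" "\<And>z. norm z = 1 \<Longrightarrow> norm (sos4 w) \<le> norm (sos4 z)"
    using continuous_attains_inf[of "sphere 0 1" "\<lambda>z. norm (sos4 z)"] by auto
  define c where "c = norm (sos4 w)"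
  have "c > 0" using sos4_eq_0[of w] w(1) by (auto simp: c_def)
  have low: "c * (norm z)\<^sup>2 \<le> norm (sos4 z)" for z
  proof (cases "z = 0")
    case False
    have "c \<le> norm (sos4 ((1 / norm z) *\<^sub>R z))" unfolding c_def using False by (intro w(2)) simp
    then show ?thesis using False by (simp add: sos4_scaleR field_simps)
  qed simp
  show ?thesis
    unfolding closed_sequential_limits
  proof (intro allI impI, elim conjE)
    fix f l assume f: "\<forall>n. f n \<in> range sos4" "f \<longlonglongrightarrow> l"
    then have "bounded (range f)" by (metis convergent_imp_bounded)
    then obtain B where B: "\<And>n. norm (f n) \<le> B" unfolding bounded_iff by blast
    have "f n \<in> sos4 ` cball 0 (sqrt (B / c))" for n
    proof -
      obtain z where z: "f n = sos4 z" using f(1) by blast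
      have "c * (norm z)\<^sup>2 \<le> B" using low[of z] B[of n] z by simp
      then have "(norm z)\<^sup>2 \<le> B / c" using \<open>c > 0\<close> by (simp add: field_simps)
      then have "norm z \<le> sqrt (B / c)" by (rule real_le_rsqrt)
      then show ?thesis unfolding z by simp
    qed
    moreover have "closed (sos4 ` cball 0 (sqrt (B / c)))"
      by (intro compact_imp_closed compact_continuous_image continuous_sos4) simp
    ultimately have "l \<in> sos4 ` cball 0 (sqrt (B / c))"
      using f(2) unfolding closed_sequential_limits by blast
    then show "l \<in> range sos4" by blast
  qed
qed

text \<open>The tuple x^3, y^3, z^3, xyz has no common zero because of the cubes and is independent,
  so \<open>annihilator_dependent\<close> makes it regular.\<close>

lemma interior_range_sos4_nonempty: "interior (range sos4) \<noteq> {}"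
proof -
  define g where "g i = (if i = 0 then monom (monom 1 0) 3 else if i = 1 then monom (monom 1 3) 0
    else if i = 2 then monom (monom 1 0) 0 else monom (monom 1 1) 1 :: real poly poly)" for i :: nat
  define z where "z = tup (\<lambda>i. bvec (g i))"
  have g: "g i \<in> bpoly 3" for i 
    using bpoly_monom[of 3 0 3 "1::real"] bpoly_monom[of 0 3 3 "1::real"] bpoly_monom[of 0 0 3 "1::real"]
      bpoly_monom[of 1 1 3 "1::real"] by (auto simp: g_def)
  have cz: "cub z i = g i" if "i < 4" for i
    unfolding z_def cub_tup[OF that] using g[of i] by (intro vpoly_bvec) simp
  have "base_point_free (cub z)"
  proof
    show "cub z i \<in> bpoly 3" for i by (rule cub_in)
    show "\<exists>i<4. coeff (coeff (cub z i) 3) 0 \<noteq> 0"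
      by (rule exI[of _ 0]) (simp add: cz g_def)
    show "\<exists>i<4. poly (top_form 3 (cpoly (cub z i))) x \<noteq> 0" for x
    proof -
      have g01: "cub z 0 = monom (monom 1 0) 3" "cub z 1 = monom (monom 1 3) 0"
        by (simp_all add: cz g_def)
      have "top_form 3 (cpoly (cub z 0)) = monom 1 3"
        unfolding g01 cpoly_monom by (subst top_form_monom) simp_all
      moreover have "top_form 3 (cpoly (cub z 1)) = monom 1 0"
        unfolding g01 cpoly_monom by (subst top_form_monom) simp_all
      ultimately show ?thesis
        by (cases "x = 0") (auto simp: poly_monom intro: exI[of _ 0] exI[of _ 1])
    qed
    show "\<exists>i<4. aff (cpoly (cub z i)) x y \<noteq> 0" for x y
      by (rule exI[of _ 2]) (simp add: cz g_def cpoly_monom aff_def poly_monom)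
  qed
  note bpf = this
  have "annihilator (cub z) \<subseteq> {0}"
  proof (rule ccontr)
    assume "\<not> annihilator (cub z) \<subseteq> {0}"
    then obtain l where "l \<in> annihilator (cub z)" "l \<noteq> 0" by blast
    then obtain c :: "nat \<Rightarrow> real" where c: "(\<Sum>i<4. smult [:c i:] (cub z i)) = 0" "\<exists>i<4. c i \<noteq> 0"
      using base_point_free.annihilator_dependent[OF bpf] by blast
    have s: "smult [:c 0:] (g 0) + smult [:c 1:] (g 1) + smult [:c 2:] (g 2) + smult [:c 3:] (g 3) = 0"
      using c(1) by (simp only: sum_lessThan_4 cz)
    have "c 0 = 0" using arg_cong[OF s, of "\<lambda>p. coeff (coeff p 3) 0"] by (simp add: g_def coeff_monom coeff_pCons split: nat.splits)
    moreover have "c 1 = 0" using arg_cong[OF s, of "\<lambda>p. coeff (coeff p 0) 3"] by (simp add: g_def coeff_monom coeff_pCons split: nat.splits)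
    moreover have "c 2 = 0" using arg_cong[OF s, of "\<lambda>p. coeff (coeff p 0) 0"] by (simp add: g_def coeff_monom coeff_pCons split: nat.splits)
    moreover have "c 3 = 0" using arg_cong[OF s, of "\<lambda>p. coeff (coeff p 1) 1"] by (simp add: g_def coeff_monom coeff_pCons split: nat.splits)
    ultimately show False using c(2) all_less_4[of "\<lambda>i. c i = 0"] by auto
  qed
  then show ?thesis using open_at_regular by blast
qed

text \<open>Connectedness is applied to the segment without its endpoint \<open>f\<close>, which may
  itself be singular and is recovered as a limit.\<close>

lemma interior_sos_cone_subset: "interior sos_cone \<subseteq> range sos4"
proof
  fix f assume f: "f \<in> interior sos_cone"
  define U where "U = interior (range sos4)"
  have "\<not> U \<subseteq> (\<lambda>(d, r). f + r *\<^sub>R (d - f)) ` (singular_locus \<times> UNIV)"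
    using negligible_subset[OF negligible_singular_cone_locus[of f]] open_not_negligible[of U] interior_range_sos4_nonempty
    unfolding U_def by auto
  then obtain f0 where f0: "f0 \<in> U" and av: "\<And>d r. d \<in> singular_locus \<Longrightarrow> f0 \<noteq> f + r *\<^sub>R (d - f)"
    by (force simp: image_iff)
  define \<gamma> where "\<gamma> s = f + s *\<^sub>R (f0 - f)" for s :: real
  have "f0 \<in> interior sos_cone"
    using f0 interior_mono[OF range_sos4_subset] unfolding U_def by blast
  then have \<gamma>int: "\<gamma> s \<in> interior sos_cone" if "0 \<le> s" "s \<le> 1" for s
    using convexD_alt[OF convex_interior[OF convex_sos_cone] f _ that] by (simp add: \<gamma>_def algebra_simps)
  have \<gamma>U: "\<gamma> s \<in> U" if s: "0 < s" "s \<le> 1" and r: "\<gamma> s \<in> range sos4" for s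
  proof -
    obtain z where z: "\<gamma> s = sos4 z" using r by blast
    have "\<gamma> s \<notin> singular_locus"
    proof
      assume "\<gamma> s \<in> singular_locus"
      \<comment> \<open>A singular point of the segment would put \<open>f0\<close> on the line from
        \<open>f\<close> through it.\<close>
      moreover have "f0 = f + (1 / s) *\<^sub>R (\<gamma> s - f)" using s by (simp add: \<gamma>_def)
      ultimately show False using av by blast
    qed
    then have "base_point_free (cub z)"
      using base_point_free_or_singular[of z] \<gamma>int[of s] s unfolding z by auto
    then show ?thesis
      using open_at_base_point_free[of z] \<gamma>int[of s] s unfolding z U_def by auto
  qed
  have "connected (\<gamma> ` {0<..1})"
    unfolding \<gamma>_def by (intro connected_continuous_image continuous_intros) simp
  moreover have "\<gamma> ` {0<..1} \<subseteq> U \<union> - range sos4"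
  proof
    fix x assume "x \<in> \<gamma> ` {0<..1}"
    then obtain s where "0 < s" "s \<le> 1" "x = \<gamma> s" by auto
    with \<gamma>U[of s] show "x \<in> U \<union> - range sos4" by (cases "x \<in> range sos4") simp_all
  qed
  moreover have "U \<inter> - range sos4 \<inter> \<gamma> ` {0<..1} = {}" using interior_subset unfolding U_def by blast
  moreover have "open U" "open (- range sos4)" using closed_range_sos4 by (auto simp: U_def)
  moreover have "U \<inter> \<gamma> ` {0<..1} \<noteq> {}"
  proof -
    have "\<gamma> 1 = f0" by (simp add: \<gamma>_def)
    then have "f0 \<in> \<gamma> ` {0<..1}" by (metis greaterThanAtMost_iff imageI order_refl zero_less_one)
    with f0 show ?thesis by blast
  qed
  ultimately have "- range sos4 \<inter> \<gamma> ` {0<..1} = {}"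
    using connectedD[of "\<gamma> ` {0<..1}" U "- range sos4"] by blast
  then have sub: "\<gamma> ` {0<..1} \<subseteq> range sos4" by blast
  have "(\<lambda>n. \<gamma> (inverse (real (Suc n)))) \<longlonglongrightarrow> f + 0 *\<^sub>R (f0 - f)"
    unfolding \<gamma>_def by (intro tendsto_intros LIMSEQ_inverse_real_of_nat)
  moreover have "\<gamma> (inverse (real (Suc n))) \<in> range sos4" for n
    using sub by (rule subsetD) (auto simp: field_simps)
  ultimately show "f \<in> range sos4"
    using closed_range_sos4 unfolding closed_sequential_limits by fastforce
qed

text \<open>A convex set with nonempty interior lies in the closure of its interior.\<close>

lemma sos_cone_eq: "sos_cone = range sos4"
proof
  have "interior sos_cone \<noteq> {}"
    using interior_range_sos4_nonempty interior_mono[OF range_sos4_subset] by auto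
  then have "closure sos_cone = closure (interior sos_cone)"
    using convex_closure_interior[OF convex_sos_cone] by simp
  also have "\<dots> \<subseteq> range sos4"
    by (rule closure_minimal[OF interior_sos_cone_subset closed_range_sos4])
  finally show "sos_cone \<subseteq> range sos4" using closure_subset by blast
qed (rule range_sos4_subset)

lemma four_squares:
  fixes q :: "nat \<Rightarrow> real poly poly"
  assumes "\<And>i. i \<in> I \<Longrightarrow> q i \<in> bpoly 3"
  obtains p1 p2 p3 p4 where "p1 \<in> bpoly 3" "p2 \<in> bpoly 3" "p3 \<in> bpoly 3" "p4 \<in> bpoly 3"
    "(\<Sum>i\<in>I. (q i)\<^sup>2) = p1\<^sup>2 + p2\<^sup>2 + p3\<^sup>2 + p4\<^sup>2"
proof -
  obtain z where z: "bvec (\<Sum>i\<in>I. (q i)\<^sup>2) = sos4 z"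
    using sos_cone_sum[of I q] assms sos_cone_eq by blast
  have q6: "p\<^sup>2 \<in> bpoly 6" if "p \<in> bpoly 3" for p :: "real poly poly"
    using bpoly_mult[OF that that] by (simp add: power2_eq_square)
  have "(\<Sum>i\<in>I. (q i)\<^sup>2) = (\<Sum>i<4. (cub z i)\<^sup>2)"
  proof (rule bvec_inject[where 'n = 7])
    show "(\<Sum>i\<in>I. (q i)\<^sup>2) \<in> bpoly (int CARD(7) - 1)" using q6 assms by (intro bpoly_sum) simp
    show "(\<Sum>i<4. (cub z i)\<^sup>2) \<in> bpoly (int CARD(7) - 1)" using q6[OF cub_in] by (intro bpoly_sum) simp
  qed (use z in \<open>simp add: sos4_def\<close>)
  then show ?thesis
    by (intro that[of "cub z 0" "cub z 1" "cub z 2" "cub z 3"]) (simp_all only: cub_in sum_lessThan_4)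
qed

section \<open>Homogenization\<close>

definition mon :: "nat \<Rightarrow> nat \<Rightarrow> nat \<Rightarrow> (nat \<Rightarrow>\<^sub>0 nat)" where
  "mon a b c = Poly_Mapping.single 1 a + Poly_Mapping.single 2 b + Poly_Mapping.single 3 c"

lemma lookup_mon: "Poly_Mapping.lookup (mon a b c) n = (if n = 1 then a else if n = 2 then b else if n = 3 then c else 0)"
  by (simp add: mon_def lookup_add lookup_single when_def)

lemma mon_add: "mon a b c + mon a' b' c' = mon (a + a') (b + b') (c + c')"
  by (rule poly_mapping_eqI) (simp add: lookup_add lookup_mon)

lemma mon_eq_iff: "mon a b c = mon a' b' c' \<longleftrightarrow> a = a' \<and> b = b' \<and> c = c'"
proof
  assume eq: "mon a b c = mon a' b' c'"
  show "a = a' \<and> b = b' \<and> c = c'"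
    using arg_cong[OF eq, of "\<lambda>m. Poly_Mapping.lookup m 1"] arg_cong[OF eq, of "\<lambda>m. Poly_Mapping.lookup m 2"]
      arg_cong[OF eq, of "\<lambda>m. Poly_Mapping.lookup m 3"] by (simp add: lookup_mon)
qed simp

lemma keys_mon: "Poly_Mapping.keys (mon a b c) \<subseteq> {1..3}"
  by (auto simp: in_keys_iff lookup_mon split: if_splits)

lemma monom_degree_sum: "Poly_Mapping.keys m \<subseteq> {1..3} \<Longrightarrow>
    monom_degree m = Poly_Mapping.lookup m 1 + Poly_Mapping.lookup m 2 + Poly_Mapping.lookup m 3"
proof -
  assume "Poly_Mapping.keys m \<subseteq> {1..3}"
  then have "monom_degree m = (\<Sum>i\<in>{1..3}. Poly_Mapping.lookup m i)"
    unfolding monom_degree_def by (intro sum.mono_neutral_left) (auto simp: in_keys_iff)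
  then show ?thesis by (simp add: eval_nat_numeral)
qed

lemma monom_degree_mon: "monom_degree (mon a b c) = a + b + c"
  by (simp add: monom_degree_sum[OF keys_mon] lookup_mon)

lemma mon_lookup: "Poly_Mapping.keys m \<subseteq> {1..3} \<Longrightarrow>
    m = mon (Poly_Mapping.lookup m 1) (Poly_Mapping.lookup m 2) (Poly_Mapping.lookup m 3)"
proof (rule poly_mapping_eqI)
  fix n assume "Poly_Mapping.keys m \<subseteq> {1..3}"
  then have "n \<noteq> 1 \<Longrightarrow> n \<noteq> 2 \<Longrightarrow> n \<noteq> 3 \<Longrightarrow> Poly_Mapping.lookup m n = 0"
    by (force simp: in_keys_iff)
  then show "Poly_Mapping.lookup m n = Poly_Mapping.lookup (mon (Poly_Mapping.lookup m 1) (Poly_Mapping.lookup m 2) (Poly_Mapping.lookup m 3)) n"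
    by (auto simp: lookup_mon)
qed

text \<open>x, y, z become the variables with indices 1, 2, 3; the truncated subtraction in the
  exponent of z is exact because \<open>i + j < Suc e\<close>.\<close>

definition homogenize :: "nat \<Rightarrow> real poly poly \<Rightarrow> rpoly" where
  "homogenize e p = (\<Sum>(i, j)\<in>{(i, j). i + j < Suc e}. Poly_Mapping.single (mon i j (e - i - j)) (coeff (coeff p i) j))"

lemma homogenize_0 [simp]: "homogenize e 0 = 0"
  by (simp add: homogenize_def case_prod_beta)

lemma homogenize_add: "homogenize e (p + q) = homogenize e p + homogenize e q"
  by (simp add: homogenize_def case_prod_beta single_add sum.distrib)

lemma homogenize_sum: "homogenize e (sum f I) = (\<Sum>i\<in>I. homogenize e (f i))"
  by (induction I rule: infinite_finite_induct) (auto simp: homogenize_add)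

lemma homogenize_monom:
  assumes "i + j \<le> e"
  shows "homogenize e (monom (monom c j) i) = Poly_Mapping.single (mon i j (e - i - j)) c"
proof -
  have "homogenize e (monom (monom c j) i) =
      (\<Sum>k\<in>{(i, j). i + j < Suc e}. if k = (i, j) then Poly_Mapping.single (mon i j (e - i - j)) c else 0)"
    unfolding homogenize_def by (intro sum.cong) (auto simp: coeff_monom split: if_splits)
  then show ?thesis using assms finite_idx_set[of "Suc e"] by simp
qed

lemma homogenize_mult:
  assumes "p \<in> bpoly (int d)" "q \<in> bpoly (int e)"
  shows "homogenize (d + e) (p * q) = homogenize d p * homogenize e q"
  using assms(1)
proof (induction p rule: bpoly_induct)
  case (monom i j c)
  show ?case using assms(2)
  proof (induction q rule: bpoly_induct)
    case (monom k l b)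
    have "d + e - (i + k) - (j + l) = (d - i - j) + (e - k - l)"
      using monom \<open>int i + int j \<le> int d\<close> by auto
    moreover have "i + j \<le> d" "k + l \<le> e" using monom \<open>int i + int j \<le> int d\<close> by auto
    ultimately show ?case
      by (simp add: mult_monom homogenize_monom mult_single mon_add del: monom_0)
  qed (simp_all add: distrib_left homogenize_add)
qed (simp_all add: distrib_right homogenize_add)

lemma homogenize_in_forms: "homogenize e p \<in> forms 3 e"
  unfolding forms_def
proof (intro CollectI ballI)
  fix m assume "m \<in> Poly_Mapping.keys (homogenize e p)"
  then obtain k where "k \<in> {(i, j). i + j < Suc e}"
    "m \<in> Poly_Mapping.keys (case k of (i, j) \<Rightarrow> Poly_Mapping.single (mon i j (e - i - j)) (coeff (coeff p i) j))"
    unfolding homogenize_def using keys_sum by (metis (no_types, lifting) UN_E subsetD)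
  moreover obtain i j where "k = (i, j)" by (cases k)
  ultimately have "i + j \<le> e" "m = mon i j (e - i - j)"
    by (auto split: if_splits)
  then show "Poly_Mapping.keys m \<subseteq> {1..3} \<and> monom_degree m = e"
    using keys_mon by (simp add: monom_degree_mon)
qed

lemma lookup_homogenize:
  assumes "i + j \<le> e"
  shows "Poly_Mapping.lookup (homogenize e p) (mon i j (e - i - j)) = coeff (coeff p i) j"
proof -
  have "Poly_Mapping.lookup (homogenize e p) (mon i j (e - i - j)) =
      (\<Sum>k\<in>{(i, j). i + j < Suc e}. if k = (i, j) then coeff (coeff p i) j else 0)"
    unfolding homogenize_def lookup_sum
    by (intro sum.cong) (auto simp: lookup_single when_def mon_eq_iff split: if_splits)
  then show ?thesis using assms finite_idx_set[of "Suc e"] by simp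
qed

lemma homogenize_inject:
  assumes "p \<in> bpoly (int e)" "q \<in> bpoly (int e)" "homogenize e p = homogenize e q"
  shows "p = q"
proof (rule bpoly_eqI[OF assms(1,2)])
  fix i j assume "int i + int j \<le> int e"
  then have "i + j \<le> e" by simp
  then show "coeff (coeff p i) j = coeff (coeff q i) j" using lookup_homogenize assms(3) by metis
qed

lemma homogenize_surj:
  assumes f: "f \<in> forms 3 e"
  obtains p where "p \<in> bpoly (int e)" "homogenize e p = f"
proof
  define p where "p = (\<Sum>(i, j)\<in>{(i, j). i + j < Suc e}. monom (monom (Poly_Mapping.lookup f (mon i j (e - i - j))) j) i)"
  show "p \<in> bpoly (int e)"
    unfolding p_def by (intro bpoly_sum) (auto intro!: bpoly_monom)
  have hp: "homogenize e p = (\<Sum>(i, j)\<in>{(i, j). i + j < Suc e}. Poly_Mapping.single (mon i j (e - i - j)) (Poly_Mapping.lookup f (mon i j (e - i - j))))"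
    unfolding p_def homogenize_sum by (intro sum.cong) (auto simp: homogenize_monom simp del: monom_0)
  show "homogenize e p = f"
  proof (rule poly_mapping_eqI)
    fix m
    show "Poly_Mapping.lookup (homogenize e p) m = Poly_Mapping.lookup f m"
    proof (cases "Poly_Mapping.keys m \<subseteq> {1..3} \<and> monom_degree m = e")
      case True
      define i j where "i = Poly_Mapping.lookup m 1" and "j = Poly_Mapping.lookup m 2"
      have ij: "i + j \<le> e" "m = mon i j (e - i - j)"
        using True mon_lookup[of m] monom_degree_sum[of m] by (auto simp: i_def j_def)
      have "Poly_Mapping.lookup (homogenize e p) m = (\<Sum>k\<in>{(i, j). i + j < Suc e}. if k = (i, j) then Poly_Mapping.lookup f m else 0)"
        unfolding hp lookup_sum ij(2) by (intro sum.cong) (auto simp: lookup_single when_def mon_eq_iff split: if_splits)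
      then show ?thesis using ij finite_idx_set[of "Suc e"] by simp
    next
      case False
      then have "m \<notin> Poly_Mapping.keys f" "m \<notin> Poly_Mapping.keys (homogenize e p)"
        using f homogenize_in_forms[of e p] unfolding forms_def by blast+
      then show ?thesis by (simp add: in_keys_iff)
    qed
  qed
qed

lemma homogenize_square: "p \<in> bpoly 3 \<Longrightarrow> homogenize 6 (p\<^sup>2) = (homogenize 3 p)\<^sup>2"
  using homogenize_mult[of p 3 p 3] by (simp add: power2_eq_square)

lemma square_in_bpoly: "p \<in> bpoly 3 \<Longrightarrow> p\<^sup>2 \<in> bpoly 6" for p :: "real poly poly"
  using bpoly_mult[of p 3 p 3] by (simp add: power2_eq_square)

lemma sum_of_squares_3_6_iff:
  "sum_of_squares 3 6 r f \<longleftrightarrow> (\<exists>p. (\<forall>i\<in>{1..r}. p i \<in> forms 3 3) \<and> f = (\<Sum>i = 1..r. (p i)\<^sup>2))"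
  unfolding sum_of_squares_def by auto

lemma sos_forms_four_squares:
  assumes "f \<in> sos_forms 3 6"
  obtains p1 p2 p3 p4 where "p1 \<in> forms 3 3" "p2 \<in> forms 3 3" "p3 \<in> forms 3 3" "p4 \<in> forms 3 3"
    "f = p1\<^sup>2 + p2\<^sup>2 + p3\<^sup>2 + p4\<^sup>2"
proof -
  obtain r where "sum_of_squares 3 6 r f" using assms unfolding sos_forms_def by blast
  then obtain P where P0: "\<forall>i\<in>{1..r}. P i \<in> forms 3 3" and P2: "f = (\<Sum>i = 1..r. (P i)\<^sup>2)"
    unfolding sum_of_squares_3_6_iff by blast
  note P = P0[THEN bspec] P2
  have "\<forall>i. \<exists>q. i \<in> {1..r} \<longrightarrow> q \<in> bpoly 3 \<and> homogenize 3 q = P i"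
  proof
    fix i show "\<exists>q. i \<in> {1..r} \<longrightarrow> q \<in> bpoly 3 \<and> homogenize 3 q = P i"
    proof (cases "i \<in> {1..r}")
      case True
      obtain q where "q \<in> bpoly (int 3)" "homogenize 3 q = P i"
        by (rule homogenize_surj[OF P(1)[OF True]])
      then show ?thesis by auto
    qed blast
  qed
  then obtain q where q: "\<And>i. i \<in> {1..r} \<Longrightarrow> q i \<in> bpoly 3" "\<And>i. i \<in> {1..r} \<Longrightarrow> homogenize 3 (q i) = P i"
    by metis
  obtain p1 p2 p3 p4 where p: "p1 \<in> bpoly 3" "p2 \<in> bpoly 3" "p3 \<in> bpoly 3" "p4 \<in> bpoly 3"
    "(\<Sum>i = 1..r. (q i)\<^sup>2) = p1\<^sup>2 + p2\<^sup>2 + p3\<^sup>2 + p4\<^sup>2"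
    by (rule four_squares[OF q(1)])
  have "f = homogenize 6 (\<Sum>i = 1..r. (q i)\<^sup>2)"
    unfolding P(2) homogenize_sum by (intro sum.cong refl) (simp add: homogenize_square q)
  then have "f = (homogenize 3 p1)\<^sup>2 + (homogenize 3 p2)\<^sup>2 + (homogenize 3 p3)\<^sup>2 + (homogenize 3 p4)\<^sup>2"
    unfolding p(5) homogenize_add by (simp add: homogenize_square p(1-4))
  then show ?thesis using that homogenize_in_forms by blast
qed

section \<open>A sextic of length four\<close>

text \<open>The squares of x^2 y, y^2 z, z^2 x and xyz, written at z = 1.\<close>

definition four_square_sextic :: "real poly poly" where
  "four_square_sextic = (monom (monom 1 1) 2)\<^sup>2 + (monom (monom 1 2) 0)\<^sup>2 + (monom (monom 1 0) 1)\<^sup>2 + (monom (monom 1 1) 1)\<^sup>2"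

lemma coeff_four_square_sextic:
  "coeff (coeff four_square_sextic i) j =
    (if (i, j) \<in> {(4, 2), (0, 4), (2, 0), (2, 2)} then 1 else 0)"
proof -
  have sq: "(monom (monom 1 b) a)\<^sup>2 = monom (monom (1::real) (b + b)) (a + a)" for a b
    by (simp only: power2_eq_square mult_monom mult_1)
  show ?thesis unfolding four_square_sextic_def sq coeff_add coeff_monom by auto
qed

text \<open>Only the monomials \<open>x\<^sup>2y, y\<^sup>2z, z\<^sup>2x, xyz\<close> can occur in squares summing to this form, and
  their ten products are distinct, so the Gram matrix of any representation is the identity.\<close>

lemma not_three_squares:
  fixes q :: "nat \<Rightarrow> real poly poly"
  assumes q: "q 1 \<in> bpoly 3" "q 2 \<in> bpoly 3" "q 3 \<in> bpoly 3"
  shows "(q 1)\<^sup>2 + (q 2)\<^sup>2 + (q 3)\<^sup>2 \<noteq> four_square_sextic"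
proof
  assume eq: "(q 1)\<^sup>2 + (q 2)\<^sup>2 + (q 3)\<^sup>2 = four_square_sextic"
  \<comment> \<open>The vector of coefficients of one monomial in the three cubics; inner products
    of these vectors are the Gram matrix entries.\<close>
  define A where "A i j = (coeff (coeff (q 1) i) j, coeff (coeff (q 2) i) j, coeff (coeff (q 3) i) j)" for i j
  have big: "A i j = 0" if "i + j > 3" for i j
    using that q by (simp add: A_def bpoly_coeff_0 zero_prod_def)
  have C: "(\<Sum>i\<le>m. \<Sum>j\<le>n. A i j \<bullet> A (m - i) (n - j)) = (if (m, n) \<in> {(4, 2), (0, 4), (2, 0), (2, 2)} then 1 else 0)" for m n
  proof -
    have "(\<Sum>i\<le>m. \<Sum>j\<le>n. A i j \<bullet> A (m - i) (n - j)) = coeff (coeff ((q 1)\<^sup>2 + (q 2)\<^sup>2 + (q 3)\<^sup>2) m) n"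
      by (simp add: A_def inner_prod_def power2_eq_square coeff_mult coeff_sum sum.distrib)
    then show ?thesis by (simp only: eq coeff_four_square_sextic)
  qed
  note expand = eval_nat_numeral big inner_commute
  \<comment> \<open>First x^3, y^3, z^3, the only sources of x^6, y^6, z^6. Then x^2 z, x y^2, y
    z^2: every other product equal to one of their squares has a cube as a factor, already ruled
    out.\<close>
  have z1: "A 3 0 = 0" using C[of 6 0] by (simp add: expand)
  have z2: "A 0 3 = 0" using C[of 0 6] by (simp add: expand)
  have z3: "A 0 0 = 0" using C[of 0 0] by simp
  have z4: "A 2 0 = 0" using C[of 4 0] z1 by (simp add: expand)
  have z5: "A 1 2 = 0" using C[of 2 4] z2 by (simp add: expand)
  have z6: "A 0 1 = 0" using C[of 0 2] z3 by (simp add: expand)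
  note z = z1 z2 z3 z4 z5 z6
  \<comment> \<open>The four surviving vectors will be orthonormal in a space of dimension three; a
    kernel vector of \<open>w\<close> gives the contradiction.\<close>
  define w where "w = (\<lambda>(a, b, c, d). a *\<^sub>R A 2 1 + b *\<^sub>R A 0 2 + c *\<^sub>R A 1 0 + (d :: real) *\<^sub>R A 1 1)"
  have diag: "A 2 1 \<bullet> A 2 1 = 1" "A 0 2 \<bullet> A 0 2 = 1" "A 1 0 \<bullet> A 1 0 = 1" "A 1 1 \<bullet> A 1 1 = 1"
    using C[of 4 2] C[of 0 4] C[of 2 0] C[of 2 2] z by (simp_all add: expand)
  have off: "A 2 1 \<bullet> A 0 2 = 0" "A 2 1 \<bullet> A 1 0 = 0" "A 2 1 \<bullet> A 1 1 = 0"
    "A 0 2 \<bullet> A 1 0 = 0" "A 0 2 \<bullet> A 1 1 = 0" "A 1 0 \<bullet> A 1 1 = 0"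
    using C[of 2 3] C[of 3 1] C[of 3 2] C[of 1 2] C[of 1 3] C[of 2 1] z by (simp_all add: expand)
  have "linear w"
    unfolding w_def by (rule linearI) (auto simp: algebra_simps)
  then obtain x where x: "x \<noteq> 0" "w x = 0"
    by (rule linear_kernel_nontrivial) simp
  obtain a b c d where abcd: "x = (a, b, c, d)" by (cases x) auto
  have eqs: "w x \<bullet> A 2 1 = a" "w x \<bullet> A 0 2 = b" "w x \<bullet> A 1 0 = c" "w x \<bullet> A 1 1 = d"
    using diag off off[THEN trans[OF inner_commute]] by (simp_all add: w_def abcd inner_add_left)
  have "a = 0" "b = 0" "c = 0" "d = 0"
    using eqs by (simp_all only: x(2) inner_zero_left)
  with x(1) show False by (simp add: abcd zero_prod_def)
qed

lemma sum_1_3: "(\<Sum>i = 1..3. f i) = f 1 + f 2 + f (3::nat)"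
  and sum_1_4: "(\<Sum>i = 1..4. f i) = f 1 + f 2 + f 3 + f (4::nat)"
  by (simp_all add: eval_nat_numeral)

lemma sum_of_squares_mono:
  assumes "sum_of_squares 3 6 r f" "r \<le> s"
  shows "sum_of_squares 3 6 s f"
proof -
  obtain p where p: "\<forall>i\<in>{1..r}. p i \<in> forms 3 3" "f = (\<Sum>i = 1..r. (p i)\<^sup>2)"
    using assms(1) unfolding sum_of_squares_3_6_iff by blast
  have 0: "0 \<in> forms 3 3" by (simp add: forms_def)
  have "f = (\<Sum>i = 1..s. (if i \<le> r then p i else 0)\<^sup>2)"
    unfolding p(2) using assms(2) by (intro sum.mono_neutral_cong_left) auto
  with p(1) 0 show ?thesis
    unfolding sum_of_squares_3_6_iff by (intro exI[of _ "\<lambda>i. if i \<le> r then p i else 0"]) auto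
qed

lemma sum_of_squares_4:
  assumes "f \<in> sos_forms 3 6"
  shows "sum_of_squares 3 6 4 f"
proof -
  obtain p1 p2 p3 p4 where p: "p1 \<in> forms 3 3" "p2 \<in> forms 3 3" "p3 \<in> forms 3 3" "p4 \<in> forms 3 3"
    "f = p1\<^sup>2 + p2\<^sup>2 + p3\<^sup>2 + p4\<^sup>2"
    by (rule sos_forms_four_squares[OF assms])
  then show ?thesis
    unfolding sum_of_squares_3_6_iff
    by (intro exI[of _ "\<lambda>i. if i = 1 then p1 else if i = 2 then p2 else if i = 3 then p3 else p4"])
       (simp add: sum_1_4[unfolded One_nat_def])
qed

lemma sextic_of_length_4:
  obtains f where "f \<in> sos_forms 3 6" "\<not> sum_of_squares 3 6 3 f"
proof -
  define f where "f = homogenize 6 four_square_sextic"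
  define h where "h i = (if i = 1 then monom (monom 1 1) 2 else if i = 2 then monom (monom 1 2) 0
    else if i = 3 then monom (monom 1 0) 1 else monom (monom 1 1) 1 :: real poly poly)" for i :: nat
  have h: "h i \<in> bpoly 3" for i
    using bpoly_monom[of 2 1 3 "1::real"] bpoly_monom[of 0 2 3 "1::real"] bpoly_monom[of 1 0 3 "1::real"]
      bpoly_monom[of 1 1 3 "1::real"] by (auto simp: h_def)
  have hv: "h 1 = monom (monom 1 1) 2" "h 2 = monom (monom 1 2) 0" "h 3 = monom (monom 1 0) 1" "h 4 = monom (monom 1 1) 1"
    by (simp_all add: h_def)
  have fh: "four_square_sextic = (h 1)\<^sup>2 + (h 2)\<^sup>2 + (h 3)\<^sup>2 + (h 4)\<^sup>2"
    unfolding hv four_square_sextic_def ..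
  have F6: "four_square_sextic \<in> bpoly 6"
    unfolding fh by (intro bpoly_add square_in_bpoly h)
  have "f = (\<Sum>i = 1..4. (homogenize 3 (h i))\<^sup>2)"
    unfolding f_def fh homogenize_add homogenize_square[OF h] sum_1_4 ..
  then have "sum_of_squares 3 6 4 f"
    unfolding sum_of_squares_3_6_iff
    by (intro exI[of _ "\<lambda>i. homogenize 3 (h i)"] conjI ballI homogenize_in_forms)
  moreover have "f \<in> forms 3 6" unfolding f_def by (rule homogenize_in_forms)
  ultimately have "f \<in> sos_forms 3 6" unfolding sos_forms_def by (intro CollectI conjI exI)
  moreover have "\<not> sum_of_squares 3 6 3 f"
  proof
    assume "sum_of_squares 3 6 3 f"
    then obtain p :: "nat \<Rightarrow> rpoly" where p0: "(\<forall>i\<in>{1..3}. p i \<in> forms 3 3) \<and> f = (\<Sum>i = 1..3. (p i)\<^sup>2)"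
      unfolding sum_of_squares_3_6_iff ..
    note p = p0[THEN conjunct1, THEN bspec] and f3 = p0[THEN conjunct2, unfolded sum_1_3]
    have "\<exists>q\<in>bpoly 3. homogenize 3 q = p i" if i: "i \<in> {1..3}" for i
    proof -
      obtain q where "q \<in> bpoly (int 3)" "homogenize 3 q = p i"
        by (rule homogenize_surj[OF p[OF i]])
      then show ?thesis by auto
    qed
    then have "\<exists>q\<in>bpoly 3. homogenize 3 q = p 1" "\<exists>q\<in>bpoly 3. homogenize 3 q = p 2" "\<exists>q\<in>bpoly 3. homogenize 3 q = p 3"
      by simp_all
    then obtain q1 q2 q3 where q: "q1 \<in> bpoly 3" "q2 \<in> bpoly 3" "q3 \<in> bpoly 3"
      "homogenize 3 q1 = p 1" "homogenize 3 q2 = p 2" "homogenize 3 q3 = p 3" by blast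
    have "homogenize 6 (q1\<^sup>2 + q2\<^sup>2 + q3\<^sup>2) = homogenize 6 four_square_sextic"
      using f3 unfolding f_def homogenize_add homogenize_square[OF q(1)] homogenize_square[OF q(2)]
        homogenize_square[OF q(3)] q(4-6) by simp
    moreover have "q1\<^sup>2 + q2\<^sup>2 + q3\<^sup>2 \<in> bpoly 6"
      by (intro bpoly_add square_in_bpoly q)
    ultimately have "q1\<^sup>2 + q2\<^sup>2 + q3\<^sup>2 = four_square_sextic"
      using F6 by (intro homogenize_inject[where e = 6]) simp_all
    then show False
      using not_three_squares[of "\<lambda>i. if i = 1 then q1 else if i = 2 then q2 else q3"] q(1-3) by simp
  qed
  ultimately show ?thesis by (rule that)
qed

theorem theorem4p1:
  shows "pythagoras_number 3 6 = 4 \<and>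
    (\<forall>f\<in>sos_forms 3 6. \<exists>p1\<in>forms 3 3. \<exists>p2\<in>forms 3 3. \<exists>p3\<in>forms 3 3. \<exists>p4\<in>forms 3 3.
       f = p1\<^sup>2 + p2\<^sup>2 + p3\<^sup>2 + p4\<^sup>2)"
proof
  have "sos_length 3 6 f \<le> 4" if "f \<in> sos_forms 3 6" for f
    unfolding sos_length_def by (rule Least_le) (rule sum_of_squares_4[OF that])
  then have "pythagoras_number 3 6 \<le> enat 4"
    unfolding pythagoras_number_def by (intro SUP_least) simp
  moreover obtain f where f: "f \<in> sos_forms 3 6" "\<not> sum_of_squares 3 6 3 f"
    by (rule sextic_of_length_4)
  have "sum_of_squares 3 6 (sos_length 3 6 f) f"
    unfolding sos_length_def by (rule LeastI) (rule sum_of_squares_4[OF f(1)])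
  \<comment> \<open>A shorter representation could be padded with zeros to three squares.\<close>
  then have "4 \<le> sos_length 3 6 f"
    using f(2) sum_of_squares_mono[of "sos_length 3 6 f" f 3] by (cases "sos_length 3 6 f \<le> 3") auto
  then have "enat 4 \<le> pythagoras_number 3 6"
    unfolding pythagoras_number_def by (intro SUP_upper2[OF f(1)]) simp
  ultimately show "pythagoras_number 3 6 = 4"
    by (simp add: numeral_eq_enat)
  show "\<forall>f\<in>sos_forms 3 6. \<exists>p1\<in>forms 3 3. \<exists>p2\<in>forms 3 3. \<exists>p3\<in>forms 3 3. \<exists>p4\<in>forms 3 3.
       f = p1\<^sup>2 + p2\<^sup>2 + p3\<^sup>2 + p4\<^sup>2"
    using sos_forms_four_squares by (metis (no_types, lifting))
qed

end
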